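(* A graph $G$ is a circuit in $M^*(2,2)$ if and only if $G$ is a connected graph that can be generated recursively from disjoint copies of base graphs by applying Henneberg $2$ moves within connected components and taking $1$-joins, $2$-joins or $3$-joins of different connected components.
   Context: Graphs are finite and simple (no loops, no multiple edges). A circuit in $M^*(2,2)$ (briefly, a circuit) is a graph $G=(V,E)$ with $|E|=2|V|-1$ such that every proper subgraph $H=(V',E')$ of $G$ (with $V'\neq\emptyset$) satisfies $|E'|\leq 2|V'|-2$. $K_4(a,b,c,d)$ denotes the complete graph on the vertex set $\{a,b,c,d\}$. Base graphs: (i) $K_5\setminus e$, the graph obtained from $K_5$ by deleting one edge; (ii) $K_4\sqcup K_4$, the graph formed by two copies of $K_4$ intersecting in exactly a single edge (and its two end-vertices); (iii) $K_4\veebar K_4$, the (unique up to isomorphism) graph formed from two copies of $K_4$ intersecting in exactly a single vertex by adding any one further edge (between two non-adjacent vertices). Henneberg $2$ move: choose an edge $uw$ and a vertex $z\notin\{u,w\}$; delete $uw$ and add a new vertex $v$ together with the edges $vu,vw,vz$. In the joins, $G_1,G_2$ are disjoint circuits. $1$-join: suppose $G_1$ contains an edge $a_1b_1$, and $G_2$ has a two-vertex cut $\{a_2,b_2\}$ such that $\{c_2,d_2\}$ is the vertex set of a component of $G_2\setminus\{a_2,b_2\}$ and $a_2,b_2,c_2,d_2$ induce $K_4(a_2,b_2,c_2,d_2)$. Then $G_1\oplus_1G_2$ is formed by removing the edge $a_1b_1$ from $G_1$, removing the vertices $c_2,d_2$ and the edge $a_2b_2$ from $G_2$, and identifying $a_1$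 with $a_2$ and $b_1$ with $b_2$. $2$-join: suppose that for $i=1,2$, $G_i$ has a two-vertex cut $\{a_i,b_i\}$ such that $\{c_i,d_i\}$ is the vertex set of a component of $G_i\setminus\{a_i,b_i\}$ and $a_i,b_i,c_i,d_i$ induce $K_4(a_i,b_i,c_i,d_i)$. Then $G_1\oplus_2G_2$ is formed by removing $c_1,d_1,c_2,d_2$, identifying $a_1$ with $a_2$ (as $a$) and $b_1$ with $b_2$ (as $b$), and keeping only one copy of the edge $ab$. $3$-join: suppose that for $i=1,2$, $G_i$ contains a vertex $v_i$ of degree $3$ with neighbour set $\{a_i,b_i,c_i\}$. Then $G_1\oplus_3G_2$ is formed by deleting $v_1,v_2$ and adding the edges $a_1a_2,b_1b_2,c_1c_2$. Recursive generation: start with a disjoint union of finitely many base graphs; at each step either apply a Henneberg $2$ move inside one connected component (all of $u,w,z$ in that component), or replace two different connected components by a $1$-, $2$- or $3$-join of them. *)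

theory Defs
  imports Main
begin

text \<open>Finite simple graphs; an edge is the two-element set of its end-vertices.\<close>

datatype 'v ugraph = Graph (verts: "'v set") (edges: "'v set set")

definition simple_graph :: "'v ugraph \<Rightarrow> bool" where
  "simple_graph G \<longleftrightarrow>
     finite (verts G) \<and> (\<forall>e\<in>edges G. e \<subseteq> verts G \<and> card e = 2)"

definition subgraph :: "'v ugraph \<Rightarrow> 'v ugraph \<Rightarrow> bool" where
  "subgraph H G \<longleftrightarrow> simple_graph H \<and> verts H \<subseteq> verts G \<and> edges H \<subseteq> edges G"

definition rename :: "('v \<Rightarrow> 'w) \<Rightarrow> 'v ugraph \<Rightarrow> 'w ugraph" where
  "rename f G = Graph (f ` verts G) ((\<lambda>e. f ` e) ` edges G)"

definition isomorphic :: "'v ugraph \<Rightarrow> 'w ugraph \<Rightarrow> bool" where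
  "isomorphic G H \<longleftrightarrow> (\<exists>f. inj_on f (verts G) \<and> H = rename f G)"

definition induced :: "'v ugraph \<Rightarrow> 'v set \<Rightarrow> 'v ugraph" where
  "induced G S = Graph (verts G \<inter> S) {e \<in> edges G. e \<subseteq> S}"

definition delete_verts :: "'v ugraph \<Rightarrow> 'v set \<Rightarrow> 'v ugraph" where
  "delete_verts G S = Graph (verts G - S) {e \<in> edges G. e \<inter> S = {}}"

definition delete_edge :: "'v ugraph \<Rightarrow> 'v set \<Rightarrow> 'v ugraph" where
  "delete_edge G e = Graph (verts G) (edges G - {e})"

definition add_edges :: "'v ugraph \<Rightarrow> 'v set set \<Rightarrow> 'v ugraph" where
  "add_edges G F = Graph (verts G) (edges G \<union> F)"

definition graph_union :: "'v ugraph \<Rightarrow> 'v ugraph \<Rightarrow> 'v ugraph" where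
  "graph_union G H = Graph (verts G \<union> verts H) (edges G \<union> edges H)"

definition complete_graph :: "'v set \<Rightarrow> 'v ugraph" where
  "complete_graph S = Graph S {e. e \<subseteq> S \<and> card e = 2}"

definition adjacent :: "'v ugraph \<Rightarrow> 'v \<Rightarrow> 'v \<Rightarrow> bool" where
  "adjacent G u v \<longleftrightarrow> {u, v} \<in> edges G"

definition neighbours :: "'v ugraph \<Rightarrow> 'v \<Rightarrow> 'v set" where
  "neighbours G v = {u. adjacent G v u}"

definition degree :: "'v ugraph \<Rightarrow> 'v \<Rightarrow> nat" where
  "degree G v = card {e \<in> edges G. v \<in> e}"

definition reachable :: "'v ugraph \<Rightarrow> 'v \<Rightarrow> 'v \<Rightarrow> bool" where
  "reachable G = (adjacent G)\<^sup>*\<^sup>*"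

text \<open>The empty graph is not counted as connected.\<close>

definition connected_graph :: "'v ugraph \<Rightarrow> bool" where
  "connected_graph G \<longleftrightarrow>
     verts G \<noteq> {} \<and> (\<forall>u\<in>verts G. \<forall>v\<in>verts G. reachable G u v)"

definition components :: "'v ugraph \<Rightarrow> 'v ugraph set" where
  "components G = {induced G {v. reachable G u v} | u. u \<in> verts G}"

definition vertex_cut :: "'v ugraph \<Rightarrow> 'v set \<Rightarrow> bool" where
  "vertex_cut G S \<longleftrightarrow> S \<subseteq> verts G \<and>
     (\<exists>u\<in>verts G - S. \<exists>v\<in>verts G - S. \<not> reachable (delete_verts G S) u v)"

text \<open>Circuits. The counts are taken in \<open>int\<close> so that subtraction does not truncate.\<close>

definition circuit :: "'v ugraph \<Rightarrow> bool" where
  "circuit G \<longleftrightarrow> simple_graph G \<and>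
     int (card (edges G)) = 2 * int (card (verts G)) - 1 \<and>
     (\<forall>H. subgraph H G \<and> H \<noteq> G \<and> verts H \<noteq> {} \<longrightarrow>
        int (card (edges H)) \<le> 2 * int (card (verts H)) - 2)"

text \<open>The base graphs \<open>K\<^sub>5 \ e\<close>, two copies of \<open>K\<^sub>4\<close> sharing exactly an edge, and two copies
  of \<open>K\<^sub>4\<close> sharing exactly a vertex with one further edge added.\<close>

inductive base_graph :: "'v ugraph \<Rightarrow> bool" where
  K5_minus_edge:
    "card S = 5 \<Longrightarrow> e \<in> edges (complete_graph S) \<Longrightarrow>
     base_graph (delete_edge (complete_graph S) e)"
| two_K4_edge:
    "card S = 4 \<Longrightarrow> card T = 4 \<Longrightarrow> card (S \<inter> T) = 2 \<Longrightarrow>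
     base_graph (graph_union (complete_graph S) (complete_graph T))"
| two_K4_vertex:
    "card S = 4 \<Longrightarrow> card T = 4 \<Longrightarrow> card (S \<inter> T) = 1 \<Longrightarrow>
     G = graph_union (complete_graph S) (complete_graph T) \<Longrightarrow>
     x \<in> verts G \<Longrightarrow> y \<in> verts G \<Longrightarrow> x \<noteq> y \<Longrightarrow> \<not> adjacent G x y \<Longrightarrow>
     base_graph (add_edges G {{x, y}})"

text \<open>\<open>{a, b}\<close> is a two-vertex cut, \<open>{c, d}\<close> spans a component of \<open>G \ {a, b}\<close>, and
  the four vertices induce \<open>K\<^sub>4(a, b, c, d)\<close>.\<close>

definition K4_end :: "'v ugraph \<Rightarrow> 'v \<Rightarrow> 'v \<Rightarrow> 'v \<Rightarrow> 'v \<Rightarrow> bool" where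
  "K4_end G a b c d \<longleftrightarrow>
     card {a, b, c, d} = 4 \<and>
     vertex_cut G {a, b} \<and>
     {c, d} \<in> verts ` components (delete_verts G {a, b}) \<and>
     induced G {a, b, c, d} = complete_graph {a, b, c, d}"

text \<open>In the first two joins the identifications are carried out by renaming
  \<open>a\<^sub>2, b\<^sub>2\<close> to \<open>a\<^sub>1, b\<^sub>1\<close>; since edges form a set, only one copy of the
  edge \<open>ab\<close> survives in the second.\<close>

inductive is_join :: "'v ugraph \<Rightarrow> 'v ugraph \<Rightarrow> 'v ugraph \<Rightarrow> bool" for G1 G2 where
  join1:
    "circuit G1 \<Longrightarrow> circuit G2 \<Longrightarrow> verts G1 \<inter> verts G2 = {} \<Longrightarrow>
     {a1, b1} \<in> edges G1 \<Longrightarrow> K4_end G2 a2 b2 c2 d2 \<Longrightarrow>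
     is_join G1 G2
       (graph_union (delete_edge G1 {a1, b1})
          (rename (id(a2 := a1, b2 := b1))
             (delete_edge (delete_verts G2 {c2, d2}) {a2, b2})))"
| join2:
    "circuit G1 \<Longrightarrow> circuit G2 \<Longrightarrow> verts G1 \<inter> verts G2 = {} \<Longrightarrow>
     K4_end G1 a1 b1 c1 d1 \<Longrightarrow> K4_end G2 a2 b2 c2 d2 \<Longrightarrow>
     is_join G1 G2
       (graph_union (delete_verts G1 {c1, d1})
          (rename (id(a2 := a1, b2 := b1)) (delete_verts G2 {c2, d2})))"
| join3:
    "circuit G1 \<Longrightarrow> circuit G2 \<Longrightarrow> verts G1 \<inter> verts G2 = {} \<Longrightarrow>
     v1 \<in> verts G1 \<Longrightarrow> degree G1 v1 = 3 \<Longrightarrow> neighbours G1 v1 = {a1, b1, c1} \<Longrightarrow>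
     v2 \<in> verts G2 \<Longrightarrow> degree G2 v2 = 3 \<Longrightarrow> neighbours G2 v2 = {a2, b2, c2} \<Longrightarrow>
     is_join G1 G2
       (add_edges (graph_union (delete_verts G1 {v1}) (delete_verts G2 {v2}))
          {{a1, a2}, {b1, b2}, {c1, c2}})"

inductive generation_step :: "'v ugraph \<Rightarrow> 'v ugraph \<Rightarrow> bool" for G where
  henneberg2:
    "C \<in> components G \<Longrightarrow> {u, w} \<in> edges C \<Longrightarrow> z \<in> verts C \<Longrightarrow> z \<notin> {u, w} \<Longrightarrow>
     v \<notin> verts G \<Longrightarrow>
     generation_step G
       (Graph (insert v (verts G)) (edges G - {{u, w}} \<union> {{v, u}, {v, w}, {v, z}}))"
| join:
    "G1 \<in> components G \<Longrightarrow> G2 \<in> components G \<Longrightarrow> G1 \<noteq> G2 \<Longrightarrow> is_join G1 G2 H \<Longrightarrow>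
     generation_step G (graph_union (delete_verts G (verts G1 \<union> verts G2)) H)"

definition disjoint_base_graphs :: "'v ugraph \<Rightarrow> bool" where
  "disjoint_base_graphs G \<longleftrightarrow>
     (\<exists>\<B>. finite \<B> \<and> (\<forall>B\<in>\<B>. base_graph B) \<and>
        (\<forall>A\<in>\<B>. \<forall>B\<in>\<B>. A \<noteq> B \<longrightarrow> verts A \<inter> verts B = {}) \<and>
        G = Graph (\<Union>B\<in>\<B>. verts B) (\<Union>B\<in>\<B>. edges B))"

text \<open>Intermediate graphs may have more vertices than the final one, so the construction is
  carried out on vertices in \<open>nat\<close>, and a graph on an arbitrary vertex type is generated
  if it is isomorphic to a graph arising in this way.\<close>

definition recursively_generated :: "'v ugraph \<Rightarrow> bool" where
  "recursively_generated G \<longleftrightarrow>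
     (\<exists>(G0 :: nat ugraph) H. disjoint_base_graphs G0 \<and>
        generation_step\<^sup>*\<^sup>* G0 H \<and> isomorphic H G)"

end

theory Submission
  imports Defs
begin

text \<open>
  Write \<open>i(X)\<close> for the number of edges inside a vertex set \<open>X\<close> of a circuit on \<open>V\<close>, and call a
  nonempty \<open>X \<noteq> V\<close> tight if \<open>i(X) = 2|X| - 2\<close>. Two tight sets that meet and do not cover \<open>V\<close>
  have tight union and intersection, with no edge between their differences.

  The moves and joins preserve circuits by counting. Conversely, a two-vertex cut splits a circuit as a
  1-join or a 2-join of smaller circuits unless the cut is an edge with a \<open>K\<^sub>4\<close> on one side, and a
  three-edge cut with both sides nontrivial is a matching and gives a 3-join, or contains a two-vertex cut.
  In a circuit that is not a base graph and where none of this applies, a vertex of degree 3 at which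
  no inverse Henneberg move yields a circuit either lies in a \<open>K\<^sub>4\<close> (type K) or has pairwise
  nonadjacent neighbours, any two of which lie in a tight set avoiding the third (type A).
  Take a maximal tight \<open>T\<close> whose complement \<open>L\<close> contains a vertex of degree at least 4.
  By uncrossing, \<open>L\<close> contains no vertex of type A, and the \<open>K\<^sub>4\<close> of a type K vertex in \<open>L\<close> stays
  inside \<open>L\<close>. The maximal tight subsets of \<open>L\<close> with at least two vertices are disjoint, contain
  all vertices of degree 3 in \<open>L\<close>, and are left by at least 4 edges each, so \<open>4 - deg\<close> has nonpositive sum
  over each of them and hence over \<open>L\<close>; but its sum over \<open>L\<close> is the number of edges leaving \<open>L\<close>
  minus 2, which is positive.
\<close>

section \<open>Edge counts and circuits\<close>

text \<open>The weight \<open>4 - deg\<close> fits circuits because |E| = 2|V| - 1 makes its total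
  just 2: the average degree lies barely below 4. A tight set left by d edges has weight 4 - d, so
  the tight sets of positive weight are those left by exactly three edges; this is what the 3-join
  has to remove. A cut by two adjacent vertices with a K_4 on one side is spared because attaching a
  K_4 to the other side gives back a circuit with as many vertices, so splitting there makes no
  progress. Such ends therefore survive in irreducible circuits, as vertices of type K. The set T is
  grown from a vertex of degree at least 4, and a second one must exist outside it. Both this and
  the leaf arguments rest on one fact: the vertices of degree 3 induce a forest. In the generating
  direction the obstacle is names: joins delete vertices, so the pieces need vertices that the final
  graph lacks, and two pieces generated side by side must never collide. Hence the induction runs
  inside an arbitrary infinite vertex set, which is divided between the pieces of a join.\<close>

definition spanned :: "'v set set \<Rightarrow> 'v set \<Rightarrow> int" where
  "spanned E X = int (card {e \<in> E. e \<subseteq> X})"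

definition nbrs :: "'v set set \<Rightarrow> 'v \<Rightarrow> 'v set" where
  "nbrs E v = {u. {v, u} \<in> E}"

definition cross :: "'v set set \<Rightarrow> 'v set \<Rightarrow> 'v set \<Rightarrow> 'v set set" where
  "cross E A B = {e \<in> E. e \<inter> A \<noteq> {} \<and> e \<inter> B \<noteq> {}}"

definition graph_on :: "'v set \<Rightarrow> 'v set set \<Rightarrow> bool" where
  "graph_on V E \<longleftrightarrow> finite V \<and> (\<forall>e\<in>E. e \<subseteq> V \<and> card e = 2)"

definition circuit_on :: "'v set \<Rightarrow> 'v set set \<Rightarrow> bool" where
  "circuit_on V E \<longleftrightarrow> graph_on V E \<and> int (card E) = 2 * int (card V) - 1 \<and>
     (\<forall>X. X \<subseteq> V \<and> X \<noteq> {} \<and> X \<noteq> V \<longrightarrow> spanned E X \<le> 2 * int (card X) - 2)"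

lemma graph_on_finite_edges: "graph_on V E \<Longrightarrow> finite E"
  unfolding graph_on_def by (meson Pow_iff finite_Pow_iff finite_subset subsetI)

text \<open>Among the subgraphs on a proper vertex subset the induced one has the most edges, and a
  proper spanning subgraph has at most 2|V| - 2 edges by losing one. So induced edge counts suffice,
  and subgraphs disappear from the argument.\<close>

lemma circuit_iff_circuit_on: "circuit G \<longleftrightarrow> circuit_on (verts G) (edges G)"
proof
  assume G: "circuit G"
  then have s: "simple_graph G" by (simp add: circuit_def)
  have "spanned (edges G) X \<le> 2 * int (card X) - 2"
    if X: "X \<subseteq> verts G" "X \<noteq> {}" "X \<noteq> verts G" for X
  proof -
    let ?H = "Graph X {e \<in> edges G. e \<subseteq> X}"
    have "subgraph ?H G" using s X by (auto simp: subgraph_def simple_graph_def finite_subset)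
    moreover have "?H \<noteq> G" using X by (metis ugraph.sel(1))
    ultimately show ?thesis using G X unfolding circuit_def spanned_def by fastforce
  qed
  then show "circuit_on (verts G) (edges G)" using G s
    by (auto simp: circuit_on_def graph_on_def simple_graph_def circuit_def)
next
  assume G: "circuit_on (verts G) (edges G)"
  then have g: "graph_on (verts G) (edges G)" by (simp add: circuit_on_def)
  then have fE: "finite (edges G)" by (rule graph_on_finite_edges)
  have "int (card (edges H)) \<le> 2 * int (card (verts H)) - 2"
    if H: "subgraph H G" "H \<noteq> G" "verts H \<noteq> {}" for H
  proof (cases "verts H = verts G")
    case True
    then have "edges H \<noteq> edges G" using H(2) by (metis ugraph.expand)
    then have "card (edges H) < card (edges G)"
      using H(1) fE by (metis psubsetI psubset_card_mono subgraph_def)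
    then show ?thesis using G True by (simp add: circuit_on_def)
  next
    case False
    have "edges H \<subseteq> {e \<in> edges G. e \<subseteq> verts H}"
      using H(1) by (auto simp: subgraph_def simple_graph_def)
    then have "int (card (edges H)) \<le> spanned (edges G) (verts H)"
      unfolding spanned_def using fE by (simp add: card_mono)
    also have "\<dots> \<le> 2 * int (card (verts H)) - 2"
      using G H False by (auto simp: circuit_on_def subgraph_def)
    finally show ?thesis .
  qed
  then show "circuit G" using G g
    by (auto simp: circuit_def circuit_on_def graph_on_def simple_graph_def)
qed

lemma nbrs_sym: "u \<in> nbrs E v \<longleftrightarrow> v \<in> nbrs E u"
  by (simp add: nbrs_def insert_commute)

lemma graph_on_nbrs:
  assumes "graph_on V E"
  shows "nbrs E v \<subseteq> V" "v \<notin> nbrs E v" "finite (nbrs E v)"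
proof -
  show 1: "nbrs E v \<subseteq> V" using assms by (auto simp: graph_on_def nbrs_def)
  show "v \<notin> nbrs E v" using assms by (auto simp: graph_on_def nbrs_def)
  show "finite (nbrs E v)" using 1 assms finite_subset by (auto simp: graph_on_def)
qed

lemma graph_on_edgeE:
  assumes "graph_on V E" "e \<in> E"
  obtains x y where "e = {x, y}" "x \<noteq> y" "x \<in> V" "y \<in> V" "y \<in> nbrs E x" "x \<in> nbrs E y"
proof -
  have "card e = 2" "e \<subseteq> V" using assms by (auto simp: graph_on_def)
  then obtain x y where "e = {x, y}" "x \<noteq> y" by (auto simp: card_2_iff)
  then show thesis using that assms(2) \<open>e \<subseteq> V\<close> by (auto simp: nbrs_def insert_commute)
qed

lemma graph_on_edge_atE:
  assumes "graph_on V E" "e \<in> E" "v \<in> e"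
  obtains u where "e = {v, u}" "u \<noteq> v" "u \<in> nbrs E v"
proof -
  obtain x y where "e = {x, y}" "x \<noteq> y" "y \<in> nbrs E x" "x \<in> nbrs E y"
    using graph_on_edgeE[OF assms(1,2)] by blast
  then show thesis using assms(3) that[of x] that[of y] by (auto simp: insert_commute)
qed

lemma inj_on_pair: "inj_on (\<lambda>u. {v, u}) A"
  by (auto simp: inj_on_def doubleton_eq_iff)

lemma edges_at_eq: "graph_on V E \<Longrightarrow> {e \<in> E. v \<in> e} = (\<lambda>u. {v, u}) ` nbrs E v"
  by (auto simp: nbrs_def elim: graph_on_edge_atE)

lemma card_edges_at: "graph_on V E \<Longrightarrow> card {e \<in> E. v \<in> e} = card (nbrs E v)"
  by (simp add: edges_at_eq card_image inj_on_pair)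

lemma spanned_empty: "graph_on V E \<Longrightarrow> spanned E {} = 0"
  by (auto simp: spanned_def graph_on_def)

lemma spanned_sing: "graph_on V E \<Longrightarrow> spanned E {v} = 0"
proof -
  assume g: "graph_on V E"
  have "{e \<in> E. e \<subseteq> {v}} = {}"
    using g by (auto simp: graph_on_def subset_singleton_iff)
  then show ?thesis unfolding spanned_def by simp
qed

lemma spanned_whole: "graph_on V E \<Longrightarrow> V \<subseteq> X \<Longrightarrow> spanned E X = int (card E)"
proof -
  assume g: "graph_on V E" and X: "V \<subseteq> X"
  have "{e \<in> E. e \<subseteq> X} = E" using g X by (auto simp: graph_on_def)
  then show ?thesis by (simp add: spanned_def)
qed

lemma spanned_Int: "graph_on V E \<Longrightarrow> spanned E (X \<inter> V) = spanned E X"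
proof -
  assume g: "graph_on V E"
  have "{e \<in> E. e \<subseteq> X \<inter> V} = {e \<in> E. e \<subseteq> X}" using g by (auto simp: graph_on_def)
  then show ?thesis by (simp add: spanned_def)
qed

lemma spanned_mono_edges: "finite E \<Longrightarrow> F \<subseteq> E \<Longrightarrow> spanned F X \<le> spanned E X"
  unfolding spanned_def by (auto intro!: card_mono)

lemma spanned_insert:
  assumes g: "graph_on V E" and v: "v \<notin> X"
  shows "spanned E (insert v X) = spanned E X + int (card (nbrs E v \<inter> X))"
proof -
  have eq: "{e \<in> E. e \<subseteq> insert v X} = {e \<in> E. e \<subseteq> X} \<union> (\<lambda>u. {v, u}) ` (nbrs E v \<inter> X)"
  proof
    show "{e \<in> E. e \<subseteq> insert v X} \<subseteq> {e \<in> E. e \<subseteq> X} \<union> (\<lambda>u. {v, u}) ` (nbrs E v \<inter> X)"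
    proof
      fix e assume e: "e \<in> {e \<in> E. e \<subseteq> insert v X}"
      show "e \<in> {e \<in> E. e \<subseteq> X} \<union> (\<lambda>u. {v, u}) ` (nbrs E v \<inter> X)"
      proof (cases "v \<in> e")
        case True
        then obtain u where "e = {v, u}" "u \<noteq> v" "u \<in> nbrs E v"
          using e graph_on_edge_atE[OF g, of e v] by blast
        then show ?thesis using e by auto
      next
        case False
        then show ?thesis using e by auto
      qed
    qed
  qed (auto simp: nbrs_def)
  have "card {e \<in> E. e \<subseteq> insert v X} = card {e \<in> E. e \<subseteq> X} + card ((\<lambda>u. {v, u}) ` (nbrs E v \<inter> X))"
    unfolding eq
    by (rule card_Un_disjoint) (use v graph_on_finite_edges[OF g] graph_on_nbrs[OF g] in auto)
  then show ?thesis by (simp add: spanned_def card_image inj_on_pair)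
qed

text \<open>An edge inside the union but inside neither set runs between the two differences. This
  supermodular count is the source of all uncrossing below.\<close>

lemma spanned_Un_Int:
  assumes g: "graph_on V E"
  shows "spanned E (X \<union> Y) + spanned E (X \<inter> Y) = spanned E X + spanned E Y + int (card (cross E (X - Y) (Y - X)))"
proof -
  have fE: "finite E" using g by (rule graph_on_finite_edges)
  let ?I = "\<lambda>X. {e \<in> E. e \<subseteq> X}"
  have eq: "?I (X \<union> Y) = (?I X \<union> ?I Y) \<union> {e \<in> cross E (X - Y) (Y - X). e \<subseteq> X \<union> Y}"
    by (auto simp: cross_def)
  have c: "{e \<in> cross E (X - Y) (Y - X). e \<subseteq> X \<union> Y} = cross E (X - Y) (Y - X)"
  proof -
    have "e \<subseteq> X \<union> Y" if "e \<in> cross E (X - Y) (Y - X)" for e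
    proof -
      have "e \<in> E" using that by (simp add: cross_def)
      then obtain x y where "e = {x, y}" using graph_on_edgeE[OF g] by blast
      then show ?thesis using that by (auto simp: cross_def)
    qed
    then show ?thesis by auto
  qed
  have "card (?I (X \<union> Y)) = card (?I X \<union> ?I Y) + card (cross E (X - Y) (Y - X))"
    unfolding eq c
    by (rule card_Un_disjoint) (use fE in \<open>auto simp: cross_def\<close>)
  moreover have "card (?I X) + card (?I Y) = card (?I X \<union> ?I Y) + card (?I X \<inter> ?I Y)"
    by (rule card_Un_Int) (use fE in auto)
  moreover have "?I X \<inter> ?I Y = ?I (X \<inter> Y)" by auto
  ultimately show ?thesis by (simp add: spanned_def)
qed

lemma spanned_split:
  assumes g: "graph_on V E" and "A \<subseteq> V"
  shows "int (card E) = spanned E A + spanned E (V - A) + int (card (cross E A (V - A)))"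
proof -
  have "A \<union> (V - A) = V" "A \<inter> (V - A) = {}" "A - (V - A) = A" "V - A - A = V - A" using assms by auto
  then show ?thesis using spanned_Un_Int[OF g, of A "V - A"] spanned_empty[OF g] spanned_whole[OF g order_refl]
    by simp
qed

text \<open>Double counting of incidences: an edge inside \<open>A\<close> contributes two, an edge
  leaving \<open>A\<close> one.\<close>

lemma handshake:
  assumes g: "graph_on V E" and A: "A \<subseteq> V"
  shows "(\<Sum>v\<in>A. int (card (nbrs E v))) = 2 * spanned E A + int (card (cross E A (V - A)))"
proof -
  have fE: "finite E" using g by (rule graph_on_finite_edges)
  have fA: "finite A" using g A finite_subset by (auto simp: graph_on_def)
  have "(\<Sum>v\<in>A. int (card (nbrs E v))) = (\<Sum>v\<in>A. \<Sum>e\<in>E. if v \<in> e then 1 else 0)"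
  proof (rule sum.cong)
    fix v assume "v \<in> A"
    have "(\<Sum>e\<in>E. if v \<in> e then 1 else (0::int)) = int (card {e \<in> E. v \<in> e})"
      using fE by (simp add: sum.If_cases Int_def)
    then show "int (card (nbrs E v)) = (\<Sum>e\<in>E. if v \<in> e then 1 else 0)"
      using card_edges_at[OF g] by metis
  qed simp
  also have "\<dots> = (\<Sum>e\<in>E. \<Sum>v\<in>A. if v \<in> e then 1 else 0)" by (rule sum.swap)
  also have "\<dots> = (\<Sum>e\<in>E. (if e \<subseteq> A then 2 else 0) + (if e \<in> cross E A (V - A) then 1 else 0))"
  proof (rule sum.cong)
    fix e assume e: "e \<in> E"
    have "(\<Sum>v\<in>A. if v \<in> e then 1 else (0::int)) = int (card (A \<inter> e))"
      using fA by (simp add: sum.If_cases Int_def)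
    also have "\<dots> = (if e \<subseteq> A then 2 else 0) + (if e \<in> cross E A (V - A) then 1 else 0)"
    proof -
      obtain x y where xy: "e = {x, y}" "x \<noteq> y" "x \<in> V" "y \<in> V" using graph_on_edgeE[OF g e] by blast
      have "A \<inter> e = (if x \<in> A then {x} else {}) \<union> (if y \<in> A then {y} else {})" using xy by auto
      then show ?thesis using xy e by (auto simp: cross_def)
    qed
    finally show "(\<Sum>v\<in>A. if v \<in> e then 1 else 0)
        = (if e \<subseteq> A then 2 else 0) + (if e \<in> cross E A (V - A) then 1 else (0::int))" .
  qed simp
  also have "\<dots> = 2 * spanned E A + int (card (cross E A (V - A)))"
  proof -
    have "E \<inter> {e. e \<in> cross E A (V - A)} = cross E A (V - A)" by (auto simp: cross_def)
    then show ?thesis using fE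
      by (simp add: sum.distrib sum.If_cases spanned_def Int_def)
  qed
  finally show ?thesis .
qed

lemma cross_empty_iff:
  assumes "graph_on V E" and that: "A \<inter> B = {}"
  shows "cross E A B = {} \<longleftrightarrow> (\<forall>a\<in>A. \<forall>b\<in>B. {a, b} \<notin> E)"
proof
  assume "cross E A B = {}"
  then show "\<forall>a\<in>A. \<forall>b\<in>B. {a, b} \<notin> E" by (fastforce simp: cross_def)
next
  assume *: "\<forall>a\<in>A. \<forall>b\<in>B. {a, b} \<notin> E"
  show "cross E A B = {}"
  proof (rule ccontr)
    assume "cross E A B \<noteq> {}"
    then obtain e where e: "e \<in> E" "e \<inter> A \<noteq> {}" "e \<inter> B \<noteq> {}" by (auto simp: cross_def)
    then obtain x y where "e = {x, y}" using graph_on_edgeE[OF assms(1)] by blast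
    then show False using e * that by (auto simp: insert_commute)
  qed
qed

section \<open>Tight sets, edge cuts and degrees in a circuit\<close>

locale circuit_graph =
  fixes V :: "'v set" and E :: "'v set set"
  assumes circuit_on: "circuit_on V E"
begin

lemma graph_on: "graph_on V E" using circuit_on by (simp add: circuit_on_def)
lemma finV: "finite V" using graph_on by (simp add: graph_on_def)
lemma finE: "finite E" using graph_on by (rule graph_on_finite_edges)
lemma cardE: "int (card E) = 2 * int (card V) - 1" using circuit_on by (simp add: circuit_on_def)
lemma spanned_V: "spanned E V = 2 * int (card V) - 1" using spanned_whole[OF graph_on order_refl] cardE by simp
lemma sparse: "X \<subseteq> V \<Longrightarrow> X \<noteq> {} \<Longrightarrow> X \<noteq> V \<Longrightarrow> spanned E X \<le> 2 * int (card X) - 2"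
  using circuit_on by (simp add: circuit_on_def)
lemma edge_props: "{x, y} \<in> E \<Longrightarrow> x \<noteq> y \<and> x \<in> V \<and> y \<in> V"
  using graph_on by (auto simp: graph_on_def)
lemma nbrs_V: "nbrs E v \<subseteq> V" and nbrs_irrefl: "v \<notin> nbrs E v" and fin_nbrs: "finite (nbrs E v)"
  using graph_on_nbrs[OF graph_on] by auto

text \<open>A single vertex of a circuit counts as tight, since it spans 0 = 2 - 2 edges; this is
  why \<open>2 \<le> card\<close> is added where a nontrivial tight set is meant.\<close>

definition tight :: "'v set \<Rightarrow> bool" where
  "tight X \<longleftrightarrow> X \<subseteq> V \<and> X \<noteq> {} \<and> X \<noteq> V \<and> spanned E X = 2 * int (card X) - 2"

lemma tight_finite: "tight X \<Longrightarrow> finite X" using finV finite_subset by (auto simp: tight_def)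

lemma card_Un_Int_V: "X \<subseteq> V \<Longrightarrow> Y \<subseteq> V \<Longrightarrow> int (card X) + int (card Y) = int (card (X \<union> Y)) + int (card (X \<inter> Y))"
  using card_Un_Int[of X Y] finV finite_subset by (metis of_nat_add)

text \<open>Union and intersection obey the sparsity bound, while supermodularity makes their counts
  at least the sum of the two tight counts. Equality holds throughout and leaves no cross edge. The
  union must differ from \<open>V\<close>, which exceeds the bound by one.\<close>

lemma tight_Un:
  assumes X: "tight X" and Y: "tight Y" and ne: "X \<inter> Y \<noteq> {}" and nV: "X \<union> Y \<noteq> V"
  shows "tight (X \<union> Y)" "tight (X \<inter> Y)" "\<And>x y. x \<in> X - Y \<Longrightarrow> y \<in> Y - X \<Longrightarrow> {x, y} \<notin> E"
proof -
  let ?c = "cross E (X - Y) (Y - X)"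
  have XY: "X \<subseteq> V" "Y \<subseteq> V" "X \<noteq> {}" "X \<noteq> V" using X Y by (auto simp: tight_def)
  have 1: "spanned E (X \<union> Y) + spanned E (X \<inter> Y) = spanned E X + spanned E Y + int (card ?c)"
    by (rule spanned_Un_Int[OF graph_on])
  have 2: "spanned E (X \<union> Y) \<le> 2 * int (card (X \<union> Y)) - 2"
    by (rule sparse) (use XY nV in auto)
  have 3: "spanned E (X \<inter> Y) \<le> 2 * int (card (X \<inter> Y)) - 2"
    by (rule sparse) (use XY ne in auto)
  have 4: "spanned E X = 2 * int (card X) - 2" "spanned E Y = 2 * int (card Y) - 2"
    using X Y by (auto simp: tight_def)
  note 5 = card_Un_Int_V[OF XY(1,2)]
  have "card ?c = 0" "spanned E (X \<union> Y) = 2 * int (card (X \<union> Y)) - 2"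
    "spanned E (X \<inter> Y) = 2 * int (card (X \<inter> Y)) - 2" using 1 2 3 4 5 by linarith+
  then show "tight (X \<union> Y)" "tight (X \<inter> Y)" using XY ne nV by (auto simp: tight_def)
  have "?c = {}" using \<open>card ?c = 0\<close> finE by (simp add: cross_def)
  then show "\<And>x y. x \<in> X - Y \<Longrightarrow> y \<in> Y - X \<Longrightarrow> {x, y} \<notin> E"
    by (auto simp: cross_def)
qed

text \<open>A new vertex raises the bound by 2, and only \<open>V\<close> exceeds the bound, by one.
  Hence \<open>v\<close> sends at most two edges into \<open>T\<close>, or exactly three when it
  completes \<open>V\<close>.\<close>

lemma tight_insert:
  assumes T: "tight T" and v: "v \<in> V" "v \<notin> T"
  shows "card (nbrs E v \<inter> T) \<le> 2 \<or> (insert v T = V \<and> card (nbrs E v) = 3)"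
    and "card (nbrs E v \<inter> T) = 2 \<Longrightarrow> tight (insert v T)"
    and "insert v T = V \<Longrightarrow> card (nbrs E v) = 3"
proof -
  have TV: "T \<subseteq> V" "spanned E T = 2 * int (card T) - 2" using T by (auto simp: tight_def)
  have e: "spanned E (insert v T) = spanned E T + int (card (nbrs E v \<inter> T))" by (rule spanned_insert[OF graph_on v(2)])
  have c: "card (insert v T) = card T + 1" using v tight_finite[OF T] by simp
  have w: "card (nbrs E v) = 3 \<and> card (nbrs E v \<inter> T) = 3" if "insert v T = V"
  proof -
    have "nbrs E v \<inter> T = nbrs E v" using nbrs_V nbrs_irrefl that by blast
    then show ?thesis using e c spanned_V TV that by (simp)
  qed
  have nw: "card (nbrs E v \<inter> T) \<le> 2" if "insert v T \<noteq> V"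
    using sparse[of "insert v T"] e c TV v that by auto
  show "card (nbrs E v \<inter> T) \<le> 2 \<or> (insert v T = V \<and> card (nbrs E v) = 3)" using w nw by auto
  show "tight (insert v T)" if "card (nbrs E v \<inter> T) = 2"
    using that w e c TV v unfolding tight_def by auto
  show "insert v T = V \<Longrightarrow> card (nbrs E v) = 3" using w by auto
qed

text \<open>Two or three vertices have 1 or 3 pairs, short of the 2 or 4 edges that tightness asks
  for.\<close>

lemma tight_card_ge_4:
  assumes T: "tight T" and 2: "2 \<le> card T"
  shows "4 \<le> card T"
proof (rule ccontr)
  assume "\<not> 4 \<le> card T"
  have f: "finite T" using tight_finite[OF T] .
  have "card {e \<in> E. e \<subseteq> T} \<le> card {e. e \<subseteq> T \<and> card e = 2}"
    by (rule card_mono) (use f graph_on in \<open>auto simp: graph_on_def\<close>)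
  also have "\<dots> = card T choose 2" using n_subsets[OF f, of 2] by (simp add: conj_commute)
  finally have le: "spanned E T \<le> int (card T choose 2)" by (simp add: spanned_def)
  consider "card T = 2" | "card T = 3" using 2 \<open>\<not> 4 \<le> card T\<close> by linarith
  then show False using le T by cases (auto simp: tight_def choose_two)
qed

text \<open>The two sides span at most 2|V| - 4 of the 2|V| - 1 edges, so at least three remain;
  exactly three means that both sides attain their bounds.\<close>

lemma cut_ge_3:
  assumes A: "A \<subseteq> V" "A \<noteq> {}" "A \<noteq> V"
  shows "3 \<le> card (cross E A (V - A))"
    and "card (cross E A (V - A)) = 3 \<longleftrightarrow> tight A \<and> tight (V - A)"
proof -
  have 1: "spanned E A \<le> 2 * int (card A) - 2" "spanned E (V - A) \<le> 2 * int (card (V - A)) - 2"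
    using A by (auto intro!: sparse)
  have 2: "int (card V) = int (card A) + int (card (V - A))"
    using A finV by (metis card_Diff_subset card_mono finite_subset le_add_diff_inverse of_nat_add)
  have 3: "V - A \<noteq> {}" "V - A \<noteq> V" using A by auto
  note 4 = spanned_split[OF graph_on A(1)] cardE
  show "3 \<le> card (cross E A (V - A))" using 1 2 4 by linarith
  have "card (cross E A (V - A)) = 3 \<longleftrightarrow> spanned E A = 2 * int (card A) - 2 \<and> spanned E (V - A) = 2 * int (card (V - A)) - 2"
    using 1 2 4 by linarith
  then show "card (cross E A (V - A)) = 3 \<longleftrightarrow> tight A \<and> tight (V - A)"
    using A 3 by (simp add: tight_def)
qed

lemma deg_ge_3: assumes "v \<in> V" shows "3 \<le> card (nbrs E v)"
proof -
  have "V \<noteq> {v}" using cardE spanned_sing[OF graph_on, of v] spanned_V by auto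
  have "cross E {v} (V - {v}) = {e \<in> E. v \<in> e}"
    unfolding cross_def using graph_on by (fastforce elim: graph_on_edgeE)
  then have "card (cross E {v} (V - {v})) = card (nbrs E v)" using card_edges_at[OF graph_on] by simp
  then show ?thesis using cut_ge_3(1)[of "{v}"] assms \<open>V \<noteq> {v}\<close> by auto
qed

abbreviation "V3 \<equiv> {v \<in> V. card (nbrs E v) = 3}"

text \<open>For a tight \<open>A\<close> the right-hand side is 4 minus the number of edges leaving
  \<open>A\<close>.\<close>

lemma surplus:
  assumes "A \<subseteq> V"
  shows "(\<Sum>v\<in>A. 4 - int (card (nbrs E v))) = 4 * int (card A) - 2 * spanned E A - int (card (cross E A (V - A)))"
  using handshake[OF graph_on assms] by (simp add: sum_subtractf)

text \<open>With i edges inside \<open>S\<close> and d leaving it, degrees give 3|S| = 2i + d, and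
  sparsity of \<open>V - S\<close> gives i + d \<ge> 2|S| + 1; subtract. As this applies to subsets
  as well, the vertices of degree 3 induce a forest.\<close>

lemma spanned_nodes:
  assumes S: "S \<subseteq> V3" "S \<noteq> {}" "S \<noteq> V"
  shows "spanned E S \<le> int (card S) - 1"
proof -
  have SV: "S \<subseteq> V" using S by auto
  have "(\<Sum>v\<in>S. 4 - int (card (nbrs E v))) = (\<Sum>v\<in>S. 1)" by (rule sum.cong) (use S in auto)
  then have 1: "4 * int (card S) - 2 * spanned E S - int (card (cross E S (V - S))) = int (card S)"
    using surplus[OF SV] by simp
  have 2: "spanned E (V - S) \<le> 2 * int (card (V - S)) - 2"
    by (rule sparse) (use S in auto)
  have 3: "int (card V) = int (card S) + int (card (V - S))"
    using SV finV by (metis card_Diff_subset card_mono finite_subset le_add_diff_inverse of_nat_add)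
  show ?thesis using 1 2 3 spanned_split[OF graph_on SV] cardE by linarith
qed

text \<open>A forest has a vertex with at most one neighbour in it: otherwise the degrees inside
  \<open>S\<close> sum to at least 2|S|, against \<open>spanned_nodes\<close>.\<close>

lemma node_leaf:
  assumes S: "S \<subseteq> V3" "S \<noteq> {}" "S \<noteq> V"
  obtains v where "v \<in> S" "card (nbrs E v \<inter> S) \<le> 1"
proof (rule ccontr)
  assume "\<not> thesis"
  then have *: "\<And>v. v \<in> S \<Longrightarrow> 2 \<le> card (nbrs E v \<inter> S)" using that by fastforce
  let ?F = "{e \<in> E. e \<subseteq> S}"
  have "S \<subseteq> V" using S by auto
  then have fS: "finite S" using finV finite_subset by blast
  have g: "graph_on S ?F" using graph_on fS by (auto simp: graph_on_def)
  have "nbrs ?F v = nbrs E v \<inter> S" if "v \<in> S" for v using that by (auto simp: nbrs_def)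
  then have "(\<Sum>v\<in>S. 2) \<le> (\<Sum>v\<in>S. int (card (nbrs ?F v)))"
    using * by (intro sum_mono) fastforce
  also have "\<dots> = 2 * spanned ?F S" using handshake[OF g order_refl] by (simp add: cross_def)
  also have "spanned ?F S = spanned E S" by (simp add: spanned_def)
  finally show False using spanned_nodes[OF S] by simp
qed

text \<open>The number of pairs of n vertices falls short of 2n - 1 for n from 1 to 4, and n = 0
  would need -1 edges.\<close>

lemma card_V_ge: "5 \<le> card V"
proof (rule ccontr)
  assume a: "\<not> 5 \<le> card V"
  have "card E \<le> card {e. e \<subseteq> V \<and> card e = 2}"
    by (rule card_mono) (use finV graph_on in \<open>auto simp: graph_on_def\<close>)
  also have "\<dots> = card V choose 2" using n_subsets[OF finV, of 2] by (simp add: conj_commute)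
  finally have le: "2 * int (card V) - 1 \<le> int (card V choose 2)" using cardE by simp
  consider "card V = 0" | "card V = 1" | "card V = 2" | "card V = 3" | "card V = 4" using a by linarith
  then show False using le cardE by cases (auto simp: choose_two)
qed

text \<open>If all vertices but \<open>t\<close> had degree 3, they would span at most |V| - 2 edges
  and \<open>t\<close> would add at most |V| - 1, two short of the total. So besides any given
  \<open>t\<close> there is another vertex of degree at least 4.\<close>

lemma two_big:
  "\<not> V - {t} \<subseteq> V3"
proof
  assume a: "V - {t} \<subseteq> V3"
  have t: "V - {t} \<noteq> {}"
  proof
    assume "V - {t} = {}"
    then have "card V \<le> card {t}" by (intro card_mono) auto
    then show False using card_V_ge by simp
  qed
  have tV: "t \<in> V"
  proof (rule ccontr)
    assume "t \<notin> V"
    then have "V \<subseteq> V3" using a by auto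
    then have "(\<Sum>v\<in>V. 4 - int (card (nbrs E v))) = (\<Sum>v\<in>V. 1)" by (intro sum.cong) auto
    \<comment> \<open>Every vertex would have weight 1, so the total would be |V|; but the total
      weight is 2.\<close>
    then have "4 * int (card V) - 2 * spanned E V = int (card V)"
      using surplus[OF order_refl] by (simp add: cross_def)
    then show False using spanned_V card_V_ge by linarith
  qed
  have 1: "spanned E (V - {t}) \<le> int (card (V - {t})) - 1"
    by (rule spanned_nodes) (use a t tV in auto)
  have "nbrs E t \<inter> (V - {t}) \<subseteq> V - {t}" by auto
  then have "card (nbrs E t \<inter> (V - {t})) \<le> card (V - {t})" using finV by (intro card_mono) auto
  moreover have "spanned E V = spanned E (V - {t}) + int (card (nbrs E t \<inter> (V - {t})))"
    using spanned_insert[OF graph_on, of t "V - {t}"] tV by (simp add: insert_absorb)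
  moreover have "card V = card (V - {t}) + 1" using tV finV by (metis Suc_eq_plus1 card_Suc_Diff1)
  ultimately show False using 1 spanned_V by linarith
qed

end

section \<open>Irreducible circuits\<close>

lemma spanned_insert_edge:
  assumes "finite F" "e \<notin> F"
  shows "spanned (insert e F) X = spanned F X + (if e \<subseteq> X then 1 else 0)"
proof -
  have "{e' \<in> insert e F. e' \<subseteq> X} = (if e \<subseteq> X then insert e {e' \<in> F. e' \<subseteq> X} else {e' \<in> F. e' \<subseteq> X})"
    by auto
  then show ?thesis using assms by (simp add: spanned_def)
qed

lemma circuit_on_intro:
  assumes "graph_on V E" "int (card E) = 2 * int (card V) - 1"
    and "\<And>X. X \<subseteq> V \<Longrightarrow> X \<noteq> {} \<Longrightarrow> X \<noteq> V \<Longrightarrow> spanned E X \<le> 2 * int (card X) - 2"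
  shows "circuit_on V E"
  using assms by (simp add: circuit_on_def)

definition clique :: "'v set set \<Rightarrow> 'v set \<Rightarrow> bool" where
  "clique E Q \<longleftrightarrow> (\<forall>x\<in>Q. \<forall>y\<in>Q. x \<noteq> y \<longrightarrow> {x, y} \<in> E)"

lemma cross_single:
  assumes "\<And>e. e \<in> E \<Longrightarrow> e \<subseteq> Q \<or> e \<subseteq> R \<or> e = f" "f \<in> E" "f \<inter> (Q - R) \<noteq> {}" "f \<inter> (R - Q) \<noteq> {}"
  shows "cross E (Q - R) (R - Q) = {f}"
  unfolding cross_def using assms by blast

lemma cross_commute: "cross E A B = cross E B A"
  by (auto simp: cross_def)

lemma card_3_E:
  assumes "card S = 3"
  obtains x y z where "S = {x, y, z}" "x \<noteq> y" "x \<noteq> z" "y \<noteq> z"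
  using assms by (auto simp: card_3_iff)

context circuit_graph
begin

lemma clique_spanned:
  assumes "clique E Q" "finite Q"
  shows "spanned E Q = int (card Q choose 2)" "{e \<in> E. e \<subseteq> Q} = {e. e \<subseteq> Q \<and> card e = 2}"
proof -
  have "e \<in> E" if e: "e \<subseteq> Q" "card e = 2" for e
    using e assms(1) unfolding card_2_iff clique_def by auto
  then show eq: "{e \<in> E. e \<subseteq> Q} = {e. e \<subseteq> Q \<and> card e = 2}"
    using graph_on by (auto simp: graph_on_def)
  show "spanned E Q = int (card Q choose 2)" unfolding spanned_def eq using n_subsets[OF assms(2), of 2] by simp
qed

lemma clique_if_spanned:
  assumes "finite Q" "spanned E Q = int (card Q choose 2)"
  shows "clique E Q"
proof -
  have sub: "{e \<in> E. e \<subseteq> Q} \<subseteq> {e. e \<subseteq> Q \<and> card e = 2}"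
    using graph_on by (auto simp: graph_on_def)
  have "card {e. e \<subseteq> Q \<and> card e = 2} = card Q choose 2" using n_subsets[OF assms(1), of 2] by simp
  then have "{e \<in> E. e \<subseteq> Q} = {e. e \<subseteq> Q \<and> card e = 2}"
    using assms by (intro card_subset_eq[OF _ sub]) (auto simp: spanned_def)
  then show ?thesis unfolding clique_def by (force simp: card_2_iff)
qed

definition K4 :: "'v set \<Rightarrow> bool" where
  "K4 Q \<longleftrightarrow> Q \<subseteq> V \<and> card Q = 4 \<and> clique E Q"

lemma K4_finite: "K4 Q \<Longrightarrow> finite Q"
  unfolding K4_def using card.infinite by fastforce

lemma K4_spanned: "K4 Q \<Longrightarrow> spanned E Q = 6"
  using clique_spanned(1) K4_finite by (simp add: K4_def choose_two)

lemma K4_tight: "K4 Q \<Longrightarrow> tight Q"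
  using K4_spanned card_V_ge by (auto simp: K4_def tight_def)

lemma K4_edge: "K4 Q \<Longrightarrow> x \<in> Q \<Longrightarrow> y \<in> Q \<Longrightarrow> x \<noteq> y \<Longrightarrow> {x, y} \<in> E"
  by (simp add: K4_def clique_def)

lemma tight4_K4:
  assumes "tight A" "card A = 4"
  shows "K4 A"
proof -
  have "spanned E A = 6" "A \<subseteq> V" using assms by (auto simp: tight_def)
  moreover have "int (card A choose 2) = 6" using assms(2) by (simp add: choose_two)
  ultimately show ?thesis using clique_if_spanned tight_finite assms unfolding K4_def by metis
qed

lemma K4_nbrs:
  assumes "K4 Q" "w \<in> Q" "card (nbrs E w) = 3"
  shows "nbrs E w = Q - {w}"
proof -
  have "Q - {w} \<subseteq> nbrs E w" using assms K4_edge by (auto simp: nbrs_def)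
  moreover have "card (Q - {w}) = 3" using assms K4_finite by (simp add: K4_def)
  ultimately show ?thesis using assms(3) fin_nbrs by (metis card_subset_eq)
qed

text \<open>This is the inverse Henneberg move at \<open>w\<close>. Only a tight set containing
  \<open>x\<close> and \<open>y\<close> but not \<open>w\<close> can be overfilled by the new edge.
  It cannot contain \<open>z\<close> too: then \<open>w\<close> would send three edges into it, so
  it would be all of \<open>V - {w}\<close>, the whole vertex set of the reduced graph.\<close>

lemma separating_tight_or_reducible:
  assumes w: "w \<in> V" "nbrs E w = {x, y, z}" "x \<noteq> y" "x \<noteq> z" "y \<noteq> z" and xy: "{x, y} \<notin> E"
    and no: "\<not> (\<exists>X. tight X \<and> w \<notin> X \<and> z \<notin> X \<and> x \<in> X \<and> y \<in> X)"
  shows "circuit_on (V - {w}) (insert {x, y} {e \<in> E. w \<notin> e})"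
proof (rule circuit_on_intro)
  let ?F = "{e \<in> E. w \<notin> e}"
  have xyw: "x \<in> V" "y \<in> V" "x \<noteq> w" "y \<noteq> w" using w nbrs_V[of w] nbrs_irrefl[of w] by auto
  have fF: "finite ?F" and nF: "{x, y} \<notin> ?F" using finE xy by auto
  show "graph_on (V - {w}) (insert {x, y} ?F)"
    using graph_on xyw w(3) by (auto simp: graph_on_def)
  have "card {e \<in> E. w \<in> e} = 3" using card_edges_at[OF graph_on, of w] w by simp
  moreover have "card E = card ?F + card {e \<in> E. w \<in> e}"
    by (subst card_Un_disjoint[symmetric]) (use finE in \<open>auto intro!: arg_cong[of _ _ card]\<close>)
  moreover have "card V = card (V - {w}) + 1" using w finV by (metis Suc_eq_plus1 card_Suc_Diff1)
  ultimately show "int (card (insert {x, y} ?F)) = 2 * int (card (V - {w})) - 1"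
    using cardE fF nF by simp
  fix X assume X: "X \<subseteq> V - {w}" "X \<noteq> {}" "X \<noteq> V - {w}"
  have le: "spanned ?F X \<le> spanned E X" by (rule spanned_mono_edges) (use finE in auto)
  have sp: "spanned E X \<le> 2 * int (card X) - 2" by (rule sparse) (use X w in auto)
  have "spanned E X \<le> 2 * int (card X) - 3" if "x \<in> X" "y \<in> X"
  proof (rule ccontr)
    assume "\<not> ?thesis"
    then have t: "tight X" using sp X w unfolding tight_def by auto
    then have "z \<in> X" using no X that by auto
    then have "nbrs E w \<inter> X = {x, y, z}" using that w by auto
    then have "card (nbrs E w \<inter> X) = 3" using w by simp
    then have "insert w X = V" using tight_insert(1)[OF t w(1)] X by auto
    then show False using X by auto
  qed
  then show "spanned (insert {x, y} ?F) X \<le> 2 * int (card X) - 2"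
    using spanned_insert_edge[OF fF nF, of X] le sp by auto
qed

end

text \<open>Each assumption says that one way of reducing the circuit fails, so the goal becomes a
  contradiction. \<open>no_3_edge_cut\<close> speaks only of matchings; other three-edge cuts are
  excluded through \<open>two_cut\<close>. In \<open>two_cut\<close> the permitted case, an edge
  \<open>ab\<close> and a side of two further vertices, is the one in which that side with
  \<open>a, b\<close> is a K_4.\<close>

locale irreducible_circuit = circuit_graph V E for V :: "'v set" and E :: "'v set set" +
  assumes no_3_edge_cut: "\<lbrakk>tight A; tight (V - A); card A \<ge> 2; card (V - A) \<ge> 2;
      cross E A (V - A) = {{a1, a2}, {b1, b2}, {c1, c2}};
      {a1, b1, c1} \<subseteq> A; {a2, b2, c2} \<subseteq> V - A; card {a1, b1, c1} = 3; card {a2, b2, c2} = 3\<rbrakk> \<Longrightarrow> False"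
    and two_cut: "\<lbrakk>V = A \<union> B \<union> {a, b}; A \<inter> B = {}; {a, b} \<inter> (A \<union> B) = {}; a \<noteq> b; A \<noteq> {}; B \<noteq> {};
      \<And>x y. x \<in> A \<Longrightarrow> y \<in> B \<Longrightarrow> {x, y} \<notin> E\<rbrakk> \<Longrightarrow> {a, b} \<in> E \<and> (card A = 2 \<or> card B = 2)"
    and no_admissible: "\<lbrakk>w \<in> V; nbrs E w = {x, y, z}; x \<noteq> y; x \<noteq> z; y \<noteq> z; {x, y} \<notin> E\<rbrakk> \<Longrightarrow>
      \<not> circuit_on (V - {w}) (insert {x, y} {e \<in> E. w \<notin> e})"
    and not_base: "\<not> base_graph (Graph V E)"
begin

text \<open>Were the union not \<open>V\<close>, the intersection would be tight with only two or
  three vertices. So the two K_4 cover \<open>V\<close>, counting leaves no edge between their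
  differences, and the circuit is a base graph: two K_4 sharing an edge, or K_5 without the edge
  joining the two unshared vertices.\<close>

lemma K4_Int:
  assumes Q: "K4 Q" "K4 Q'" "Q \<noteq> Q'"
  shows "card (Q \<inter> Q') \<le> 1"
proof (rule ccontr)
  assume "\<not> ?thesis"
  then have k2: "2 \<le> card (Q \<inter> Q')" by simp
  have f: "finite Q" "finite Q'" using Q K4_finite by auto
  have c4: "card Q = 4" "card Q' = 4" using Q by (auto simp: K4_def)
  have k3: "card (Q \<inter> Q') \<le> 3"
  proof (rule ccontr)
    assume "\<not> ?thesis"
    then have "card Q \<le> card (Q \<inter> Q')" "card Q' \<le> card (Q \<inter> Q')" using c4 by simp_all
    then have "Q \<inter> Q' = Q" "Q \<inter> Q' = Q'" using f by (auto intro: card_seteq[THEN sym] dest!: card_seteq[rotated 2])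
    then show False using Q by auto
  qed
  have ne: "Q \<inter> Q' \<noteq> {}" using k2 by auto
  have V: "Q \<union> Q' = V"
  proof (rule ccontr)
    assume "Q \<union> Q' \<noteq> V"
    then have "tight (Q \<inter> Q')" using tight_Un(2) K4_tight Q ne by blast
    then show False using tight_card_ge_4 k2 k3 by fastforce
  qed
  have cl: "clique E (Q \<inter> Q')" using Q by (auto simp: K4_def clique_def)
  have "card (Q \<union> Q') + card (Q \<inter> Q') = 8" using card_Un_Int[of Q Q'] f c4 by simp
  then have n: "card V = 8 - card (Q \<inter> Q')" using V by simp
  have eq: "2 * int (card V) - 1 + int (card (Q \<inter> Q') choose 2) = 12 + int (card (cross E (Q - Q') (Q' - Q)))"
    using spanned_Un_Int[OF graph_on, of Q Q'] V spanned_V K4_spanned Q clique_spanned(1)[OF cl] f by simp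
  consider (2) "card (Q \<inter> Q') = 2" | (3) "card (Q \<inter> Q') = 3" using k2 k3 by linarith
  \<comment> \<open>With k shared vertices 2|V| - 1 is 15 - 2k; adding the k choose 2 shared pairs
    gives 12 for k = 2 and for k = 3, so nothing remains for cross edges.\<close>
  then have "card (cross E (Q - Q') (Q' - Q)) = 0"
    using eq n by cases (auto simp: choose_two)
  then have nc: "cross E (Q - Q') (Q' - Q) = {}" using finE by (simp add: cross_def)
  have pairs: "{e \<in> E. e \<subseteq> Q} = {e. e \<subseteq> Q \<and> card e = 2}" "{e \<in> E. e \<subseteq> Q'} = {e. e \<subseteq> Q' \<and> card e = 2}"
    using clique_spanned(2) Q f by (auto simp: K4_def)
  have split: "e \<subseteq> Q \<or> e \<subseteq> Q'" if e: "e \<in> E" for e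
  proof -
    obtain x y where "e = {x, y}" "x \<in> V" "y \<in> V" using graph_on_edgeE[OF graph_on e] by blast
    then show ?thesis using nc e V by (auto simp: cross_def)
  qed
  have E: "E = {e. e \<subseteq> Q \<and> card e = 2} \<union> {e. e \<subseteq> Q' \<and> card e = 2}"
  proof -
    have "E = {e \<in> E. e \<subseteq> Q} \<union> {e \<in> E. e \<subseteq> Q'}" using split by blast
    then show ?thesis unfolding pairs .
  qed
  from \<open>2 \<le> card (Q \<inter> Q')\<close> k3 consider (2) "card (Q \<inter> Q') = 2" | (3) "card (Q \<inter> Q') = 3" by linarith
  then show False
  proof cases
    case 2
    have "base_graph (graph_union (complete_graph Q) (complete_graph Q'))"
      by (rule base_graph.two_K4_edge) (use c4 2 in auto)
    then show False using not_base E V by (simp add: graph_union_def complete_graph_def)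
  next
    case 3
    have "card (Q - Q') = 1" "card (Q' - Q) = 1"
      using 3 c4 f card_Diff_subset_Int[of Q Q'] card_Diff_subset_Int[of Q' Q] by (auto simp: Int_commute)
    then obtain a b where ab: "Q - Q' = {a}" "Q' - Q = {b}" by (auto simp: card_1_singleton_iff)
    have "e \<subseteq> Q \<or> e \<subseteq> Q' \<longleftrightarrow> e \<noteq> {a, b}" if e: "e \<subseteq> V" "card e = 2" for e
    proof -
      obtain x y where xy: "e = {x, y}" "x \<noteq> y" using e(2) by (auto simp: card_2_iff)
      have "x \<in> V" "y \<in> V" using xy e by auto
      moreover have "z \<in> Q \<longleftrightarrow> z \<noteq> b" "z \<in> Q' \<longleftrightarrow> z \<noteq> a" if "z \<in> V" for z
        using that ab V by blast+
      moreover have "a \<noteq> b" using ab by blast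
      ultimately show ?thesis using xy by (auto simp: doubleton_eq_iff)
    qed
    moreover have "e \<subseteq> V" if "e \<subseteq> Q \<or> e \<subseteq> Q'" for e using that V by auto
    moreover have "e \<in> E \<longleftrightarrow> card e = 2 \<and> (e \<subseteq> Q \<or> e \<subseteq> Q')" for e
      by (subst E) auto
    ultimately have "e \<in> E \<longleftrightarrow> e \<in> {e. e \<subseteq> V \<and> card e = 2} - {{a, b}}" for e
      by (metis (mono_tags, lifting) Diff_iff mem_Collect_eq singleton_iff)
    then have "E = {e. e \<subseteq> V \<and> card e = 2} - {{a, b}}" by (rule set_eqI)
    moreover have "base_graph (delete_edge (complete_graph V) {a, b})"
      by (rule base_graph.K5_minus_edge) (use n 3 ab V in \<open>auto simp: complete_graph_def card_2_iff\<close>)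
    ultimately show False using not_base by (simp add: delete_edge_def complete_graph_def)
  qed
qed

text \<open>The vertex \<open>a\<close> has a single neighbour \<open>a'\<close> outside the K_4, so
  \<open>{a', b}\<close> separates \<open>{a, c, d}\<close> from the remaining vertices.
  Irreducibility leaves just two of these, and counting edges makes them a second K_4 with
  \<open>a'\<close> and \<open>b\<close>: the circuit is the base graph of two K_4 sharing a vertex,
  with \<open>{a, a'}\<close> as the further edge.\<close>

lemma end_degree:
  assumes K: "K4 {a, b, c, d}" and dist: "a \<noteq> b" "a \<noteq> c" "a \<noteq> d" "b \<noteq> c" "b \<noteq> d" "c \<noteq> d"
    and cd: "card (nbrs E c) = 3" "card (nbrs E d) = 3" and a: "card (nbrs E a) = 4"
  shows False
proof -
  let ?Q = "{a, b, c, d}"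
  have nc: "nbrs E c = {a, b, d}" and nd: "nbrs E d = {a, b, c}"
    using K4_nbrs[OF K] cd dist by auto
  have sub: "{b, c, d} \<subseteq> nbrs E a" using K4_edge[OF K] dist by (auto simp: nbrs_def)
  have "card (nbrs E a - {b, c, d}) = 1" using sub a dist by (subst card_Diff_subset) auto
  then obtain a' where a': "nbrs E a - {b, c, d} = {a'}" by (auto simp: card_1_singleton_iff)
  then have na: "nbrs E a = {a', b, c, d}" using sub by auto
  have a'Q: "a' \<notin> ?Q" using a' nbrs_irrefl[of a] by auto
  have a'V: "a' \<in> V" using na nbrs_V[of a] by auto
  have QV: "?Q \<subseteq> V" using K by (simp add: K4_def)
  have a'E: "{a, a'} \<in> E" using na by (auto simp: nbrs_def)
  let ?B = "V - {a, b, c, d, a'}"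
  have cQ: "card ?Q = 4" using dist by simp
  \<comment> \<open>Otherwise \<open>V\<close> has five vertices and \<open>a'\<close> only the
    possible neighbours \<open>a\<close> and \<open>b\<close>, which gives at most 6 + 2 edges
    instead of 9.\<close>
  have B: "?B \<noteq> {}"
  proof
    assume "?B = {}"
    then have V: "V = insert a' ?Q" using QV a'V by auto
    have cV: "card V = 5" using V a'Q cQ by simp
    have "spanned E V = spanned E ?Q + int (card (nbrs E a' \<inter> ?Q))" unfolding V by (rule spanned_insert[OF graph_on a'Q])
    moreover have "nbrs E a' \<inter> ?Q \<subseteq> {a, b}" using nc nd nbrs_sym[of a' E c] nbrs_sym[of a' E d] a'Q by auto
    then have "card (nbrs E a' \<inter> ?Q) \<le> card {a, b}" by (intro card_mono) auto
    ultimately show False using spanned_V K4_spanned[OF K] cV dist by simp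
  qed
  \<comment> \<open>Since \<open>{a, c, d}\<close> has three vertices, it is the other side that
    must have two.\<close>
  have *: "{a', b} \<in> E \<and> (card {a, c, d} = 2 \<or> card ?B = 2)"
  proof (rule two_cut)
    show "{x, y} \<notin> E" if "x \<in> {a, c, d}" "y \<in> ?B" for x y
      using that na nc nd by (auto simp: nbrs_def)
  qed (use B QV a'V a'Q dist in auto)
  then have cB: "card ?B = 2" using dist by simp
  let ?R = "?B \<union> {a', b}"
  have cR: "card ?R = 4" using cB a'Q finV by (subst card_Un_disjoint) auto
  have V: "?Q \<union> ?R = V" "?Q \<inter> ?R = {b}" using QV a'V a'Q by auto
  have cV: "card V = 7" using card_Un_Int[of ?Q ?R] cR cQ V finV by simp
  have e7: "e \<in> E \<Longrightarrow> e \<subseteq> ?Q \<or> e \<subseteq> ?R \<or> e = {a, a'}" for e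
  proof -
    assume e: "e \<in> E"
    obtain x y where xy: "e = {x, y}" "x \<in> V" "y \<in> V" "y \<in> nbrs E x" "x \<in> nbrs E y"
      using graph_on_edgeE[OF graph_on e] by blast
    have *: "q \<in> ?Q \<or> p = a \<and> q = a'" if "q \<in> nbrs E p" "p \<in> {a, c, d}" for p q
      using that nc nd na by blast
    consider "x \<in> {a, c, d}" | "y \<in> {a, c, d}" | "x \<in> ?R" "y \<in> ?R" using xy by blast
    then show ?thesis
    proof cases
      case 1
      then show ?thesis using *[OF xy(4)] xy(1) by blast
    next
      case 2
      then show ?thesis using *[OF xy(5)] xy(1) by blast
    next
      case 3
      then show ?thesis using xy(1) by blast
    qed
  qed
  have cr: "cross E (?Q - ?R) (?R - ?Q) = {{a, a'}}"
  proof (rule cross_single)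
    show "e \<subseteq> ?Q \<or> e \<subseteq> ?R \<or> e = {a, a'}" if "e \<in> E" for e using e7[OF that] .
  qed (use a'E a'Q dist in auto)
  \<comment> \<open>Seven vertices carry 13 edges: 6 in the first K_4, one is
    \<open>{a, a'}\<close>, and the remaining 6 make \<open>?R\<close> complete.\<close>
  have "spanned E ?R = 6"
    using spanned_Un_Int[OF graph_on, of ?Q ?R] V cr spanned_V cV K4_spanned[OF K] spanned_sing[OF graph_on, of b] by simp
  then have clR: "clique E ?R" using cR finV by (intro clique_if_spanned) (auto simp: choose_two)
  have pairs: "{e \<in> E. e \<subseteq> ?R} = {e. e \<subseteq> ?R \<and> card e = 2}" "{e \<in> E. e \<subseteq> ?Q} = {e. e \<subseteq> ?Q \<and> card e = 2}"
    using clique_spanned(2)[OF clR] clique_spanned(2)[of ?Q] K finV by (auto simp: K4_def)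
  have "E = {e \<in> E. e \<subseteq> ?Q} \<union> {e \<in> E. e \<subseteq> ?R} \<union> {{a, a'}}"
    using e7 a'E by blast
  then have E: "E = {e. e \<subseteq> ?Q \<and> card e = 2} \<union> {e. e \<subseteq> ?R \<and> card e = 2} \<union> {{a, a'}}"
    unfolding pairs .
  have "base_graph (add_edges (graph_union (complete_graph ?Q) (complete_graph ?R)) {{a, a'}})"
    by (rule base_graph.two_K4_vertex[OF cQ cR _ refl])
      (use V dist a'Q in \<open>auto simp: graph_union_def complete_graph_def adjacent_def\<close>)
  moreover have "add_edges (graph_union (complete_graph ?Q) (complete_graph ?R)) {{a, a'}} = Graph V E"
    unfolding E using V(1) by (simp add: add_edges_def graph_union_def complete_graph_def)
  ultimately show False using not_base by simp
qed

text \<open>If all three edges end at \<open>a\<close>, then \<open>a\<close> sends three edges into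
  the tight complement, so \<open>A\<close> is just \<open>{a}\<close>. Otherwise
  \<open>{a, p}\<close> is a two-vertex cut; as \<open>V - A\<close> has at least four vertices,
  \<open>A\<close> must be a K_4, in which \<open>p\<close> has degree 4 and the two vertices off
  the cut have degree 3, contrary to \<open>end_degree\<close>.\<close>

lemma cut_3_shared_end:
  assumes A: "tight A" "tight (V - A)" "2 \<le> card A" "2 \<le> card (V - A)"
    and cr: "cross E A (V - A) = {{a, q1}, {a, q2}, {p, q3}}"
    and c3: "card (cross E A (V - A)) = 3"
    and ends: "a \<in> A" "p \<in> A" "q1 \<in> V - A" "q2 \<in> V - A" "q3 \<in> V - A"
  shows False
proof -
  have AV: "A \<subseteq> V" using A by (simp add: tight_def)
  have A4: "4 \<le> card A" "4 \<le> card (V - A)" using A tight_card_ge_4 by auto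
  have inE: "{a, q1} \<in> E" "{a, q2} \<in> E" "{p, q3} \<in> E" using cr by (auto simp: cross_def)
  have crE: "{x, y} \<in> {{a, q1}, {a, q2}, {p, q3}}" if "x \<in> A" "y \<in> V - A" "{x, y} \<in> E" for x y
  proof -
    have "{x, y} \<in> cross E A (V - A)" using that by (auto simp: cross_def)
    then show ?thesis unfolding cr .
  qed
  have q12: "q1 \<noteq> q2" using c3 unfolding cr by (auto simp: card_insert_if split: if_splits)
  show False
  proof (cases "p = a")
    case True
    have "q1 \<noteq> q3" "q2 \<noteq> q3" using c3 True unfolding cr by (auto simp: card_insert_if split: if_splits)
    then have "card {q1, q2, q3} = 3" using q12 by simp
    moreover have "{q1, q2, q3} \<subseteq> nbrs E a \<inter> (V - A)" using inE ends True by (auto simp: nbrs_def)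
    ultimately have "3 \<le> card (nbrs E a \<inter> (V - A))"
      using fin_nbrs by (metis card_mono finite_Int)
    then have "insert a (V - A) = V" using tight_insert(1)[OF A(2), of a] ends AV by auto
    then have "A = {a}" using AV ends by auto
    then show False using A4 by simp
  next
    case False
    have fA: "finite A" using tight_finite A by blast
    have cA: "card (A - {a, p}) = card A - 2" using ends False by (subst card_Diff_subset) auto
    have sep: "{x, y} \<notin> E" if "x \<in> A - {a, p}" "y \<in> V - A" for x y
      using crE[of x y] that ends by (auto simp: doubleton_eq_iff)
    have *: "{a, p} \<in> E \<and> (card (A - {a, p}) = 2 \<or> card (V - A) = 2)"
    proof (rule two_cut)
      show "V = A - {a, p} \<union> (V - A) \<union> {a, p}" using AV ends by auto
      have "2 \<le> card (A - {a, p})" using cA A4 by simp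
      then show "A - {a, p} \<noteq> {}" by (metis card.empty not_numeral_le_zero)
      show "V - A \<noteq> {}" using A4(2) by (metis card.empty not_numeral_le_zero)
    qed (use ends False sep in auto)
    then have c4: "card A = 4" using cA A4 by auto
    then have "card (A - {a, p}) = 2" using cA by simp
    then obtain c d where cd: "A - {a, p} = {c, d}" "c \<noteq> d" by (auto simp: card_2_iff)
    then have Aeq: "A = {a, p, c, d}" and dist: "c \<noteq> a" "c \<noteq> p" "d \<noteq> a" "d \<noteq> p" using ends by auto
    have K: "K4 {p, a, c, d}" using tight4_K4[OF A(1) c4] Aeq by (simp add: insert_commute)
    have A': "A = {p, a, c, d}" using Aeq by auto
    have nin: "nbrs E v = A - {v}" if v: "v \<in> A - {a, p}" for v
    proof
      show "nbrs E v \<subseteq> A - {v}"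
      proof
        fix y assume "y \<in> nbrs E v"
        then have "y \<in> V" "y \<noteq> v" "{v, y} \<in> E" using nbrs_V nbrs_irrefl by (auto simp: nbrs_def)
        then show "y \<in> A - {v}" using sep[OF v] by blast
      qed
      show "A - {v} \<subseteq> nbrs E v"
        using K4_edge[OF K] v unfolding A' nbrs_def by blast
    qed
    have n1: "card (nbrs E c) = 3" "card (nbrs E d) = 3"
    proof -
      have 3: "card (nbrs E v) = 3" if "v \<in> A - {a, p}" for v
        unfolding nin[OF that] using that fA c4 by simp
      show "card (nbrs E c) = 3" "card (nbrs E d) = 3" by (rule 3, unfold cd(1), simp)+
    qed
    have n2: "nbrs E p = {a, c, d, q3}"
    proof
      show "nbrs E p \<subseteq> {a, c, d, q3}"
      proof
        fix y assume y: "y \<in> nbrs E p"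
        then have "y \<in> V" "y \<noteq> p" using nbrs_V nbrs_irrefl by auto
        show "y \<in> {a, c, d, q3}"
        proof (cases "y \<in> A")
          case True
          then show ?thesis using Aeq \<open>y \<noteq> p\<close> by auto
        next
          case F: False
          then have "{p, y} \<in> {{a, q1}, {a, q2}, {p, q3}}" using crE[OF ends(2)] y \<open>y \<in> V\<close> by (auto simp: nbrs_def)
          then show ?thesis using False ends by (auto simp: doubleton_eq_iff)
        qed
      qed
      show "{a, c, d, q3} \<subseteq> nbrs E p" using K4_edge[OF K] dist False inE by (auto simp: nbrs_def)
    qed
    have "q3 \<notin> {a, c, d}" using ends Aeq by auto
    then have "card (nbrs E p) = 4" unfolding n2 using dist cd(2) by (auto simp: card_insert_if)
    then show False using end_degree[OF K] n1 dist cd(2) False by metis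
  qed
qed

text \<open>A cut of three edges has tight sides, and no two of its edges share an end on either
  side; so it is a matching, which irreducibility forbids.\<close>

lemma cut_ge_4:
  assumes A: "A \<subseteq> V" "2 \<le> card A" "2 \<le> card (V - A)"
  shows "4 \<le> card (cross E A (V - A))"
proof (rule ccontr)
  assume n4: "\<not> ?thesis"
  have ne: "A \<noteq> {}" "A \<noteq> V" using A by auto
  have c3: "card (cross E A (V - A)) = 3" using cut_ge_3(1)[OF A(1) ne] n4 by linarith
  then have t: "tight A" "tight (V - A)" using cut_ge_3(2)[OF A(1) ne] by auto
  have VV: "V - (V - A) = A" using A by auto
  have ends: "\<exists>x y. e = {x, y} \<and> x \<in> A \<and> y \<in> V - A" if e: "e \<in> cross E A (V - A)" for e
  proof -
    have "e \<in> E" using e by (auto simp: cross_def)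
    then obtain x y where "e = {x, y}" using graph_on_edgeE[OF graph_on] by blast
    then show ?thesis using e by (auto simp: cross_def insert_commute)
  qed
  obtain e1 e2 e3 where e: "cross E A (V - A) = {e1, e2, e3}" "e1 \<noteq> e2" "e1 \<noteq> e3" "e2 \<noteq> e3"
    using card_3_E[OF c3] by metis
  obtain a1 a2 where 1: "e1 = {a1, a2}" "a1 \<in> A" "a2 \<in> V - A" using ends[of e1] e by auto
  obtain b1 b2 where 2: "e2 = {b1, b2}" "b1 \<in> A" "b2 \<in> V - A" using ends[of e2] e by auto
  obtain d1 d2 where 3: "e3 = {d1, d2}" "d1 \<in> A" "d2 \<in> V - A" using ends[of e3] e by auto
  have cr: "cross E A (V - A) = {{a1, a2}, {b1, b2}, {d1, d2}}" using e 1 2 3 by simp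
  have cr': "cross E (V - A) (V - (V - A)) = {{a2, a1}, {b2, b1}, {d2, d1}}"
    unfolding VV cross_commute[of E "V - A"] cr by (simp add: insert_commute)
  have c3': "card (cross E (V - A) (V - (V - A))) = 3"
    unfolding VV cross_commute[of E "V - A"] by (rule c3)
  have t': "tight (V - (V - A))" "card (V - (V - A)) \<ge> 2" using t A VV by auto
  \<comment> \<open>The second instance is the same lemma for the complement, excluding shared ends
    in \<open>V - A\<close>.\<close>
  note sh = cut_3_shared_end[OF t A(2,3) _ c3] cut_3_shared_end[OF t(2) t'(1) A(3) t'(2) _ c3', unfolded VV]
  have "a1 \<noteq> b1" using sh(1)[of a1 a2 b2 d1 d2] cr 1 2 3 by auto
  moreover have "a1 \<noteq> d1" using sh(1)[of a1 a2 d2 b1 b2] cr 1 2 3 by (auto simp: insert_commute)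
  moreover have "b1 \<noteq> d1" using sh(1)[of b1 b2 d2 a1 a2] cr 1 2 3 by (auto simp: insert_commute)
  moreover have "a2 \<noteq> b2" using sh(2)[of a2 a1 b1 d2 d1] cr'[unfolded VV] 1 2 3 by auto
  moreover have "a2 \<noteq> d2" using sh(2)[of a2 a1 d1 b2 b1] cr'[unfolded VV] 1 2 3 by (auto simp: insert_commute)
  moreover have "b2 \<noteq> d2" using sh(2)[of b2 b1 d1 a2 a1] cr'[unfolded VV] 1 2 3 by (auto simp: insert_commute)
  ultimately show False
    using no_3_edge_cut[OF t A(2,3) cr] 1 2 3 by auto
qed

lemma separating_tight:
  assumes "w \<in> V" "nbrs E w = {x, y, z}" "x \<noteq> y" "x \<noteq> z" "y \<noteq> z" "{x, y} \<notin> E"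
  obtains X where "tight X" "w \<notin> X" "z \<notin> X" "x \<in> X" "y \<in> X"
  using separating_tight_or_reducible[OF assms] no_admissible[OF assms] by blast

text \<open>The sets share \<open>z\<close> and miss \<open>w\<close>, so they uncross. The union is
  tight and holds three neighbours of \<open>w\<close>, hence is everything but \<open>w\<close>;
  and \<open>x, y\<close> lie in opposite differences, between which there is no edge.\<close>

lemma tight_pair:
  assumes w: "w \<in> V" "nbrs E w = {x, y, z}" "x \<noteq> y" "x \<noteq> z" "y \<noteq> z"
    and X: "tight X" "w \<notin> X" "x \<notin> X" "y \<in> X" "z \<in> X"
    and Y: "tight Y" "w \<notin> Y" "y \<notin> Y" "x \<in> Y" "z \<in> Y"
  shows "X \<union> Y = V - {w}" "{x, y} \<notin> E"
proof -
  have ne: "X \<inter> Y \<noteq> {}" "X \<union> Y \<noteq> V" using X Y w by auto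
  note t = tight_Un[OF X(1) Y(1) ne]
  have "nbrs E w \<inter> (X \<union> Y) = {x, y, z}" using w X Y by auto
  then have "card (nbrs E w \<inter> (X \<union> Y)) = 3" using w by simp
  then have "insert w (X \<union> Y) = V" using tight_insert(1)[OF t(1) w(1)] X Y by auto
  then show "X \<union> Y = V - {w}" using X Y by auto
  show "{x, y} \<notin> E" using t(3)[of y x] X Y by (simp add: insert_commute)
qed

text \<open>The two missing edges supply the separating sets to which \<open>tight_pair\<close>
  applies.\<close>

lemma two_nonadjacent:
  assumes w: "w \<in> V" "nbrs E w = {x, y, z}" "x \<noteq> y" "x \<noteq> z" "y \<noteq> z"
    and yz: "{y, z} \<notin> E" and xz: "{x, z} \<notin> E"
  shows "{x, y} \<notin> E"
proof -
  have "nbrs E w = {y, z, x}" "nbrs E w = {x, z, y}" using w by auto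
  then obtain X Y where "tight X" "w \<notin> X" "x \<notin> X" "y \<in> X" "z \<in> X"
      "tight Y" "w \<notin> Y" "y \<notin> Y" "x \<in> Y" "z \<in> Y"
    using separating_tight[of w y z x] separating_tight[of w x z y] w yz xz by metis
  then show ?thesis using tight_pair(2)[OF w] by blast
qed

text \<open>The separating set of \<open>y, z\<close> absorbs \<open>x\<close>, which has exactly
  two neighbours there, and then \<open>w\<close> with its three neighbours completes
  \<open>V\<close>. So \<open>w\<close> and \<open>x\<close> are attached to the rest only through
  \<open>y\<close> and \<open>z\<close>: a two-vertex cut, which in an irreducible circuit must be
  an edge.\<close>

lemma one_nonadjacent:
  assumes w: "w \<in> V" "nbrs E w = {x, y, z}" "x \<noteq> y" "x \<noteq> z" "y \<noteq> z"
    and yz: "{y, z} \<notin> E" and xy: "{x, y} \<in> E" and xz: "{x, z} \<in> E"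
  shows False
proof -
  have wn: "nbrs E w = {y, z, x}" using w by auto
  obtain X where X: "tight X" "w \<notin> X" "x \<notin> X" "y \<in> X" "z \<in> X"
    using separating_tight[OF w(1) wn] w(3-5) yz by metis
  have xV: "x \<in> V" "y \<in> V" "z \<in> V" "x \<noteq> w" using w nbrs_V[of w] nbrs_irrefl[of w] by auto
  have fX: "finite X" using X tight_finite by auto
  have yzx: "{y, z} \<subseteq> nbrs E x \<inter> X" using xy xz X by (auto simp: nbrs_def)
  then have "card {y, z} \<le> card (nbrs E x \<inter> X)" using fin_nbrs by (intro card_mono) auto
  then have ge: "2 \<le> card (nbrs E x \<inter> X)" using w(5) by simp
  have nV: "insert x X \<noteq> V" using X w xV by auto
  then have c2: "card (nbrs E x \<inter> X) = 2" using tight_insert(1)[OF X(1) xV(1) X(3)] ge by auto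
  then have t: "tight (insert x X)" using tight_insert(2)[OF X(1) xV(1) X(3)] by simp
  have "nbrs E w \<inter> insert x X = {x, y, z}" using w X by auto
  then have "card (nbrs E w \<inter> insert x X) = 3" using w by simp
  then have V: "insert w (insert x X) = V" using tight_insert(1)[OF t w(1)] X xV by auto
  have nx: "nbrs E x \<inter> X = {y, z}" using yzx c2 w(5) fin_nbrs
    by (metis card_2_iff card_subset_eq finite_Int)
  have "2 \<le> card X" using X w(5) fX by (metis card_2_iff card_mono empty_subsetI insert_subset)
  then have "4 \<le> card X" using tight_card_ge_4 X by blast
  moreover have "card (X - {y, z}) = card X - 2" using X w by (subst card_Diff_subset) auto
  ultimately have "2 \<le> card (X - {y, z})" by simp
  then have ne: "X - {y, z} \<noteq> {}" by (metis card.empty not_numeral_le_zero)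
  have "{y, z} \<in> E \<and> (card {w, x} = 2 \<or> card (X - {y, z}) = 2)"
  proof (rule two_cut)
    show "{a, b} \<notin> E" if "a \<in> {w, x}" "b \<in> X - {y, z}" for a b
    proof
      assume "{a, b} \<in> E"
      then have "b \<in> nbrs E a" by (simp add: nbrs_def)
      then show False using that w nx X xV by auto
    qed
  qed (use ne V X w xV in auto)
  then show False using yz by simp
qed

section \<open>Types of degree 3 vertices and the final contradiction\<close>

definition type_K :: "'v \<Rightarrow> bool" where
  "type_K w \<longleftrightarrow> w \<in> V3 \<and> clique E (nbrs E w)"

definition type_A :: "'v \<Rightarrow> bool" where
  "type_A w \<longleftrightarrow> w \<in> V3 \<and> (\<forall>x\<in>nbrs E w. \<forall>y\<in>nbrs E w. {x, y} \<notin> E)"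

text \<open>Among the three pairs of neighbours, exactly one or exactly two missing edges are
  impossible, whichever pairs they are; so none or all are missing.\<close>

lemma node_types:
  assumes "w \<in> V3"
  shows "type_K w \<or> type_A w"
proof -
  have wV: "w \<in> V" "card (nbrs E w) = 3" using assms by auto
  obtain x y z where n: "nbrs E w = {x, y, z}" "x \<noteq> y" "x \<noteq> z" "y \<noteq> z" using card_3_E[OF wV(2)] by metis
  have perm: "nbrs E w = {y, x, z}" "nbrs E w = {z, y, x}" "nbrs E w = {x, z, y}" "nbrs E w = {y, z, x}" "nbrs E w = {z, x, y}"
    using n by auto
  have one: "{y, z} \<in> E \<or> {x, y} \<notin> E \<or> {x, z} \<notin> E" "{x, z} \<in> E \<or> {x, y} \<notin> E \<or> {y, z} \<notin> E"
      "{x, y} \<in> E \<or> {x, z} \<notin> E \<or> {y, z} \<notin> E"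
    using one_nonadjacent[OF wV(1) n] one_nonadjacent[OF wV(1) perm(1)] one_nonadjacent[OF wV(1) perm(2)] n(2-4)
    by (auto simp: insert_commute)
  have two: "{x, y} \<notin> E \<or> {y, z} \<in> E \<or> {x, z} \<in> E" "{x, z} \<notin> E \<or> {y, z} \<in> E \<or> {x, y} \<in> E"
      "{y, z} \<notin> E \<or> {x, z} \<in> E \<or> {x, y} \<in> E"
    using two_nonadjacent[OF wV(1) n] two_nonadjacent[OF wV(1) perm(3)] two_nonadjacent[OF wV(1) perm(4)] n(2-4)
    by (auto simp: insert_commute)
  \<comment> \<open>\<open>type_A\<close> also quantifies over equal neighbours, for which
    \<open>{x, y}\<close> is a singleton.\<close>
  have sing: "{a} \<notin> E" for a using graph_on by (auto simp: graph_on_def)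
  consider "{x, y} \<in> E" "{x, z} \<in> E" "{y, z} \<in> E" | "{x, y} \<notin> E" "{x, z} \<notin> E" "{y, z} \<notin> E"
    using one two by blast
  then show ?thesis
  proof cases
    case 1
    then have "type_K w" using assms n by (auto simp: type_K_def clique_def insert_commute)
    then show ?thesis ..
  next
    case 2
    then have "type_A w" using assms n sing by (auto simp: type_A_def insert_commute)
    then show ?thesis ..
  qed
qed

lemma type_K_K4:
  assumes "type_K w"
  shows "K4 (insert w (nbrs E w))"
proof -
  have "card (insert w (nbrs E w)) = 4" using assms nbrs_irrefl fin_nbrs by (simp add: type_K_def)
  moreover have "insert w (nbrs E w) \<subseteq> V" using assms nbrs_V by (auto simp: type_K_def)
  moreover have "clique E (insert w (nbrs E w))" using assms
    by (auto simp: type_K_def clique_def nbrs_def insert_commute)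
  ultimately show ?thesis by (simp add: K4_def)
qed

text \<open>Each nonadjacent pair of neighbours yields a separating set, and
  \<open>tight_pair\<close> applies to any two of them. The pairwise covers force a set that avoids
  \<open>w\<close> and is disjoint from \<open>X\<close> into both \<open>Y\<close> and
  \<open>Z\<close>.\<close>

lemma type_A_sets:
  assumes w: "type_A w" "nbrs E w = {x, y, z}" "x \<noteq> y" "x \<noteq> z" "y \<noteq> z"
  obtains X Y Z where
    "tight X" "tight Y" "tight Z" "w \<notin> X" "w \<notin> Y" "w \<notin> Z"
    "x \<notin> X" "y \<in> X" "z \<in> X" "x \<in> Y" "y \<notin> Y" "z \<in> Y" "x \<in> Z" "y \<in> Z" "z \<notin> Z"
    "X \<union> Y = V - {w}" "X \<union> Z = V - {w}" "Y \<union> Z = V - {w}"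
proof -
  have wV: "w \<in> V" using w by (simp add: type_A_def)
  have nE: "{x, y} \<notin> E" "{x, z} \<notin> E" "{y, z} \<notin> E" using w by (auto simp: type_A_def)
  have perm: "nbrs E w = {y, z, x}" "nbrs E w = {x, z, y}" using w by auto
  obtain X where X: "tight X" "w \<notin> X" "x \<notin> X" "y \<in> X" "z \<in> X"
    using separating_tight[OF wV perm(1)] w(3-5) nE by metis
  obtain Y where Y: "tight Y" "w \<notin> Y" "y \<notin> Y" "x \<in> Y" "z \<in> Y"
    using separating_tight[OF wV perm(2)] w(3-5) nE by metis
  obtain Z where Z: "tight Z" "w \<notin> Z" "z \<notin> Z" "x \<in> Z" "y \<in> Z"
    using separating_tight[OF wV w(2)] w(3-5) nE by metis
  have "X \<union> Y = V - {w}" using tight_pair(1)[OF wV w(2-5) X Y] .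
  moreover have "X \<union> Z = V - {w}" using tight_pair(1)[OF wV perm(2) _ _ _ X(1-3,5,4) Z(1-5)] w(3-5) by auto
  moreover have "Y \<union> Z = V - {w}" using tight_pair(1)[OF wV perm(1) _ _ _ Y(1-3,5,4) Z(1-3,5,4)] w(3-5) by auto
  ultimately show thesis using that X Y Z by metis
qed

text \<open>Vertices of degree 3 induce a forest.\<close>

lemma no_node_triangle:
  assumes "x \<in> V3" "y \<in> V3" "z \<in> V3" "x \<noteq> y" "x \<noteq> z" "y \<noteq> z" "{x, y} \<in> E" "{x, z} \<in> E" "{y, z} \<in> E"
  shows False
proof -
  let ?S = "{x, y, z}"
  have "clique E ?S" using assms by (auto simp: clique_def insert_commute)
  then have "spanned E ?S = 3" using clique_spanned(1)[of ?S] assms by (simp add: choose_two)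
  moreover have "?S \<noteq> V" using card_V_ge assms by auto
  then have "spanned E ?S \<le> int (card ?S) - 1" by (intro spanned_nodes) (use assms in auto)
  ultimately show False using assms by simp
qed

text \<open>The circuit has |T| + 3 vertices, hence 2|T| + 5 edges, of which the two tight parts
  take 6 + 2|T| - 2; so a single edge joins \<open>Q - T\<close> to \<open>T - Q\<close>. Its end
  \<open>r\<close> in \<open>Q\<close> has degree 4, while \<open>w\<close> and the fourth vertex
  \<open>s\<close> have degree 3, contrary to \<open>end_degree\<close>.\<close>

lemma K4_glued_at_vertex:
  assumes T: "tight T" and K: "K4 Q" and w: "w \<in> V3" "w \<in> Q" "w \<notin> T"
    and QT: "Q \<inter> T = {q}" and V: "Q \<union> T = V"
  shows False
proof -
  let ?C = "cross E (Q - T) (T - Q)"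
  have fQ: "finite Q" "card Q = 4" using K K4_finite by (auto simp: K4_def)
  have "card V + 1 = 4 + card T"
    using card_Un_Int[of Q T] fQ tight_finite[OF T] QT V by simp
  then have c1: "card ?C = 1"
    using spanned_Un_Int[OF graph_on, of Q T] QT V spanned_V K4_spanned[OF K] spanned_sing[OF graph_on, of q] T
    by (simp add: tight_def)
  then obtain e where e: "?C = {e}" by (auto simp: card_1_singleton_iff)
  have eE: "e \<in> E" using e by (auto simp: cross_def)
  obtain r t where rt: "e = {r, t}" "r \<in> Q - T" "t \<in> T - Q"
  proof -
    obtain x y where "e = {x, y}" using graph_on_edgeE[OF graph_on eE] by blast
    moreover have "e \<inter> (Q - T) \<noteq> {}" "e \<inter> (T - Q) \<noteq> {}" using e by (auto simp: cross_def)
    ultimately show thesis using that[of x y] that[of y x] by (auto simp: insert_commute)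
  qed
  have only: "x = r \<and> y = t" if "x \<in> Q - T" "y \<in> T - Q" "{x, y} \<in> E" for x y
  proof -
    have "{x, y} \<in> ?C" using that by (auto simp: cross_def)
    then have "{x, y} = {r, t}" using e rt by simp
    then show ?thesis using that rt by (auto simp: doubleton_eq_iff)
  qed
  have nw: "nbrs E w = Q - {w}" using K4_nbrs[OF K w(2)] w(1) by simp
  have wr: "w \<noteq> r" using nw rt eE by (auto simp: nbrs_def)
  have "{q, r, w} \<subseteq> Q" "q \<noteq> r" "q \<noteq> w" using QT rt(2) w by blast+
  then have "card (Q - {q, r, w}) = 4 - card {q, r, w}" "card {q, r, w} = 3"
    using card_Diff_subset[of "{q, r, w}" Q] fQ wr by auto
  then have cq: "card (Q - {q, r, w}) = 1" by simp
  then obtain s where s: "Q - {q, r, w} = {s}" by (auto simp: card_1_singleton_iff)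
  have qm: "q \<in> Q" "q \<in> T" using QT by auto
  have sQ: "s \<in> Q" "s \<noteq> q" "s \<noteq> r" "s \<noteq> w" using s by auto
  have sT: "s \<notin> T" using sQ QT by blast
  have Qeq: "Q = {r, q, w, s}" using s qm rt w by blast
  have dist: "r \<noteq> q" "r \<noteq> w" "r \<noteq> s" "q \<noteq> w" "q \<noteq> s" "w \<noteq> s" using rt qm w wr sQ by auto
  have ns: "nbrs E s = Q - {s}"
  proof
    show "nbrs E s \<subseteq> Q - {s}"
    proof
      fix y assume y: "y \<in> nbrs E s"
      then have "y \<in> V" "y \<noteq> s" "{s, y} \<in> E" using nbrs_V nbrs_irrefl by (auto simp: nbrs_def)
      then show "y \<in> Q - {s}" using only[of s y] sQ sT V by blast
    qed
    show "Q - {s} \<subseteq> nbrs E s" using K4_edge[OF K] sQ by (auto simp: nbrs_def)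
  qed
  have nr: "nbrs E r = insert t (Q - {r})"
  proof
    show "nbrs E r \<subseteq> insert t (Q - {r})"
    proof
      fix y assume y: "y \<in> nbrs E r"
      then have "y \<in> V" "y \<noteq> r" "{r, y} \<in> E" using nbrs_V nbrs_irrefl by (auto simp: nbrs_def)
      then show "y \<in> insert t (Q - {r})" using only[of r y] rt V by blast
    qed
    show "insert t (Q - {r}) \<subseteq> nbrs E r" using K4_edge[OF K] rt eE by (auto simp: nbrs_def)
  qed
  have "card (nbrs E r) = 4" unfolding nr using fQ rt by simp
  moreover have "card (nbrs E s) = 3" unfolding ns using fQ sQ by simp
  moreover have "K4 {r, q, w, s}" using K Qeq by simp
  ultimately show False using end_degree[of r q w s] dist w(1) by auto
qed

text \<open>With two neighbours in \<open>T\<close>, the vertex \<open>w\<close> could be added to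
  \<open>T\<close>, against maximality, since \<open>w\<close> is not a vertex of large degree. If
  type A vertices occurred outside \<open>T\<close>, one that is a leaf among them would have a
  neighbour of large degree outside \<open>T\<close>; its separating sets are then trapped by the
  maximality of \<open>T\<close>.\<close>

lemma tight_complement_nodes_type_K:
  assumes T: "tight T" and L: "\<not> V - T \<subseteq> V3"
    and max: "\<And>T'. tight T' \<Longrightarrow> T \<subseteq> T' \<Longrightarrow> \<not> V - T' \<subseteq> V3 \<Longrightarrow> T' = T"
    and w: "w \<in> V3" "w \<notin> T"
  shows "card (nbrs E w \<inter> T) \<le> 1" "type_K w"
proof -
  have one: "card (nbrs E w \<inter> T) \<le> 1" if w: "w \<in> V3" "w \<notin> T" for w
  proof (rule ccontr)
    assume n: "\<not> ?thesis"
    have nV: "insert w T \<noteq> V"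
    proof
      assume "insert w T = V"
      then have "V - T \<subseteq> {w}" by auto
      then show False using L w by auto
    qed
    then have "card (nbrs E w \<inter> T) = 2" using tight_insert(1)[OF T, of w] w n by auto
    then have "tight (insert w T)" using tight_insert(2)[OF T, of w] w by simp
    moreover have "\<not> V - insert w T \<subseteq> V3" using L w by blast
    ultimately show False using max[of "insert w T"] w by auto
  qed
  then show "card (nbrs E w \<inter> T) \<le> 1" using w .
  let ?S = "{u \<in> V - T. type_A u}"
  have "?S = {}"
  proof (rule ccontr)
    assume ne: "?S \<noteq> {}"
    have "?S \<subseteq> V3" by (auto simp: type_A_def)
    moreover have "?S \<noteq> V" using T by (auto simp: tight_def)
    ultimately obtain u where u: "u \<in> ?S" "card (nbrs E u \<inter> ?S) \<le> 1" using node_leaf[OF _ ne] by blast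
    have uA: "type_A u" "u \<in> V - T" "u \<in> V3" using u by (auto simp: type_A_def)
    have uT: "card (nbrs E u \<inter> T) \<le> 1" using one uA by blast
    \<comment> \<open>Such an \<open>l\<close> of degree 3 would be of type K, and its complete
      neighbourhood would put \<open>u\<close> in a triangle, making two neighbours of
      \<open>u\<close> adjacent.\<close>
    have big: "l \<notin> V3" if l: "l \<in> nbrs E u" "l \<notin> T" "l \<notin> ?S" for l
    proof
      assume "l \<in> V3"
      then have tK: "type_K l" using node_types l nbrs_V by blast
      have cl: "clique E (nbrs E l)" "card (nbrs E l) = 3" using tK by (auto simp: type_K_def)
      have ul: "u \<in> nbrs E l" using l(1) nbrs_sym by metis
      have "\<not> nbrs E l \<subseteq> {u}"
      proof
        assume "nbrs E l \<subseteq> {u}"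
        then have "card (nbrs E l) \<le> card {u}" by (intro card_mono) auto
        then show False using cl(2) by simp
      qed
      then obtain q where q: "q \<in> nbrs E l" "q \<noteq> u" by blast
      then have "{u, q} \<in> E" using cl(1) ul by (auto simp: clique_def)
      then have "q \<in> nbrs E u" by (simp add: nbrs_def)
      moreover have "{l, q} \<in> E" using q by (simp add: nbrs_def)
      ultimately show False using uA(1) l(1) by (auto simp: type_A_def)
    qed
    \<comment> \<open>At most one of the three neighbours lies in \<open>T\<close> and at most one
      is a type A vertex outside \<open>T\<close>, so the third has degree at least 4 and lies
      outside \<open>T\<close>.\<close>
    have "\<not> nbrs E u \<subseteq> (nbrs E u \<inter> T) \<union> (nbrs E u \<inter> ?S)"
    proof
      assume "nbrs E u \<subseteq> (nbrs E u \<inter> T) \<union> (nbrs E u \<inter> ?S)"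
      then have "card (nbrs E u) \<le> card ((nbrs E u \<inter> T) \<union> (nbrs E u \<inter> ?S))"
        using fin_nbrs by (intro card_mono) auto
      also have "\<dots> \<le> 1 + 1" using card_Un_le[of "nbrs E u \<inter> T" "nbrs E u \<inter> ?S"] uT u(2) by linarith
      finally show False using uA(3) by simp
    qed
    then obtain l1 where l1: "l1 \<in> nbrs E u" "l1 \<notin> T" "l1 \<notin> ?S" by blast
    have l1V: "l1 \<notin> V3" using big[OF l1] .
    have "card (nbrs E u - {l1}) = 2" using l1 uA(3) fin_nbrs by simp
    then obtain l2 l3 where l23: "nbrs E u - {l1} = {l2, l3}" "l2 \<noteq> l3" by (auto simp: card_2_iff)
    have n: "nbrs E u = {l1, l2, l3}" "l1 \<noteq> l2" "l1 \<noteq> l3" "l2 \<noteq> l3" using l23 l1(1) by auto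
    obtain X Y Z where XYZ: "tight X" "tight Y" "tight Z" "u \<notin> X" "u \<notin> Y" "u \<notin> Z"
      "l1 \<notin> X" "l2 \<in> X" "l3 \<in> X" "l1 \<in> Y" "l2 \<notin> Y" "l3 \<in> Y" "l1 \<in> Z" "l2 \<in> Z" "l3 \<notin> Z"
      "X \<union> Y = V - {u}" "X \<union> Z = V - {u}" "Y \<union> Z = V - {u}"
      using type_A_sets[OF uA(1) n] by metis
    have lV: "l1 \<in> V" "l2 \<in> V" "l3 \<in> V" using n nbrs_V[of u] by auto
    \<comment> \<open>A tight set that meets \<open>T\<close> and misses a vertex of large degree
      outside \<open>T\<close> can be united with \<open>T\<close> without losing the property for
      which \<open>T\<close> is maximal.\<close>
    have absorb: "W \<subseteq> T" if W: "tight W" "u \<notin> W" "l \<notin> W" "W \<inter> T \<noteq> {}" "l \<in> V" "l \<notin> T" "l \<notin> V3" for W l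
    proof -
      have "W \<union> T \<noteq> V" using W(2) uA by blast
      then have "tight (W \<union> T)" using tight_Un(1)[OF W(1) T] W(4) by blast
      moreover have "\<not> V - (W \<union> T) \<subseteq> V3" using W by blast
      ultimately have "W \<union> T = T" using max[of "W \<union> T"] by blast
      then show ?thesis by blast
    qed
    have TV: "T \<subseteq> V" "T \<noteq> {}" using T by (auto simp: tight_def)
    show False
    proof (cases "X \<inter> T = {}")
      case False
      have "X \<subseteq> T" by (rule absorb[OF XYZ(1,4,7) False lV(1) l1(2) l1V])
      then have "{l2, l3} \<subseteq> nbrs E u \<inter> T" using XYZ(8,9) n(1) by auto
      then have "card {l2, l3} \<le> card (nbrs E u \<inter> T)" using fin_nbrs by (intro card_mono) auto
      then show False using uT n by simp
    next
      case True
      have "T \<subseteq> V - {u}" using TV(1) uA(2) by blast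
      then have "T \<subseteq> X \<union> Y" "T \<subseteq> X \<union> Z" using XYZ(16,17) by simp_all
      \<comment> \<open>Now neither \<open>l2\<close> nor \<open>l3\<close> is in \<open>T\<close>,
        and not both are of type A, so one of them also has large degree. The separating set that
        misses it contains \<open>T\<close> and must lie in \<open>T\<close>, although it contains
        \<open>l1\<close>.\<close>
      then have "T \<subseteq> Y" "T \<subseteq> Z" using True by blast+
      then have nT: "l2 \<notin> T" "l3 \<notin> T" using XYZ(11,15) by auto
      have "l2 \<notin> ?S \<or> l3 \<notin> ?S"
      proof (rule ccontr)
        assume "\<not> ?thesis"
        then have "{l2, l3} \<subseteq> nbrs E u \<inter> ?S" using n by blast
        then have "card {l2, l3} \<le> card (nbrs E u \<inter> ?S)" using fin_nbrs by (intro card_mono) auto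
        then show False using u(2) n by simp
      qed
      then show False
      proof
        assume "l2 \<notin> ?S"
        then have "l2 \<notin> V3" using big[of l2] n nT by blast
        moreover have "Y \<inter> T \<noteq> {}" using \<open>T \<subseteq> Y\<close> TV by blast
        ultimately have "Y \<subseteq> T" by (intro absorb[OF XYZ(2,5,11) _ lV(2) nT(1)])
        then show False using XYZ(10) l1(2) by blast
      next
        assume "l3 \<notin> ?S"
        then have "l3 \<notin> V3" using big[of l3] n nT by blast
        moreover have "Z \<inter> T \<noteq> {}" using \<open>T \<subseteq> Z\<close> TV by blast
        ultimately have "Z \<subseteq> T" by (intro absorb[OF XYZ(3,6,15) _ lV(3) nT(2)])
        then show False using XYZ(13) l1(2) by blast
      qed
    qed
  qed
  moreover have "w \<in> V - T" using w by auto
  ultimately show "type_K w" using node_types w by blast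
qed

text \<open>Otherwise the K_4 of \<open>w\<close> meets \<open>T\<close> in one vertex. If the two
  cover \<open>V\<close>, \<open>K4_glued_at_vertex\<close> applies. If not, their union is tight
  and, by maximality of \<open>T\<close>, everything outside it has degree 3; the K_4 of an outside
  vertex is then forced to contain an edge between the two differences, which uncrossing
  forbids.\<close>

lemma tight_complement_K4s:
  assumes T: "tight T" and L: "\<not> V - T \<subseteq> V3"
    and max: "\<And>T'. tight T' \<Longrightarrow> T \<subseteq> T' \<Longrightarrow> \<not> V - T' \<subseteq> V3 \<Longrightarrow> T' = T"
    and w: "w \<in> V3" "w \<notin> T"
  shows "insert w (nbrs E w) \<inter> T = {}"
proof (rule ccontr)
  assume ne: "insert w (nbrs E w) \<inter> T \<noteq> {}"
  note nodes = tight_complement_nodes_type_K[OF T L max]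
  let ?Q = "insert w (nbrs E w)"
  have K: "K4 ?Q" using type_K_K4 nodes(2)[OF _ _ _ w] by blast
  have QT: "?Q \<inter> T = nbrs E w \<inter> T" using w by auto
  have "card (?Q \<inter> T) \<le> 1" unfolding QT using nodes(1)[OF _ _ _ w] by blast
  moreover have "card (?Q \<inter> T) \<noteq> 0" using ne fin_nbrs by simp
  ultimately have "card (?Q \<inter> T) = 1" by linarith
  then obtain q where q: "?Q \<inter> T = {q}" by (auto simp: card_1_singleton_iff)
  show False
  proof (cases "?Q \<union> T = V")
    case True
    then show False using K4_glued_at_vertex[OF T K w(1) _ w(2) q] by blast
  next
    case False
    note t = tight_Un[OF K4_tight[OF K] T ne False]
    have "\<not> ?Q \<union> T = T" using w by blast
    then have sub: "V - (?Q \<union> T) \<subseteq> V3" using max[OF t(1)] by blast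
    have "?Q \<union> T \<subseteq> V" using t(1) by (simp add: tight_def)
    then obtain p where p: "p \<in> V" "p \<notin> ?Q" "p \<notin> T" using False by blast
    then have p3: "p \<in> V3" using sub by blast
    let ?P = "insert p (nbrs E p)"
    have KP: "K4 ?P" using type_K_K4 nodes(2)[OF _ _ _ p3 p(3)] by blast
    have PT: "?P \<inter> T = nbrs E p \<inter> T" using p by auto
    have cPT: "card (?P \<inter> T) \<le> 1" unfolding PT using nodes(1)[OF _ _ _ p3 p(3)] by blast
    have cPQ: "card (?P \<inter> ?Q) \<le> 1" using K4_Int[OF KP K] p by blast
    have cP: "card ?P = 4" "finite ?P" "?P \<subseteq> V" using KP K4_finite[OF KP] unfolding K4_def by blast+
    let ?O = "?P - (?Q \<union> T)"
    have O3: "?O \<subseteq> V3" using sub cP by blast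
    have cl: "{x, y} \<in> E" if "x \<in> ?P" "y \<in> ?P" "x \<noteq> y" for x y using K4_edge[OF KP] that by blast
    \<comment> \<open>Three vertices of this K_4 outside both sets would be a triangle of vertices
      of degree 3.\<close>
    have "card ?O \<le> 2"
    proof (rule ccontr)
      assume "\<not> ?thesis"
      then have "3 \<le> card ?O" by simp
      then obtain S where S: "S \<subseteq> ?O" "card S = 3" using obtain_subset_with_card_n by metis
      obtain x y z where xyz: "S = {x, y, z}" "x \<noteq> y" "x \<noteq> z" "y \<noteq> z" using card_3_E[OF S(2)] by metis
      have m: "x \<in> ?P" "y \<in> ?P" "z \<in> ?P" "x \<in> V3" "y \<in> V3" "z \<in> V3" using xyz S O3 by blast+
      show False using no_node_triangle[OF m(4-6) xyz(2-4) cl[OF m(1,2) xyz(2)] cl[OF m(1,3) xyz(3)] cl[OF m(2,3) xyz(4)]] .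
    qed
    moreover have "?P = ?O \<union> ((?P \<inter> ?Q) \<union> (?P \<inter> T))" by blast
    then have "card ?P \<le> card ?O + card ((?P \<inter> ?Q) \<union> (?P \<inter> T))" using card_Un_le by metis
    ultimately have two: "2 \<le> card ((?P \<inter> ?Q) \<union> (?P \<inter> T))" using cP by linarith
    have nQ: "\<not> (?P \<inter> ?Q) \<union> (?P \<inter> T) \<subseteq> ?P \<inter> ?Q"
    proof
      assume "(?P \<inter> ?Q) \<union> (?P \<inter> T) \<subseteq> ?P \<inter> ?Q"
      then have "(?P \<inter> ?Q) \<union> (?P \<inter> T) = ?P \<inter> ?Q" by blast
      then show False using two cPQ by simp
    qed
    then obtain a where a: "a \<in> ?P" "a \<in> T" "a \<notin> ?Q" by blast
    have nT: "\<not> (?P \<inter> ?Q) \<union> (?P \<inter> T) \<subseteq> ?P \<inter> T"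
    proof
      assume "(?P \<inter> ?Q) \<union> (?P \<inter> T) \<subseteq> ?P \<inter> T"
      then have "(?P \<inter> ?Q) \<union> (?P \<inter> T) = ?P \<inter> T" by blast
      then show False using two cPT by simp
    qed
    then obtain b where b: "b \<in> ?P" "b \<in> ?Q" "b \<notin> T" by blast
    \<comment> \<open>At least two vertices of \<open>?P\<close> lie in \<open>?Q\<close> or
      \<open>T\<close> but at most one in each, so it has vertices \<open>a\<close> and
      \<open>b\<close> in the opposite differences.\<close>
    have "{b, a} \<in> E" using cl a b by blast
    then show False using t(3)[of b a] a b by blast
  qed
qed

theorem no_irreducible_circuit: False
proof -
  have "\<not> V \<subseteq> V3" using two_big by blast
  then obtain t where t: "t \<in> V" "t \<notin> V3" by blast
  \<comment> \<open>Keeping \<open>t\<close>, of degree at least 4, inside \<open>T\<close> serves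
    two purposes: two sets in \<open>V - T\<close> never cover \<open>V\<close>, and no tight set in
    \<open>V - T\<close> is the complement of a single vertex, since that vertex would be
    \<open>t\<close> and have degree 3.\<close>
  let ?F = "{T. tight T \<and> t \<in> T \<and> \<not> V - T \<subseteq> V3}"
  have "V \<noteq> {t}" using card_V_ge by auto
  then have "tight {t}" using t spanned_sing[OF graph_on] by (auto simp: tight_def)
  then have F: "{t} \<in> ?F" using two_big by blast
  have "?F \<subseteq> Pow V" by (auto simp: tight_def)
  then have "finite ?F" using finV finite_subset by blast
  from finite_has_maximal2[OF this F]
  obtain T where T: "T \<in> ?F" and mx: "\<forall>T'\<in>?F. T \<subseteq> T' \<longrightarrow> T = T'" by (elim bexE conjE)
  have tT: "tight T" "t \<in> T" and L: "\<not> V - T \<subseteq> V3" using T by auto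
  have max: "T' = T" if T': "tight T'" "T \<subseteq> T'" "\<not> V - T' \<subseteq> V3" for T'
  proof -
    have "T' \<in> ?F" using T' tT(2) by auto
    from mp[OF bspec[OF mx this] T'(2)] show ?thesis by (rule sym)
  qed
  have typeK: "type_K w" "insert w (nbrs E w) \<inter> T = {}" if "w \<in> V3" "w \<notin> T" for w
    using tight_complement_nodes_type_K(2)[OF tT(1) L max that] tight_complement_K4s[OF tT(1) L max that] by auto
  let ?L = "V - T"
  have TV: "T \<subseteq> V" using tT by (simp add: tight_def)
  let ?s = "\<lambda>v. 4 - int (card (nbrs E v))"
  \<comment> \<open>Singletons are left out: a single vertex of degree 3 has weight 1.\<close>
  define S where "S = {S. tight S \<and> S \<subseteq> ?L \<and> 2 \<le> card S}"
  define M where "M = {A \<in> S. \<forall>B\<in>S. A \<subseteq> B \<longrightarrow> B = A}"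
  have finS: "finite S" using finV finite_subset[of S "Pow V"] by (auto simp: S_def)
  have disj: "A \<inter> B = {}" if "A \<in> M" "B \<in> M" "A \<noteq> B" for A B
  proof (rule ccontr)
    assume ne: "A \<inter> B \<noteq> {}"
    have AB: "tight A" "tight B" "A \<subseteq> ?L" "B \<subseteq> ?L" "2 \<le> card A" using that by (auto simp: M_def S_def)
    have "A \<union> B \<noteq> V" using AB tT t by blast
    then have tAB: "tight (A \<union> B)" using tight_Un(1)[OF AB(1,2) ne] by blast
    have "card A \<le> card (A \<union> B)" using tight_finite[OF tAB] by (intro card_mono) auto
    then have "A \<union> B \<in> S" using tAB AB by (auto simp: S_def)
    then have "A \<union> B = A" "A \<union> B = B" using that by (auto simp: M_def)
    then show False using that by blast
  qed
  have neg: "(\<Sum>v\<in>A. ?s v) \<le> 0" if "A \<in> M" for A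
  proof -
    have A: "tight A" "A \<subseteq> ?L" "2 \<le> card A" using that by (auto simp: M_def S_def)
    have AV: "A \<subseteq> V" using A by blast
    have TA: "T \<subseteq> V - A" using A TV by blast
    have "card (V - A) \<noteq> 0" using TA tT finV by auto
    moreover have "card (V - A) \<noteq> 1"
    proof
      assume "card (V - A) = 1"
      then obtain x where "V - A = {x}" by (auto simp: card_1_singleton_iff)
      then have "V - A = {t}" using subsetD[OF TA tT(2)] by simp
      then have "insert t A = V" "t \<notin> A" using AV by auto
      then have "card (nbrs E t) = 3" using tight_insert(3)[OF A(1) t(1)] by blast
      then show False using t by blast
    qed
    ultimately have "2 \<le> card (V - A)" by linarith
    then have "4 \<le> card (cross E A (V - A))" using cut_ge_4[OF AV A(3)] by blast
    then show ?thesis using surplus[OF AV] A(1) by (simp add: tight_def)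
  qed
  have cover: "w \<in> \<Union>M" if w: "w \<in> V3" "w \<notin> T" for w
  proof -
    let ?Q = "insert w (nbrs E w)"
    have "K4 ?Q" using type_K_K4 typeK[OF w] by blast
    then have "?Q \<in> S" using typeK(2)[OF w] K4_tight by (auto simp: S_def K4_def)
    then obtain A where "A \<in> S" "?Q \<subseteq> A" "\<forall>B\<in>S. A \<subseteq> B \<longrightarrow> B = A"
      using finite_has_maximal2[OF finS] by metis
    then have "A \<in> M" "w \<in> A" by (auto simp: M_def)
    then show ?thesis by blast
  qed
  have UM: "\<Union>M \<subseteq> ?L" by (auto simp: M_def S_def)
  have finL: "finite ?L" using finV by simp
  have "(\<Sum>v\<in>?L. ?s v) = (\<Sum>v\<in>\<Union>M. ?s v) + (\<Sum>v\<in>?L - \<Union>M. ?s v)"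
    using sum.subset_diff[OF UM finL] by (simp add: add.commute)
  also have "(\<Sum>v\<in>\<Union>M. ?s v) = (\<Sum>A\<in>M. \<Sum>v\<in>A. ?s v)"
    using sum.Union_disjoint[of M ?s] disj tight_finite by (auto simp: M_def S_def)
  also have "\<dots> \<le> 0" by (rule sum_nonpos) (rule neg)
  also have "(\<Sum>v\<in>?L - \<Union>M. ?s v) \<le> 0"
  proof (rule sum_nonpos)
    fix v assume v: "v \<in> ?L - \<Union>M"
    then have "v \<notin> V3" using cover by blast
    then show "?s v \<le> 0" using v deg_ge_3[of v] by auto
  qed
  finally have le: "(\<Sum>v\<in>?L. ?s v) \<le> 0" by simp
  have LT: "V - ?L = T" using TV by blast
  have "card V = card T + card ?L" using TV finV by (metis card_Diff_subset card_mono finite_subset le_add_diff_inverse)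
  moreover have "int (card E) = spanned E T + spanned E ?L + int (card (cross E T ?L))" using spanned_split[OF graph_on TV] .
  moreover have "(\<Sum>v\<in>?L. ?s v) = 4 * int (card ?L) - 2 * spanned E ?L - int (card (cross E T ?L))"
    using surplus[of ?L] unfolding LT cross_commute[of E ?L] by blast
  moreover have "3 \<le> card (cross E T ?L)" using cut_ge_3(1)[of T] tT by (simp add: tight_def)
  moreover have "spanned E T = 2 * int (card T) - 2" using tT by (simp add: tight_def)
  \<comment> \<open>With d edges leaving \<open>T\<close>, the edge count gives 2|L| + 1 - d edges
    inside L, so the weight of L is 4|L| - 2(2|L| + 1 - d) - d = d - 2, at least 1.\<close>
  ultimately show False using le cardE by linarith
qed

end

section \<open>Henneberg moves and joins of edge sets\<close>

lemma spanned_restrict: "Y \<subseteq> R \<Longrightarrow> spanned {e \<in> E. e \<subseteq> R} Y = spanned E Y"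
proof -
  assume "Y \<subseteq> R"
  then have "{e \<in> {e \<in> E. e \<subseteq> R}. e \<subseteq> Y} = {e \<in> E. e \<subseteq> Y}" by blast
  then show ?thesis by (simp add: spanned_def)
qed

lemma spanned_cong: "(\<And>e. e \<subseteq> X \<Longrightarrow> e \<in> E \<longleftrightarrow> e \<in> F) \<Longrightarrow> spanned E X = spanned F X"
  unfolding spanned_def by (metis (no_types, lifting) Collect_cong)

lemma spanned_Un:
  assumes "finite E" "finite F" "E \<inter> F = {}"
  shows "spanned (E \<union> F) X = spanned E X + spanned F X"
proof -
  have "{e \<in> E \<union> F. e \<subseteq> X} = {e \<in> E. e \<subseteq> X} \<union> {e \<in> F. e \<subseteq> X}" by blast
  moreover have "card ({e \<in> E. e \<subseteq> X} \<union> {e \<in> F. e \<subseteq> X}) = card {e \<in> E. e \<subseteq> X} + card {e \<in> F. e \<subseteq> X}"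
    by (rule card_Un_disjoint) (use assms in auto)
  ultimately show ?thesis by (simp add: spanned_def)
qed

lemma spanned_remove_edge:
  assumes "finite E" "f \<in> E"
  shows "spanned (E - {f}) X = spanned E X - (if f \<subseteq> X then 1 else 0)"
  using spanned_insert_edge[of "E - {f}" f X] assms by (simp add: insert_absorb)

lemma card_Int_le_2:
  assumes "\<not> {x, y} \<subseteq> Y"
  shows "card ({x, y, z} \<inter> Y) \<le> 2"
proof -
  obtain t where "{x, y, z} \<inter> Y \<subseteq> {t, z}" using assms by blast
  then have "card ({x, y, z} \<inter> Y) \<le> card {t, z}" by (intro card_mono) auto
  also have "\<dots> \<le> 2" by (simp add: card_insert_if)
  finally show ?thesis .
qed

lemma card_Int_le_3: "card ({x, y, z} \<inter> Y) \<le> 3"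
proof -
  have "card ({x, y, z} \<inter> Y) \<le> card {x, y, z}" by (intro card_mono) auto
  also have "\<dots> \<le> 3" by (simp add: card_insert_if)
  finally show ?thesis .
qed

lemma nbrs_insert_star:
  assumes "graph_on V E" "v \<notin> V" "F \<subseteq> E"
  shows "nbrs (F \<union> {{v, x}, {v, y}, {v, z}}) v = {x, y, z}"
proof -
  have "{v, t} \<notin> F" for t using assms unfolding graph_on_def by blast
  then show ?thesis by (auto simp: nbrs_def doubleton_eq_iff)
qed

lemma spanned_star_irrelevant:
  assumes "v \<notin> Y"
  shows "spanned (F \<union> {{v, x}, {v, y}, {v, z}}) Y = spanned F Y"
  using assms by (intro spanned_cong) auto

text \<open>Adding \<open>v\<close> to a set raises the bound by 2. It brings three edges only if
  \<open>u, w, z\<close> are all present, and then the deleted edge \<open>uw\<close> pays one back.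
  Without \<open>v\<close>, the set \<open>V\<close> itself is brought down to the bound by the loss
  of \<open>uw\<close>.\<close>

theorem circuit_on_henneberg2:
  assumes C: "circuit_on V E" and uw: "{u, w} \<in> E" and z: "z \<in> V" "z \<notin> {u, w}" and v: "v \<notin> V"
  shows "circuit_on (insert v V) (E - {{u, w}} \<union> {{v, u}, {v, w}, {v, z}})"
proof -
  interpret circuit_graph V E using C by unfold_locales
  let ?F = "E - {{u, w}}"
  let ?E = "?F \<union> {{v, u}, {v, w}, {v, z}}"
  have uwV: "u \<noteq> w" "u \<in> V" "w \<in> V" using edge_props[OF uw] by auto
  have vn: "v \<noteq> u" "v \<noteq> w" "v \<noteq> z" using uwV z v by auto
  have g: "graph_on (insert v V) ?E"
    using graph_on uwV z vn unfolding graph_on_def by auto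
  have nb: "nbrs ?E v = {u, w, z}" by (rule nbrs_insert_star[OF graph_on v]) blast
  have low: "spanned ?E Y = spanned E Y - (if {u, w} \<subseteq> Y then 1 else 0)" if "v \<notin> Y" for Y
    using spanned_star_irrelevant[OF that] spanned_remove_edge[OF finE uw] by metis
  have high: "spanned ?E (insert v Y) = spanned E Y - (if {u, w} \<subseteq> Y then 1 else 0) + int (card ({u, w, z} \<inter> Y))"
    if "v \<notin> Y" for Y using spanned_insert[OF g that] low[OF that] nb by simp
  have sparse': "spanned ?E X \<le> 2 * int (card X) - 2"
    if X: "X \<subseteq> insert v V" "X \<noteq> {}" "X \<noteq> insert v V" for X
  proof (cases "v \<in> X")
    case False
    then have XV: "X \<subseteq> V" using X by auto
    show ?thesis
    proof (cases "X = V")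
      case True
      then show ?thesis using low[OF False] spanned_V uwV by simp
    next
      case F: False
      then show ?thesis using low[OF False] sparse[OF XV X(2)] by auto
    qed
  next
    case True
    define Y where "Y = X - {v}"
    have Y: "v \<notin> Y" "X = insert v Y" "Y \<subseteq> V" "Y \<noteq> V" using X True by (auto simp: Y_def)
    have fY: "finite Y" using Y finV finite_subset by blast
    have cX: "card X = card Y + 1" using Y fY by simp
    show ?thesis
    proof (cases "Y = {}")
      case True
      then show ?thesis using high[OF Y(1)] Y cX spanned_empty[OF graph_on] by simp
    next
      case False
      have sp: "spanned E Y \<le> 2 * int (card Y) - 2" using sparse Y False by blast
      show ?thesis
        using high[OF Y(1)] sp cX card_Int_le_3[of u w z Y] card_Int_le_2[of u w Y z]
        unfolding Y(2)[symmetric] by auto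
    qed
  qed
  have "card ({u, w, z} \<inter> V) = 3"
  proof -
    have "{u, w, z} \<inter> V = {u, w, z}" using uwV z by auto
    then show ?thesis using uwV z by (auto simp: card_insert_if)
  qed
  then have "spanned ?E (insert v V) = 2 * int (card (insert v V)) - 1"
    using high[OF v] spanned_V uwV finV v by simp
  then have "int (card ?E) = 2 * int (card (insert v V)) - 1" using spanned_whole[OF g order_refl] by simp
  then show ?thesis using circuit_on_intro[OF g _ sparse'] by blast
qed

text \<open>What is left of a circuit when a vertex of degree 3 with neighbours \<open>x, y, z\<close> is deleted.\<close>

definition node_side :: "'v set \<Rightarrow> 'v set set \<Rightarrow> 'v \<Rightarrow> 'v \<Rightarrow> 'v \<Rightarrow> bool" where
  "node_side A F x y z \<longleftrightarrow> graph_on A F \<and> x \<noteq> y \<and> x \<noteq> z \<and> y \<noteq> z \<and> {x, y, z} \<subseteq> A \<and>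
     int (card F) = 2 * int (card A) - 2 \<and>
     (\<forall>Y\<subseteq>A. Y \<noteq> {} \<longrightarrow> spanned F Y \<le> 2 * int (card Y) - 2) \<and>
     (\<forall>Y\<subseteq>A. {x, y, z} \<subseteq> Y \<and> Y \<noteq> A \<longrightarrow> spanned F Y \<le> 2 * int (card Y) - 3)"

lemma node_side_finite: "node_side A F x y z \<Longrightarrow> finite A \<and> finite F"
  using graph_on_finite_edges by (auto simp: node_side_def graph_on_def)

text \<open>Restoring \<open>v\<close> to a set with all three neighbours adds three edges but
  raises the bound by only 2, so such a set, unless it is everything, stays one below the usual
  bound.\<close>

lemma circuit_on_node_side:
  assumes C: "circuit_on V E" and v: "v \<in> V" "nbrs E v = {x, y, z}" "x \<noteq> y" "x \<noteq> z" "y \<noteq> z"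
  shows "node_side (V - {v}) {e \<in> E. v \<notin> e} x y z"
proof -
  interpret circuit_graph V E using C by unfold_locales
  let ?A = "V - {v}" and ?F = "{e \<in> E. v \<notin> e}"
  have g: "graph_on ?A ?F" using graph_on by (auto simp: graph_on_def)
  have xyz: "{x, y, z} \<subseteq> ?A" using v(2) nbrs_V[of v] nbrs_irrefl[of v] by auto
  have e: "spanned ?F Y = spanned E Y" if "v \<notin> Y" for Y using that by (intro spanned_cong) auto
  have ins: "spanned E (insert v Y) = spanned E Y + int (card ({x, y, z} \<inter> Y))" if "v \<notin> Y" for Y
    using spanned_insert[OF graph_on that] v(2) by simp
  have cV: "card V = card ?A + 1" using v finV by (metis Suc_eq_plus1 card_Suc_Diff1)
  have "{x, y, z} \<inter> ?A = {x, y, z}" using xyz by auto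
  then have "spanned E V = spanned E ?A + 3" using ins[of ?A] v by (simp add: insert_absorb)
  then have "spanned E ?A = 2 * int (card ?A) - 2" using spanned_V cV by simp
  then have "int (card ?F) = 2 * int (card ?A) - 2" using spanned_whole[OF g order_refl] e by simp
  moreover have "spanned ?F Y \<le> 2 * int (card Y) - 2" if "Y \<subseteq> ?A" "Y \<noteq> {}" for Y
  proof -
    have "v \<notin> Y" "Y \<subseteq> V" "Y \<noteq> V" using that v by auto
    then show ?thesis using sparse that e by simp
  qed
  moreover have "spanned ?F Y \<le> 2 * int (card Y) - 3" if Y: "Y \<subseteq> ?A" "{x, y, z} \<subseteq> Y" "Y \<noteq> ?A" for Y
  proof -
    have vY: "v \<notin> Y" "insert v Y \<subseteq> V" "insert v Y \<noteq> V" using Y v by auto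
    have "{x, y, z} \<inter> Y = {x, y, z}" using Y by auto
    then have "spanned E (insert v Y) = spanned E Y + 3" using ins[OF vY(1)] v by simp
    moreover have "spanned E (insert v Y) \<le> 2 * int (card (insert v Y)) - 2" using sparse vY by blast
    moreover have "card (insert v Y) = card Y + 1" using vY finV finite_subset by auto
    ultimately show ?thesis using e[OF vY(1)] by simp
  qed
  ultimately show ?thesis using g xyz v by (simp add: node_side_def)
qed

text \<open>Converse of \<open>circuit_on_node_side\<close> for an arbitrary new \<open>v\<close>;
  it turns each side of a three-edge cut into a circuit with a fresh vertex.\<close>

lemma node_side_circuit_on:
  assumes N: "node_side A F x y z" and v: "v \<notin> A"
  shows "circuit_on (insert v A) (F \<union> {{v, x}, {v, y}, {v, z}})"
    and "nbrs (F \<union> {{v, x}, {v, y}, {v, z}}) v = {x, y, z}"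
proof -
  let ?E = "F \<union> {{v, x}, {v, y}, {v, z}}"
  have gF: "graph_on A F" and d: "x \<noteq> y" "x \<noteq> z" "y \<noteq> z" and xyz: "{x, y, z} \<subseteq> A"
    and c: "int (card F) = 2 * int (card A) - 2"
    and s: "\<And>Y. Y \<subseteq> A \<Longrightarrow> Y \<noteq> {} \<Longrightarrow> spanned F Y \<le> 2 * int (card Y) - 2"
    and s3: "\<And>Y. Y \<subseteq> A \<Longrightarrow> {x, y, z} \<subseteq> Y \<Longrightarrow> Y \<noteq> A \<Longrightarrow> spanned F Y \<le> 2 * int (card Y) - 3"
    using N by (auto simp: node_side_def)
  have fA: "finite A" using gF by (simp add: graph_on_def)
  have "v \<noteq> x" "v \<noteq> y" "v \<noteq> z" using xyz v by auto
  then have g: "graph_on (insert v A) ?E" using gF xyz unfolding graph_on_def by auto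
  show nb: "nbrs ?E v = {x, y, z}" by (rule nbrs_insert_star[OF gF v order_refl])
  have high: "spanned ?E (insert v Y) = spanned F Y + int (card ({x, y, z} \<inter> Y))" if "v \<notin> Y" for Y
    using spanned_insert[OF g that] spanned_star_irrelevant[OF that] nb by metis
  have int3: "card ({x, y, z} \<inter> Y) = 3" if "{x, y, z} \<subseteq> Y" for Y
  proof -
    have "{x, y, z} \<inter> Y = {x, y, z}" using that by auto
    then show ?thesis using d by simp
  qed
  show "circuit_on (insert v A) ?E"
  proof (rule circuit_on_intro[OF g])
    have "spanned ?E (insert v A) = 2 * int (card (insert v A)) - 1"
      using high[OF v] int3[OF xyz] spanned_whole[OF gF order_refl] c fA v by simp
    then show "int (card ?E) = 2 * int (card (insert v A)) - 1" using spanned_whole[OF g order_refl] by simp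
    fix X assume X: "X \<subseteq> insert v A" "X \<noteq> {}" "X \<noteq> insert v A"
    show "spanned ?E X \<le> 2 * int (card X) - 2"
    proof (cases "v \<in> X")
      case False
      then have "X \<subseteq> A" using X by auto
      then show ?thesis using spanned_star_irrelevant[OF False] s X by metis
    next
      case True
      define Y where "Y = X - {v}"
      have Y: "v \<notin> Y" "X = insert v Y" "Y \<subseteq> A" "Y \<noteq> A" using X True by (auto simp: Y_def)
      have fY: "finite Y" using Y fA finite_subset by blast
      have cX: "card X = card Y + 1" using Y fY by simp
      consider "Y = {}" | "Y \<noteq> {}" "{x, y, z} \<subseteq> Y" | "Y \<noteq> {}" "\<not> {x, y, z} \<subseteq> Y" by blast
      then show ?thesis
      proof cases
        case 1
        then show ?thesis using high[OF Y(1)] Y cX spanned_empty[OF gF] by simp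
      next
        case 2
        then show ?thesis using high[OF Y(1)] Y cX s3[OF Y(3) _ Y(4)] int3[of Y] by simp
      next
        case 3
        then have "{x, y, z} \<inter> Y \<subset> {x, y, z}" by blast
        then have "card ({x, y, z} \<inter> Y) < card {x, y, z}" by (intro psubset_card_mono) auto
        then have "card ({x, y, z} \<inter> Y) \<le> 2" using d by simp
        then show ?thesis using high[OF Y(1)] Y cX s[OF Y(3) 3(1)] by simp
      qed
    qed
  qed
qed

lemma no_edge_within:
  assumes "\<And>e. e \<in> M \<Longrightarrow> \<not> e \<subseteq> A \<and> \<not> e \<subseteq> B" "X \<subseteq> A \<or> X \<subseteq> B"
  shows "card {e \<in> M. e \<subseteq> X} = 0"
proof -
  have "{e \<in> M. e \<subseteq> X} = {}" using assms by blast
  then show ?thesis by (metis card.empty)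
qed

lemma card_edges_within_less:
  assumes "\<not> \<Union>M \<subseteq> X" "finite M"
  shows "card {e \<in> M. e \<subseteq> X} < card M"
proof -
  have "{e \<in> M. e \<subseteq> X} \<subset> M" using assms(1) by blast
  then show ?thesis using assms(2) by (intro psubset_card_mono)
qed

lemma spanned_three_edges:
  assumes "finite F"
  shows "spanned (F \<union> {e1, e2, e3}) X \<le> spanned F X + int (card {e \<in> {e1, e2, e3}. e \<subseteq> X})"
proof -
  have "{e \<in> F \<union> {e1, e2, e3}. e \<subseteq> X} = {e \<in> F. e \<subseteq> X} \<union> {e \<in> {e1, e2, e3}. e \<subseteq> X}" by blast
  then show ?thesis unfolding spanned_def
    using card_Un_le[of "{e \<in> F. e \<subseteq> X}" "{e \<in> {e1, e2, e3}. e \<subseteq> X}"] by simp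
qed

text \<open>For a set meeting both sides the two bounds add up to 2|X| - 4, which leaves room for
  two of the joining edges. If all three lie in \<open>X\<close>, both traces contain their triples
  and one of them is proper, so its sharper bound pays for the third.\<close>

theorem circuit_on_join3:
  assumes N1: "node_side A F a1 b1 c1" and N2: "node_side B G a2 b2 c2" and dis: "A \<inter> B = {}"
  shows "circuit_on (A \<union> B) (F \<union> G \<union> {{a1, a2}, {b1, b2}, {c1, c2}})"
proof -
  let ?M = "{{a1, a2}, {b1, b2}, {c1, c2}}"
  let ?E = "F \<union> G \<union> ?M"
  have gF: "graph_on A F" and d1: "a1 \<noteq> b1" "a1 \<noteq> c1" "b1 \<noteq> c1" and m1: "{a1, b1, c1} \<subseteq> A"
    and cF: "int (card F) = 2 * int (card A) - 2"
    and s1: "\<And>Y. Y \<subseteq> A \<Longrightarrow> Y \<noteq> {} \<Longrightarrow> spanned F Y \<le> 2 * int (card Y) - 2"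
    and t1: "\<And>Y. Y \<subseteq> A \<Longrightarrow> {a1, b1, c1} \<subseteq> Y \<Longrightarrow> Y \<noteq> A \<Longrightarrow> spanned F Y \<le> 2 * int (card Y) - 3"
    using N1 by (auto simp: node_side_def)
  have gG: "graph_on B G" and d2: "a2 \<noteq> b2" "a2 \<noteq> c2" "b2 \<noteq> c2" and m2: "{a2, b2, c2} \<subseteq> B"
    and cG: "int (card G) = 2 * int (card B) - 2"
    and s2: "\<And>Y. Y \<subseteq> B \<Longrightarrow> Y \<noteq> {} \<Longrightarrow> spanned G Y \<le> 2 * int (card Y) - 2"
    and t2: "\<And>Y. Y \<subseteq> B \<Longrightarrow> {a2, b2, c2} \<subseteq> Y \<Longrightarrow> Y \<noteq> B \<Longrightarrow> spanned G Y \<le> 2 * int (card Y) - 3"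
    using N2 by (auto simp: node_side_def)
  have fin: "finite A" "finite B" "finite F" "finite G"
    using node_side_finite[OF N1] node_side_finite[OF N2] by auto
  have ab: "a1 \<noteq> a2" "b1 \<noteq> b2" "c1 \<noteq> c2" "a1 \<noteq> b2" "a1 \<noteq> c2" "b1 \<noteq> a2" "b1 \<noteq> c2" "c1 \<noteq> a2" "c1 \<noteq> b2"
    using m1 m2 dis by auto
  have FG: "F \<inter> G = {}"
  proof (rule ccontr)
    assume "F \<inter> G \<noteq> {}"
    then obtain e where "e \<in> F" "e \<in> G" by blast
    then have "e \<subseteq> A \<inter> B" "card e = 2" using gF gG by (auto simp: graph_on_def)
    then show False using dis by auto
  qed
  have mA: "\<And>e. e \<in> ?M \<Longrightarrow> \<not> e \<subseteq> A \<and> \<not> e \<subseteq> B" using m1 m2 dis by auto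
  have FGM: "(F \<union> G) \<inter> ?M = {}"
  proof -
    have "e \<subseteq> A \<or> e \<subseteq> B" if "e \<in> F \<union> G" for e using that gF gG by (auto simp: graph_on_def)
    then show ?thesis using mA by blast
  qed
  have cM: "card ?M = 3" using d1 d2 ab by (simp add: card_insert_if doubleton_eq_iff)
  have g: "graph_on (A \<union> B) ?E"
    using gF gG m1 m2 ab fin unfolding graph_on_def by auto
  have e12: "spanned (F \<union> G) X = spanned F (X \<inter> A) + spanned G (X \<inter> B)" for X
    using spanned_Un[OF fin(3,4) FG] spanned_Int[OF gF] spanned_Int[OF gG] by metis
  show ?thesis
  proof (rule circuit_on_intro[OF g])
    have "card ?E = card F + card G + 3"
      using card_Un_disjoint[of "F \<union> G" ?M] card_Un_disjoint[of F G] FG FGM cM fin by simp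
    moreover have "card (A \<union> B) = card A + card B" using card_Un_disjoint dis fin by blast
    ultimately show "int (card ?E) = 2 * int (card (A \<union> B)) - 1" using cF cG by simp
    fix X assume X: "X \<subseteq> A \<union> B" "X \<noteq> {}" "X \<noteq> A \<union> B"
    let ?Y = "X \<inter> A" and ?Z = "X \<inter> B"
    have XYZ: "X = ?Y \<union> ?Z" using X by blast
    have cX: "card X = card ?Y + card ?Z"
      by (subst XYZ, rule card_Un_disjoint) (use fin dis in auto)
    let ?k = "card {e \<in> ?M. e \<subseteq> X}"
    have le: "spanned ?E X \<le> spanned F ?Y + spanned G ?Z + int ?k"
      using spanned_three_edges[OF finite_UnI[OF fin(3,4)], of "{a1, a2}" "{b1, b2}" "{c1, c2}" X] unfolding e12 .
    have k3: "?k \<le> 3"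
    proof -
      have "?k \<le> card ?M" by (intro card_mono) auto
      then show ?thesis using cM by simp
    qed
    consider (Y0) "?Y = {}" | (Z0) "?Z = {}" | (ne) "?Y \<noteq> {}" "?Z \<noteq> {}" by blast
    then show "spanned ?E X \<le> 2 * int (card X) - 2"
    proof cases
      case Y0
      then have "X \<subseteq> B" "?Z \<noteq> {}" using X(1,2) by blast+
      then have "?k = 0" using no_edge_within[OF mA] by blast
      moreover have "spanned F ?Y = 0" "card ?Y = 0" using Y0 spanned_empty[OF gF] by simp_all
      moreover have "spanned G ?Z \<le> 2 * int (card ?Z) - 2" using s2 \<open>?Z \<noteq> {}\<close> by blast
      ultimately show ?thesis using le cX by linarith
    next
      case Z0
      then have "X \<subseteq> A" "?Y \<noteq> {}" using X(1,2) by blast+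
      then have "?k = 0" using no_edge_within[OF mA] by blast
      moreover have "spanned G ?Z = 0" "card ?Z = 0" using Z0 spanned_empty[OF gG] by simp_all
      moreover have "spanned F ?Y \<le> 2 * int (card ?Y) - 2" using s1 \<open>?Y \<noteq> {}\<close> by blast
      ultimately show ?thesis using le cX by linarith
    next
      case ne
      have sY: "spanned F ?Y \<le> 2 * int (card ?Y) - 2" using s1 ne by simp
      have sZ: "spanned G ?Z \<le> 2 * int (card ?Z) - 2" using s2 ne by simp
      show ?thesis
      proof (cases "\<Union>?M \<subseteq> X")
        case True
        then have "{a1, b1, c1} \<subseteq> ?Y" "{a2, b2, c2} \<subseteq> ?Z" using m1 m2 by auto
        moreover have "?Y \<noteq> A \<or> ?Z \<noteq> B" using X XYZ by blast
        ultimately have "spanned F ?Y \<le> 2 * int (card ?Y) - 3 \<or> spanned G ?Z \<le> 2 * int (card ?Z) - 3"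
          using t1[of ?Y] t2[of ?Z] by blast
        then show ?thesis using le sY sZ k3 cX by linarith
      next
        case False
        then have "?k < card ?M" by (rule card_edges_within_less) simp
        then show ?thesis using le sY sZ cX cM by linarith
      qed
    qed
  qed
qed

text \<open>For a proper subset \<open>Y\<close> of \<open>A\<close> containing the three ends, all
  cut edges run between \<open>Y\<close> and \<open>V - A\<close>. Sparsity of \<open>Y\<close>
  together with the tight set \<open>V - A\<close> then leaves at most 2|Y| - 3 edges for
  \<open>Y\<close>.\<close>

lemma (in circuit_graph) cut_node_side:
  assumes A: "tight A" "tight (V - A)"
    and cr: "cross E A (V - A) = {{a1, a2}, {b1, b2}, {c1, c2}}"
    and m: "{a1, b1, c1} \<subseteq> A" "{a2, b2, c2} \<subseteq> V - A"
    and d: "card {a1, b1, c1} = 3" "card {a2, b2, c2} = 3"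
  shows "node_side A {e \<in> E. e \<subseteq> A} a1 b1 c1"
proof -
  let ?F = "{e \<in> E. e \<subseteq> A}" and ?B = "V - A"
  have AV: "A \<subseteq> V" "A \<noteq> V" "spanned E A = 2 * int (card A) - 2" using A by (auto simp: tight_def)
  have fA: "finite A" using A tight_finite by blast
  have g: "graph_on A ?F" using graph_on fA by (auto simp: graph_on_def)
  have "spanned ?F Y \<le> 2 * int (card Y) - 2" if "Y \<subseteq> A" "Y \<noteq> {}" for Y
    using spanned_restrict[OF that(1)] sparse[of Y] that AV by fastforce
  moreover have "spanned ?F Y \<le> 2 * int (card Y) - 3" if Y: "Y \<subseteq> A" "{a1, b1, c1} \<subseteq> Y" "Y \<noteq> A" for Y
  proof -
    have int: "Y \<inter> ?B = {}" "Y - ?B = Y" "?B - Y = ?B" using Y by auto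
    have "cross E A ?B \<subseteq> cross E Y ?B"
    proof
      fix e assume e: "e \<in> cross E A ?B"
      then have "e \<in> {{a1, a2}, {b1, b2}, {c1, c2}}" using cr by simp
      then have "e \<inter> Y \<noteq> {}" using Y(2) by blast
      then show "e \<in> cross E Y ?B" using e by (simp add: cross_def)
    qed
    then have "3 \<le> card (cross E Y ?B)"
      using cut_ge_3(1)[of A] AV A finE card_mono[of "cross E Y ?B" "cross E A ?B"]
      by (auto simp: tight_def cross_def)
    then have "spanned E (Y \<union> ?B) \<ge> spanned E Y + spanned E ?B + 3"
      using spanned_Un_Int[OF graph_on, of Y ?B] int spanned_empty[OF graph_on] by simp
    moreover have "spanned E (Y \<union> ?B) \<le> 2 * int (card (Y \<union> ?B)) - 2"
      by (rule sparse) (use Y AV in auto)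
    moreover have "card (Y \<union> ?B) = card Y + card ?B"
      by (rule card_Un_disjoint) (use int(1) finV finite_subset[OF Y(1) fA] in auto)
    moreover have "spanned E ?B = 2 * int (card ?B) - 2" using A(2) by (simp add: tight_def)
    ultimately show ?thesis using spanned_restrict[OF Y(1)] by simp
  qed
  moreover have "int (card ?F) = 2 * int (card A) - 2" using AV(3) by (simp add: spanned_def)
  moreover have "a1 \<noteq> b1" "a1 \<noteq> c1" "b1 \<noteq> c1" using d(1) by (auto simp: card_insert_if split: if_splits)
  ultimately show ?thesis using g m(1) unfolding node_side_def by blast
qed

text \<open>A local form of \<open>K4_end\<close>, equivalent to it in a circuit: listing all
  neighbours of \<open>c\<close> and \<open>d\<close> already says that they form a component once
  \<open>a\<close> and \<open>b\<close> are removed.\<close>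

definition K4_end_edges :: "'v set set \<Rightarrow> 'v \<Rightarrow> 'v \<Rightarrow> 'v \<Rightarrow> 'v \<Rightarrow> bool" where
  "K4_end_edges E a b c d \<longleftrightarrow> card {a, b, c, d} = 4 \<and> {a, b} \<in> E \<and> nbrs E c = {a, b, d} \<and> nbrs E d = {a, b, c}"

text \<open>What is left of a circuit with a \<open>K\<^sub>4\<close> end \<open>{a, b, c, d}\<close> when \<open>c, d\<close> are deleted.\<close>

definition tight_side :: "'v set \<Rightarrow> 'v set set \<Rightarrow> 'v \<Rightarrow> 'v \<Rightarrow> bool" where
  "tight_side R F a b \<longleftrightarrow> graph_on R F \<and> a \<noteq> b \<and> {a, b} \<in> F \<and>
     int (card F) = 2 * int (card R) - 2 \<and>
     (\<forall>Y\<subseteq>R. Y \<noteq> {} \<longrightarrow> spanned F Y \<le> 2 * int (card Y) - 2) \<and>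
     (\<forall>Y\<subseteq>R. {a, b} \<subseteq> Y \<and> Y \<noteq> R \<longrightarrow> spanned F Y \<le> 2 * int (card Y) - 3)"

lemma card_4_distinct:
  "card {a, b, c, d} = 4 \<longleftrightarrow> a \<noteq> b \<and> a \<noteq> c \<and> a \<noteq> d \<and> b \<noteq> c \<and> b \<noteq> d \<and> c \<noteq> d"
  by (auto simp: card_insert_if)

lemma K4_end_edges_spanned:
  assumes g: "graph_on V E" and K: "K4_end_edges E a b c d" and Y: "c \<notin> Y" "d \<notin> Y"
  shows "spanned E (insert c Y) = spanned E Y + int (card ({a, b} \<inter> Y))"
    and "spanned E (insert d Y) = spanned E Y + int (card ({a, b} \<inter> Y))"
    and "spanned E (insert d (insert c Y)) = spanned E Y + 2 * int (card ({a, b} \<inter> Y)) + 1"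
proof -
  have n: "nbrs E c = {a, b, d}" "nbrs E d = {a, b, c}" and dist: "a \<noteq> c" "b \<noteq> c" "c \<noteq> d"
    using K by (auto simp: K4_end_edges_def card_4_distinct)
  have "{a, b, d} \<inter> Y = {a, b} \<inter> Y" "{a, b, c} \<inter> Y = {a, b} \<inter> Y" using Y by auto
  then show 1: "spanned E (insert c Y) = spanned E Y + int (card ({a, b} \<inter> Y))"
    and "spanned E (insert d Y) = spanned E Y + int (card ({a, b} \<inter> Y))"
    using spanned_insert[OF g Y(1)] spanned_insert[OF g Y(2)] n by simp_all
  have "{a, b, c} \<inter> insert c Y = insert c ({a, b} \<inter> Y)" by auto
  moreover have "card (insert c ({a, b} \<inter> Y)) = card ({a, b} \<inter> Y) + 1" using Y by simp
  moreover have "d \<notin> insert c Y" using Y dist by auto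
  ultimately show "spanned E (insert d (insert c Y)) = spanned E Y + 2 * int (card ({a, b} \<inter> Y)) + 1"
    using spanned_insert[OF g, of d "insert c Y"] n 1 by simp
qed

text \<open>Restoring \<open>c\<close> and \<open>d\<close> to a set containing \<open>a, b\<close>
  adds five edges while the bound grows by 4; hence the loss of one in the bound for such proper
  sets.\<close>

lemma circuit_on_K4_end_side:
  assumes C: "circuit_on V E" and K: "K4_end_edges E a b c d"
  shows "tight_side (V - {c, d}) {e \<in> E. e \<subseteq> V - {c, d}} a b"
proof -
  interpret circuit_graph V E using C by unfold_locales
  let ?R = "V - {c, d}"
  let ?F = "{e \<in> E. e \<subseteq> ?R}"
  have dist: "a \<noteq> b" "a \<noteq> c" "a \<noteq> d" "b \<noteq> c" "b \<noteq> d" "c \<noteq> d" and ab: "{a, b} \<in> E"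
    and n: "nbrs E c = {a, b, d}" "nbrs E d = {a, b, c}"
    using K by (auto simp: K4_end_edges_def card_4_distinct)
  have m: "a \<in> V" "b \<in> V" "c \<in> V" "d \<in> V" using n nbrs_V[of c] nbrs_V[of d] by auto
  have g: "graph_on ?R ?F" using graph_on by (auto simp: graph_on_def)
  have k2: "card ({a, b} \<inter> Y) = 2" if "{a, b} \<subseteq> Y" for Y
  proof -
    have "{a, b} \<inter> Y = {a, b}" using that by auto
    then show ?thesis using dist by simp
  qed
  have full: "spanned E (insert d (insert c Y)) = spanned E Y + 5" if "{a, b} \<subseteq> Y" "Y \<subseteq> ?R" for Y
  proof -
    have "c \<notin> Y" "d \<notin> Y" using that(2) by blast+
    then show ?thesis using K4_end_edges_spanned(3)[OF graph_on K] k2[OF that(1)] by simp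
  qed
  have cd: "card (insert d (insert c Y)) = card Y + 2" if "Y \<subseteq> ?R" for Y
  proof -
    have "finite Y" using that finV finite_subset by (metis finite_Diff)
    moreover have "c \<notin> Y" "d \<notin> insert c Y" using that dist by auto
    ultimately show ?thesis by simp
  qed
  have Veq: "insert d (insert c ?R) = V" using m by auto
  have "{a, b} \<subseteq> ?R" using dist m by simp
  from full[OF this order_refl] cd[OF order_refl]
  have "spanned E V = spanned E ?R + 5" "card V = card ?R + 2" unfolding Veq .
  then have "spanned E ?R = 2 * int (card ?R) - 2" using spanned_V by linarith
  then have "int (card ?F) = 2 * int (card ?R) - 2" by (simp add: spanned_def)
  moreover have "spanned ?F Y \<le> 2 * int (card Y) - 2" if "Y \<subseteq> ?R" "Y \<noteq> {}" for Y
  proof -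
    have "Y \<subseteq> V" "Y \<noteq> V" using that m by auto
    then show ?thesis using spanned_restrict[OF that(1)] sparse that by simp
  qed
  moreover have "spanned ?F Y \<le> 2 * int (card Y) - 3" if Y: "Y \<subseteq> ?R" "{a, b} \<subseteq> Y" "Y \<noteq> ?R" for Y
  proof -
    have "insert d (insert c Y) \<subseteq> V" "insert d (insert c Y) \<noteq> V" using Y m by auto
    then have "spanned E (insert d (insert c Y)) \<le> 2 * int (card (insert d (insert c Y))) - 2"
      using sparse by blast
    then show ?thesis using full[OF Y(2,1)] cd[OF Y(1)] spanned_restrict[OF Y(1)] by simp
  qed
  moreover have "{a, b} \<in> ?F" using ab m dist by auto
  ultimately show ?thesis using g dist unfolding tight_side_def by blast
qed

lemma tight_sideD:
  assumes "tight_side R F a b"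
  shows "graph_on R F" "finite R" "finite F" "a \<noteq> b" "{a, b} \<in> F" "a \<in> R" "b \<in> R"
    "int (card F) = 2 * int (card R) - 2" "spanned F R = 2 * int (card R) - 2"
    "\<And>Y. Y \<subseteq> R \<Longrightarrow> Y \<noteq> {} \<Longrightarrow> spanned F Y \<le> 2 * int (card Y) - 2"
    "\<And>Y. Y \<subseteq> R \<Longrightarrow> {a, b} \<subseteq> Y \<Longrightarrow> Y \<noteq> R \<Longrightarrow> spanned F Y \<le> 2 * int (card Y) - 3"
proof -
  show g: "graph_on R F" and "a \<noteq> b" and ab: "{a, b} \<in> F" and c: "int (card F) = 2 * int (card R) - 2"
    and "\<And>Y. Y \<subseteq> R \<Longrightarrow> Y \<noteq> {} \<Longrightarrow> spanned F Y \<le> 2 * int (card Y) - 2"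
    and "\<And>Y. Y \<subseteq> R \<Longrightarrow> {a, b} \<subseteq> Y \<Longrightarrow> Y \<noteq> R \<Longrightarrow> spanned F Y \<le> 2 * int (card Y) - 3"
    using assms by (auto simp: tight_side_def)
  show "finite R" "finite F" using g graph_on_finite_edges by (auto simp: graph_on_def)
  show "a \<in> R" "b \<in> R" using g ab by (auto simp: graph_on_def)
  show "spanned F R = 2 * int (card R) - 2" using spanned_whole[OF g order_refl] c by simp
qed

text \<open>The edges of the K_4 other than \<open>ab\<close>, which already belongs to the side
  being extended.\<close>

abbreviation K4_star :: "'v \<Rightarrow> 'v \<Rightarrow> 'v \<Rightarrow> 'v \<Rightarrow> 'v set set" where
  "K4_star a b c d \<equiv> {{c, d}, {c, a}, {c, b}, {d, a}, {d, b}}"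

text \<open>Attaching \<open>c\<close> and \<open>d\<close> to \<open>Y\<close> adds 2k + 1 edges,
  where k of \<open>a, b\<close> lie in \<open>Y\<close>, and raises the bound by 4. Only k = 2
  exceeds this, by one, and then the sharper bound of \<open>tight_side\<close> for proper sets
  makes up for it.\<close>

lemma tight_side_extend:
  assumes S: "tight_side R F a b" and cd: "c \<notin> R" "d \<notin> R" "c \<noteq> d"
  shows "circuit_on (insert d (insert c R)) (F \<union> K4_star a b c d)"
    and "K4_end_edges (F \<union> K4_star a b c d) a b c d"
proof -
  let ?E = "F \<union> K4_star a b c d" and ?V = "insert d (insert c R)"
  note S' = tight_sideD[OF S]
  have dist: "a \<noteq> c" "a \<noteq> d" "b \<noteq> c" "b \<noteq> d" using S' cd by auto
  have nF: "{c, t} \<notin> F" "{d, t} \<notin> F" for t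
    using S'(1) cd unfolding graph_on_def by blast+
  have "nbrs ?E c = {a, b, d}" "nbrs ?E d = {a, b, c}"
    using nF dist cd(3) by (auto simp: nbrs_def doubleton_eq_iff)
  then show K: "K4_end_edges ?E a b c d"
    using S'(4,5) dist cd(3) by (auto simp: K4_end_edges_def card_4_distinct)
  have g: "graph_on ?V ?E" using S'(1,6,7) dist cd(3) unfolding graph_on_def by auto
  have low: "spanned ?E Y = spanned F Y" if "c \<notin> Y" "d \<notin> Y" for Y
    using that by (intro spanned_cong) auto
  show "circuit_on ?V ?E"
  proof (rule circuit_on_intro[OF g])
    have "{a, b} \<inter> R = {a, b}" using S' by auto
    then have "spanned ?E ?V = spanned F R + 5" using K4_end_edges_spanned(3)[OF g K cd(1,2)] low[OF cd(1,2)] S'(4) by simp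
    then show "int (card ?E) = 2 * int (card ?V) - 1"
      using spanned_whole[OF g order_refl] S'(2,9) cd by simp
    fix X assume X: "X \<subseteq> ?V" "X \<noteq> {}" "X \<noteq> ?V"
    define Y where "Y = X - {c, d}"
    have Y: "c \<notin> Y" "d \<notin> Y" "Y \<subseteq> R" using X cd by (auto simp: Y_def)
    have fY: "finite Y" using Y S'(2) finite_subset by blast
    have k: "card ({a, b} \<inter> Y) \<le> 2"
    proof -
      have "card ({a, b} \<inter> Y) \<le> card {a, b}" by (intro card_mono) auto
      then show ?thesis using S'(4) by simp
    qed
    have k0: "Y = {} \<Longrightarrow> card ({a, b} \<inter> Y) = 0 \<and> spanned F Y = 0 \<and> card Y = 0" using spanned_empty[OF S'(1)] by simp
    have k1: "card ({a, b} \<inter> Y) \<le> 1" if "\<not> {a, b} \<subseteq> Y"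
    proof -
      have "{a, b} \<inter> Y \<subset> {a, b}" using that by blast
      then have "card ({a, b} \<inter> Y) < card {a, b}" by (intro psubset_card_mono) auto
      then show ?thesis using S'(4) by simp
    qed
    note e = K4_end_edges_spanned[OF g K Y(1,2)] low[OF Y(1,2)]
    note sp = S'(10)[OF Y(3)]
    consider "c \<in> X" "d \<in> X" | "c \<in> X" "d \<notin> X" | "c \<notin> X" "d \<in> X" | "c \<notin> X" "d \<notin> X" by blast
    then show "spanned ?E X \<le> 2 * int (card X) - 2"
    proof cases
      case 1
      then have Xe: "X = insert d (insert c Y)" by (auto simp: Y_def)
      then have "Y \<noteq> R" using X by auto
      then have "spanned F Y \<le> 2 * int (card Y) - 3" if "{a, b} \<subseteq> Y" using S'(11)[OF Y(3) that] by blast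
      moreover have "card X = card Y + 2" using Xe fY Y cd(3) by simp
      ultimately show ?thesis unfolding Xe using e k k0 k1 sp Xe by (cases "Y = {}"; cases "{a, b} \<subseteq> Y") auto
    next
      case 2
      then have Xe: "X = insert c Y" by (auto simp: Y_def)
      moreover have "card X = card Y + 1" using Xe fY Y by simp
      ultimately show ?thesis using e k k0 sp by (cases "Y = {}") auto
    next
      case 3
      then have Xe: "X = insert d Y" by (auto simp: Y_def)
      moreover have "card X = card Y + 1" using Xe fY Y by simp
      ultimately show ?thesis using e k k0 sp by (cases "Y = {}") auto
    next
      case 4
      then have "X = Y" by (auto simp: Y_def)
      then show ?thesis using e sp X by simp
    qed
  qed
qed

lemma card_glue:
  assumes "finite P" "finite R" "P \<inter> R = {a, b}" "a \<noteq> b" "X \<subseteq> P \<union> R"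
  shows "int (card (X \<inter> P)) + int (card (X \<inter> R)) = int (card X) + int (card (X \<inter> {a, b}))"
proof -
  have "(X \<inter> P) \<union> (X \<inter> R) = X" "(X \<inter> P) \<inter> (X \<inter> R) = X \<inter> {a, b}" using assms by blast+
  then show ?thesis using card_Un_Int[of "X \<inter> P" "X \<inter> R"] assms(1,2) by (metis finite_Int of_nat_add)
qed

lemma glued_edges_Int:
  assumes "graph_on P F" "graph_on R G" "P \<inter> R = {a, b}" "e \<in> F" "e \<in> G"
  shows "e = {a, b}"
proof -
  have "e \<subseteq> P \<inter> R" "card e = 2" using assms unfolding graph_on_def by blast+
  moreover have "card {a, b} \<le> 2" by (simp add: card_insert_if)
  ultimately show ?thesis using assms(3) by (intro card_seteq) simp_all
qed

text \<open>The common core of 1-joins and 2-joins. Two shared vertices and the dropped copy of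
  \<open>ab\<close> give 2|P| - 2 + 2|R| - 2 - 1 = 2|P \<union> R| - 1 edges. The same sum bounds a
  set containing \<open>a, b\<close> by 2|X| - 1, and one trace is proper, which saves the last
  edge. With at most one of \<open>a, b\<close> present, the two ordinary bounds suffice.\<close>

lemma circuit_on_glue:
  assumes gF: "graph_on P F" and cF: "int (card F) = 2 * int (card P) - 2"
    and sF: "\<And>Y. Y \<subseteq> P \<Longrightarrow> Y \<noteq> {} \<Longrightarrow> spanned F Y \<le> 2 * int (card Y) - 2"
    and tF: "\<And>Y. Y \<subseteq> P \<Longrightarrow> {a, b} \<subseteq> Y \<Longrightarrow> Y \<noteq> P \<Longrightarrow> spanned F Y \<le> 2 * int (card Y) - 3"
    and S: "tight_side R G a b" and PR: "P \<inter> R = {a, b}"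
  shows "circuit_on (P \<union> R) (F \<union> (G - {{a, b}}))"
proof -
  let ?G = "G - {{a, b}}"
  note S' = tight_sideD[OF S]
  have fin: "finite P" "finite F" using gF graph_on_finite_edges by (auto simp: graph_on_def)
  have dis: "F \<inter> ?G = {}" using glued_edges_Int[OF gF S'(1) PR] by blast
  have g: "graph_on (P \<union> R) (F \<union> ?G)" using gF S'(1) unfolding graph_on_def by blast
  have e: "spanned (F \<union> ?G) X = spanned F (X \<inter> P) + spanned G (X \<inter> R) - (if {a, b} \<subseteq> X then 1 else 0)" for X
    using spanned_Un[OF _ _ dis, of X] spanned_remove_edge[OF S'(3,5), of X]
      spanned_Int[OF gF, of X] spanned_Int[OF S'(1), of X] fin S'(3) by simp
  note cg = card_glue[OF fin(1) S'(2) PR S'(4)]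
  have two: "int (card (X \<inter> {a, b})) = 2" if "{a, b} \<subseteq> X" for X
  proof -
    have "X \<inter> {a, b} = {a, b}" using that by blast
    then show ?thesis using S'(4) by simp
  qed
  have one: "int (card (X \<inter> {a, b})) \<le> 1" if "\<not> {a, b} \<subseteq> X" for X
  proof -
    have "X \<inter> {a, b} \<subset> {a, b}" using that by blast
    then have "card (X \<inter> {a, b}) < card {a, b}" by (intro psubset_card_mono) auto
    then show ?thesis using S'(4) by simp
  qed
  have abPR: "{a, b} \<subseteq> P" "{a, b} \<subseteq> R" using PR by auto
  show ?thesis
  proof (rule circuit_on_intro[OF g])
    have I: "(P \<union> R) \<inter> P = P" "(P \<union> R) \<inter> R = R" by auto
    have "spanned (F \<union> ?G) (P \<union> R) = spanned F P + spanned G R - 1" using e[of "P \<union> R"] abPR I by auto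
    then have "spanned (F \<union> ?G) (P \<union> R) = 2 * int (card (P \<union> R)) - 1"
      using cg[of "P \<union> R"] two[of "P \<union> R"] abPR I spanned_whole[OF gF order_refl] cF S'(9) by auto
    then show "int (card (F \<union> ?G)) = 2 * int (card (P \<union> R)) - 1" using spanned_whole[OF g order_refl] by simp
    fix X assume X: "X \<subseteq> P \<union> R" "X \<noteq> {}" "X \<noteq> P \<union> R"
    let ?Y = "X \<inter> P" and ?Z = "X \<inter> R"
    note cX = cg[OF X(1)] e[of X]
    have sY: "?Y \<noteq> {} \<Longrightarrow> spanned F ?Y \<le> 2 * int (card ?Y) - 2" using sF by blast
    have sZ: "?Z \<noteq> {} \<Longrightarrow> spanned G ?Z \<le> 2 * int (card ?Z) - 2" using S'(10) by blast
    show "spanned (F \<union> ?G) X \<le> 2 * int (card X) - 2"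
    proof (cases "{a, b} \<subseteq> X")
      case True
      then have ne: "?Y \<noteq> {}" "?Z \<noteq> {}" "{a, b} \<subseteq> ?Y" "{a, b} \<subseteq> ?Z" using abPR by auto
      have "?Y \<noteq> P \<or> ?Z \<noteq> R" using X by blast
      then have "spanned F ?Y \<le> 2 * int (card ?Y) - 3 \<or> spanned G ?Z \<le> 2 * int (card ?Z) - 3"
        using tF[OF _ ne(3)] S'(11)[OF _ ne(4)] by blast
      then show ?thesis using cX two[OF True] True sY[OF ne(1)] sZ[OF ne(2)] by auto
    next
      case False
      have zY: "?Y = {} \<Longrightarrow> spanned F ?Y = 0 \<and> card ?Y = 0 \<and> card (X \<inter> {a, b}) = 0"
        using spanned_empty[OF gF] abPR by (metis Int_assoc Int_commute card.empty inf.absorb_iff2 inf_bot_left)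
      have zZ: "?Z = {} \<Longrightarrow> spanned G ?Z = 0 \<and> card ?Z = 0 \<and> card (X \<inter> {a, b}) = 0"
        using spanned_empty[OF S'(1)] abPR by (metis Int_assoc Int_commute card.empty inf.absorb_iff2 inf_bot_left)
      have "?Y \<noteq> {} \<or> ?Z \<noteq> {}" using X by blast
      then show ?thesis using cX one[OF False] False sY sZ zY zZ
        by (cases "?Y = {}"; cases "?Z = {}") auto
    qed
  qed
qed

text \<open>Without \<open>ab\<close> the edges of the circuit on \<open>P\<close> number exactly
  2|P| - 2, and every proper set containing both ends loses one edge: just what
  \<open>circuit_on_glue\<close> asks of \<open>F\<close>.\<close>

theorem circuit_on_join1:
  assumes C: "circuit_on P E" and ab: "{a, b} \<in> E" and S: "tight_side R G a b" and PR: "P \<inter> R = {a, b}"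
  shows "circuit_on (P \<union> R) ((E - {{a, b}}) \<union> (G - {{a, b}}))"
proof (rule circuit_on_glue[OF _ _ _ _ S PR])
  interpret circuit_graph P E using C by unfold_locales
  note e = spanned_remove_edge[OF finE ab]
  have abP: "{a, b} \<subseteq> P" using PR by blast
  show g: "graph_on P (E - {{a, b}})" using graph_on by (auto simp: graph_on_def)
  show "int (card (E - {{a, b}})) = 2 * int (card P) - 2"
    using spanned_whole[OF g order_refl] e[of P] abP spanned_V by simp
  show "spanned (E - {{a, b}}) Y \<le> 2 * int (card Y) - 3" if Y: "Y \<subseteq> P" "{a, b} \<subseteq> Y" "Y \<noteq> P" for Y
  proof -
    have "spanned E Y \<le> 2 * int (card Y) - 2" using sparse[OF Y(1) _ Y(3)] Y(2) by blast
    then show ?thesis using e[of Y] Y(2) by simp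
  qed
  show "spanned (E - {{a, b}}) Y \<le> 2 * int (card Y) - 2" if Y: "Y \<subseteq> P" "Y \<noteq> {}" for Y
  proof (cases "Y = P")
    case True
    then show ?thesis using e[of P] abP spanned_V by simp
  next
    case False
    then show ?thesis using e[of Y] sparse[OF Y False] by auto
  qed
qed

theorem circuit_on_join2:
  assumes S1: "tight_side P F a b" and S2: "tight_side R G a b" and PR: "P \<inter> R = {a, b}"
  shows "circuit_on (P \<union> R) (F \<union> G)"
proof -
  note S = tight_sideD[OF S1]
  \<comment> \<open>\<open>F\<close> already contains \<open>ab\<close>, so dropping the second copy
    changes nothing.\<close>
  have "F \<union> G = F \<union> (G - {{a, b}})" using S(5) by auto
  then show ?thesis using circuit_on_glue[OF S(1,8,10,11) S2 PR] by simp
qed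

section \<open>Renaming, two-vertex cuts and base graphs\<close>

lemma graph_on_rename:
  assumes "graph_on V E" "inj_on f V"
  shows "graph_on (f ` V) ((`) f ` E)"
  using assms unfolding graph_on_def
  by (auto simp: card_image inj_on_subset)

lemma inj_on_image_subset_iff:
  assumes "inj_on f V" "X \<subseteq> V" "Y \<subseteq> V"
  shows "f ` X \<subseteq> f ` Y \<longleftrightarrow> X \<subseteq> Y"
  using assms by (auto simp: inj_on_def) blast

lemma spanned_rename:
  assumes g: "graph_on V E" and f: "inj_on f V" and X: "X \<subseteq> V"
  shows "spanned ((`) f ` E) (f ` X) = spanned E X"
proof -
  have EV: "e \<subseteq> V" if "e \<in> E" for e using that g by (simp add: graph_on_def)
  have "{e' \<in> (`) f ` E. e' \<subseteq> f ` X} = (`) f ` {e \<in> E. e \<subseteq> X}"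
    using inj_on_image_subset_iff[OF f EV X] by blast
  moreover have "inj_on ((`) f) {e \<in> E. e \<subseteq> X}"
    using inj_on_image_Pow[OF f] by (rule inj_on_subset) (use X in auto)
  ultimately show ?thesis by (simp add: spanned_def card_image)
qed

lemma card_edges_rename:
  assumes "graph_on V E" "inj_on f V"
  shows "card ((`) f ` E) = card E"
proof (rule card_image)
  show "inj_on ((`) f) E"
    using inj_on_image_Pow[OF assms(2)] by (rule inj_on_subset) (use assms(1) in \<open>auto simp: graph_on_def\<close>)
qed

lemma circuit_on_rename:
  assumes C: "circuit_on V E" and f: "inj_on f V"
  shows "circuit_on (f ` V) ((`) f ` E)"
proof -
  interpret circuit_graph V E using C by unfold_locales
  show ?thesis
  proof (rule circuit_on_intro[OF graph_on_rename[OF graph_on f]])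
    show "int (card ((`) f ` E)) = 2 * int (card (f ` V)) - 1"
      using card_edges_rename[OF graph_on f] card_image[OF f] cardE by simp
    fix X assume X: "X \<subseteq> f ` V" "X \<noteq> {}" "X \<noteq> f ` V"
    obtain Y where Y: "Y \<subseteq> V" "X = f ` Y" using X(1) by (rule subset_imageE)
    have "Y \<noteq> {}" "Y \<noteq> V" using X Y by auto
    then show "spanned ((`) f ` E) X \<le> 2 * int (card X) - 2"
      using sparse[OF Y(1)] spanned_rename[OF graph_on f Y(1)] card_image[OF inj_on_subset[OF f Y(1)]] Y(2) by simp
  qed
qed

lemma tight_side_rename:
  assumes S: "tight_side R F a b" and f: "inj_on f R"
  shows "tight_side (f ` R) ((`) f ` F) (f a) (f b)"
proof -
  note S' = tight_sideD[OF S]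
  have ab: "f a \<noteq> f b" using S'(4,6,7) f by (auto dest: inj_onD)
  have abE: "{f a, f b} \<in> (`) f ` F"
    by (rule image_eqI[of _ _ "{a, b}"]) (use S'(5) in auto)
  have c: "int (card ((`) f ` F)) = 2 * int (card (f ` R)) - 2"
    using card_edges_rename[OF S'(1) f] card_image[OF f] S'(8) by simp
  have s: "spanned ((`) f ` F) X \<le> 2 * int (card X) - 2" if X: "X \<subseteq> f ` R" "X \<noteq> {}" for X
  proof -
    obtain Y where Y: "Y \<subseteq> R" "X = f ` Y" using X(1) by (rule subset_imageE)
    then show ?thesis
      using X S'(10)[OF Y(1)] spanned_rename[OF S'(1) f Y(1)] card_image[OF inj_on_subset[OF f Y(1)]] by simp
  qed
  have s3: "spanned ((`) f ` F) X \<le> 2 * int (card X) - 3" if X: "X \<subseteq> f ` R" "{f a, f b} \<subseteq> X" "X \<noteq> f ` R" for X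
  proof -
    obtain Y where Y: "Y \<subseteq> R" "X = f ` Y" using X(1) by (rule subset_imageE)
    have "f ` {a, b} \<subseteq> f ` Y" using X Y by simp
    moreover have "{a, b} \<subseteq> R" using S'(6,7) by simp
    ultimately have "{a, b} \<subseteq> Y" using inj_on_image_subset_iff[OF f _ Y(1)] by metis
    moreover have "Y \<noteq> R" using X Y by auto
    ultimately show ?thesis
      using S'(11)[OF Y(1)] spanned_rename[OF S'(1) f Y(1)] card_image[OF inj_on_subset[OF f Y(1)]] Y(2) by simp
  qed
  show ?thesis unfolding tight_side_def
    by (intro conjI allI impI graph_on_rename[OF S'(1) f] ab abE c s s3) simp_all
qed

section \<open>Splitting a circuit at a two-vertex cut\<close>

locale two_vertex_cut = circuit_graph V E for V :: "'v set" and E +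
  fixes A B a b
  assumes V: "V = A \<union> B \<union> {a, b}" and AB: "A \<inter> B = {}" and nab: "{a, b} \<inter> (A \<union> B) = {}" "a \<noteq> b"
    and neA: "A \<noteq> {}" and neB: "B \<noteq> {}" and sep: "\<And>x y. x \<in> A \<Longrightarrow> y \<in> B \<Longrightarrow> {x, y} \<notin> E"
begin

abbreviation "P \<equiv> A \<union> {a, b}"
abbreviation "R \<equiv> B \<union> {a, b}"

lemma PR: "P \<union> R = V" "P \<inter> R = {a, b}" "P - R = A" "R - P = B" "P \<subseteq> V" "R \<subseteq> V" "P \<noteq> V" "R \<noteq> V"
  using V AB nab neA neB by blast+

lemma fin: "finite A" "finite B"
  using finV PR(3,4,5,6) finite_subset finite_Diff by metis+

lemma spanned_ab: "spanned E {a, b} = (if {a, b} \<in> E then 1 else 0)"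
proof -
  have "e = {a, b}" if e: "e \<in> E" "e \<subseteq> {a, b}" for e
  proof -
    have "card e = 2" using e graph_on by (simp add: graph_on_def)
    then show ?thesis using e(2) nab(2) by (intro card_seteq) simp_all
  qed
  then have "{e \<in> E. e \<subseteq> {a, b}} = (if {a, b} \<in> E then {{a, b}} else {})" by auto
  then show ?thesis by (simp add: spanned_def)
qed

lemma card_PR: "int (card V) + 2 = int (card P) + int (card R)"
  using card_Un_Int[of P R] fin PR(1,2) nab(2) by simp

lemma no_cross: "cross E X B = {}" if "X \<subseteq> A"
  using cross_empty_iff[OF graph_on, of X B] AB sep that by blast

lemma spanned_PR: "2 * int (card V) - 1 + spanned E {a, b} = spanned E P + spanned E R"
proof -
  have "cross E (P - R) (R - P) = {}" unfolding PR(3,4) by (rule no_cross) simp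
  then show ?thesis using spanned_Un_Int[OF graph_on, of P R] unfolding PR(1,2) spanned_V by simp
qed

lemma sparse_P: "spanned E P \<le> 2 * int (card P) - 2" and sparse_R: "spanned E R \<le> 2 * int (card R) - 2"
  using sparse PR by blast+

text \<open>Shrinking one side of the cut makes \<open>Y \<union> R\<close> a proper set, so it is
  sparse; of the 6, two come from the sparsity bound and four from the two shared vertices. A lower
  bound for \<open>spanned E R\<close> thus sharpens the bound for \<open>Y\<close>.\<close>

lemma spanned_Y_R:
  assumes Y: "Y \<subseteq> P" "{a, b} \<subseteq> Y" "Y \<noteq> P"
  shows "spanned E Y + spanned E R \<le> 2 * int (card Y) + 2 * int (card R) - 6 + spanned E {a, b}"
proof -
  have i: "Y \<inter> R = {a, b}" "Y - R \<subseteq> A" "R - Y = B" using Y AB nab by auto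
  have nV: "Y \<union> R \<noteq> V"
  proof
    assume "Y \<union> R = V"
    then have "A \<subseteq> Y" using V AB nab by blast
    then show False using Y by blast
  qed
  have YV: "Y \<subseteq> V" using Y PR by blast
  have "spanned E (Y \<union> R) \<le> 2 * int (card (Y \<union> R)) - 2" using sparse[of "Y \<union> R"] YV PR(6) nV by blast
  moreover have "int (card Y) + int (card R) = int (card (Y \<union> R)) + 2"
    using card_Un_Int_V[OF YV PR(6)] i nab(2) by simp
  moreover have "spanned E (Y \<union> R) + spanned E {a, b} = spanned E Y + spanned E R"
    using spanned_Un_Int[OF graph_on, of Y R] no_cross[OF i(2)] unfolding i(1,3) by simp
  ultimately show ?thesis by linarith
qed

text \<open>When \<open>ab\<close> is an edge, the counts of the two sides add up to 2|V| = 2|P| +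
  2|R| - 4, the sum of their bounds, so both sides are tight.\<close>

lemma tight_side_P:
  assumes ab: "{a, b} \<in> E"
  shows "tight_side P {e \<in> E. e \<subseteq> P} a b" "tight P"
proof -
  have 1: "spanned E P = 2 * int (card P) - 2" "spanned E R = 2 * int (card R) - 2"
    using spanned_PR card_PR spanned_ab ab sparse_P sparse_R by simp_all
  then show "tight P" using PR by (auto simp: tight_def)
  have "graph_on P {e \<in> E. e \<subseteq> P}" using graph_on fin by (auto simp: graph_on_def)
  moreover have "int (card {e \<in> E. e \<subseteq> P}) = 2 * int (card P) - 2" using 1 by (simp add: spanned_def)
  moreover have "spanned {e \<in> E. e \<subseteq> P} Y \<le> 2 * int (card Y) - 2" if "Y \<subseteq> P" "Y \<noteq> {}" for Y
  proof -
    have "Y \<subseteq> V" "Y \<noteq> V" using that PR by blast+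
    then show ?thesis using spanned_restrict[OF that(1)] sparse that by simp
  qed
  moreover have "spanned {e \<in> E. e \<subseteq> P} Y \<le> 2 * int (card Y) - 3" if Y: "Y \<subseteq> P" "{a, b} \<subseteq> Y" "Y \<noteq> P" for Y
    using spanned_Y_R[OF Y] spanned_ab ab 1 spanned_restrict[OF Y(1)] by simp
  moreover have "{a, b} \<in> {e \<in> E. e \<subseteq> P}" using ab by simp
  ultimately show "tight_side P {e \<in> E. e \<subseteq> P} a b"
    using nab(2) unfolding tight_side_def by blast
qed

text \<open>Now the counts add up to 2|P| + 2|R| - 5, so exactly one side is one short of its
  bound.\<close>

lemma nonedge_sides:
  assumes ab: "{a, b} \<notin> E"
  shows "spanned E P = 2 * int (card P) - 2 \<and> spanned E R = 2 * int (card R) - 3 \<or>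
    spanned E P = 2 * int (card P) - 3 \<and> spanned E R = 2 * int (card R) - 2"
  using spanned_PR card_PR spanned_ab ab sparse_P sparse_R by auto

lemma nonedge_insert:
  assumes ab: "{a, b} \<notin> E"
  shows "graph_on P (insert {a, b} {e \<in> E. e \<subseteq> P})"
    "Y \<subseteq> P \<Longrightarrow> spanned (insert {a, b} {e \<in> E. e \<subseteq> P}) Y = spanned E Y + (if {a, b} \<subseteq> Y then 1 else 0)"
proof -
  show "graph_on P (insert {a, b} {e \<in> E. e \<subseteq> P})"
    using graph_on fin nab(2) by (auto simp: graph_on_def)
  show "spanned (insert {a, b} {e \<in> E. e \<subseteq> P}) Y = spanned E Y + (if {a, b} \<subseteq> Y then 1 else 0)" if "Y \<subseteq> P"
  proof -
    have "{a, b} \<notin> {e \<in> E. e \<subseteq> P}" using ab by simp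
    then show ?thesis using spanned_insert_edge[of "{e \<in> E. e \<subseteq> P}" "{a, b}" Y] spanned_restrict[OF that, of E] finE by simp
  qed
qed

text \<open>The side that attains its bound lacks only the edge \<open>ab\<close> to be a circuit;
  it will be the first operand of a 1-join. Since the other side is one short,
  \<open>spanned_Y_R\<close> leaves room for \<open>ab\<close> in the sets containing both
  ends.\<close>

lemma nonadjacent_circuit_side:
  assumes ab: "{a, b} \<notin> E" and t: "spanned E P = 2 * int (card P) - 2"
  shows "circuit_on P (insert {a, b} {e \<in> E. e \<subseteq> P})"
proof -
  let ?F = "insert {a, b} {e \<in> E. e \<subseteq> P}"
  note i = nonedge_insert[OF ab]
  show ?thesis
  proof (rule circuit_on_intro[OF i(1)])
    show "int (card ?F) = 2 * int (card P) - 1"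
      using spanned_whole[OF i(1) order_refl] i(2)[OF order_refl] t by simp
    fix Y assume Y: "Y \<subseteq> P" "Y \<noteq> {}" "Y \<noteq> P"
    have YV: "Y \<subseteq> V" "Y \<noteq> V" using Y PR by blast+
    have "spanned E R = 2 * int (card R) - 3" using nonedge_sides[OF ab] t by linarith
    then show "spanned ?F Y \<le> 2 * int (card Y) - 2"
      using i(2)[OF Y(1)] sparse[OF YV(1) Y(2) YV(2)] spanned_Y_R[OF Y(1) _ Y(3)] spanned_ab ab by auto
  qed
qed

text \<open>The side that is one short becomes tight with \<open>ab\<close>; extended by a K_4 it
  will be the second operand of the 1-join.\<close>

lemma nonadjacent_tight_side:
  assumes ab: "{a, b} \<notin> E" and t: "spanned E P = 2 * int (card P) - 3"
  shows "tight_side P (insert {a, b} {e \<in> E. e \<subseteq> P}) a b"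
proof -
  let ?F = "insert {a, b} {e \<in> E. e \<subseteq> P}"
  note i = nonedge_insert[OF ab]
  have R: "spanned E R = 2 * int (card R) - 2" using nonedge_sides[OF ab] t by linarith
  have "int (card ?F) = 2 * int (card P) - 2"
    using spanned_whole[OF i(1) order_refl] i(2)[OF order_refl] t by simp
  moreover have s3: "spanned ?F Y \<le> 2 * int (card Y) - 3" if Y: "Y \<subseteq> P" "{a, b} \<subseteq> Y" "Y \<noteq> P" for Y
    using spanned_Y_R[OF Y] spanned_ab ab R i(2)[OF Y(1)] Y(2) by simp
  moreover have "spanned ?F Y \<le> 2 * int (card Y) - 2" if Y: "Y \<subseteq> P" "Y \<noteq> {}" for Y
  proof (cases "{a, b} \<subseteq> Y")
    case True
    then show ?thesis
    proof (cases "Y = P")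
      case True
      then show ?thesis using i(2)[OF order_refl] t by simp
    next
      case False
      then show ?thesis using s3[OF Y(1) True] by simp
    qed
  next
    case False
    have "Y \<subseteq> V" "Y \<noteq> V" using Y PR by blast+
    then show ?thesis using sparse Y(2) i(2)[OF Y(1)] False by auto
  qed
  ultimately show ?thesis using i(1) nab(2) unfolding tight_side_def by blast
qed

lemma swap: "two_vertex_cut V E B A a b"
proof unfold_locales
  show "V = B \<union> A \<union> {a, b}" using V by blast
  show "{x, y} \<notin> E" if "x \<in> B" "y \<in> A" for x y using sep[OF that(2,1)] by (simp add: insert_commute)
qed (use AB nab neA neB in auto)

end

section \<open>Base graphs are circuits\<close>

lemma choose_2_le: "n \<le> 4 \<Longrightarrow> 1 \<le> n \<Longrightarrow> int (n choose 2) \<le> 2 * int n - 2"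
proof -
  assume "n \<le> 4" "1 \<le> n"
  then have "n = 1 \<or> n = 2 \<or> n = 3 \<or> n = 4" by auto
  then show "int (n choose 2) \<le> 2 * int n - 2" by (auto simp: choose_two)
qed

text \<open>Here a set of \<open>n\<close> vertices meets the two K_4 in \<open>s\<close> and
  \<open>t\<close> vertices and their overlap in \<open>k\<close>; it is proper, so one of
  \<open>s, t\<close> is at most 3. The finitely many cases are checked one by one.\<close>

lemma two_K4_sparse:
  fixes s t k n :: nat
  assumes "n + k = s + t" "s \<le> 4" "t \<le> 4" "k \<le> s" "k \<le> t" "k \<le> 2" "s \<le> 3 \<or> t \<le> 3" "n \<noteq> 0"
  shows "int (s choose 2) + int (t choose 2) - int (k choose 2) \<le> 2 * int n - 2"
proof -
  have n: "n = s + t - k" using assms by simp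
  have "s = 0 \<or> s = 1 \<or> s = 2 \<or> s = 3 \<or> s = 4" "t = 0 \<or> t = 1 \<or> t = 2 \<or> t = 3 \<or> t = 4" "k = 0 \<or> k = 1 \<or> k = 2"
    using assms by auto
  then show ?thesis using assms(4-) unfolding n by (elim disjE) (simp_all add: choose_two)
qed

text \<open>The case of a set holding both ends of the further edge: these ends lie outside the
  overlap in different K_4, whence \<open>k < s\<close> and \<open>k < t\<close>.\<close>

lemma two_K4_plus_edge_sparse:
  fixes s t k n :: nat
  assumes "n + k = s + t" "s \<le> 4" "t \<le> 4" "k \<le> 1" "s \<le> 3 \<or> t \<le> 3" "k < s" "k < t"
  shows "int (s choose 2) + int (t choose 2) - int (k choose 2) + 1 \<le> 2 * int n - 2"
proof -
  have n: "n = s + t - k" using assms by simp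
  have "s = 1 \<or> s = 2 \<or> s = 3 \<or> s = 4" "t = 1 \<or> t = 2 \<or> t = 3 \<or> t = 4" "k = 0 \<or> k = 1"
    using assms by auto
  then show ?thesis using assms(5-) unfolding n by (elim disjE) (simp_all add: choose_two)
qed

abbreviation "pairs S \<equiv> {e. e \<subseteq> S \<and> card e = 2}"

lemma graph_on_pairs: "finite S \<Longrightarrow> graph_on S (pairs S)"
  by (simp add: graph_on_def)

lemma spanned_pairs: "finite S \<Longrightarrow> spanned (pairs S) X = int (card (X \<inter> S) choose 2)"
proof -
  assume "finite S"
  have "{e \<in> pairs S. e \<subseteq> X} = {e. e \<subseteq> X \<inter> S \<and> card e = 2}" by auto
  then show ?thesis using n_subsets[of "X \<inter> S" 2] \<open>finite S\<close> by (simp add: spanned_def)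
qed

lemma circuit_on_K5_minus_edge:
  assumes S: "card S = 5" and e: "e \<in> pairs S"
  shows "circuit_on S (pairs S - {e})"
proof -
  have f: "finite S" using S card.infinite by fastforce
  have g: "graph_on S (pairs S - {e})" using graph_on_pairs[OF f] by (auto simp: graph_on_def)
  have fp: "finite (pairs S)" using graph_on_finite_edges[OF graph_on_pairs[OF f]] .
  have spanned: "spanned (pairs S - {e}) X = int (card (X \<inter> S) choose 2) - (if e \<subseteq> X then 1 else 0)" for X
    using spanned_remove_edge[OF fp e, of X] spanned_pairs[OF f] by simp
  show ?thesis
  proof (rule circuit_on_intro[OF g])
    have "spanned (pairs S - {e}) S = 9" using spanned[of S] e S by (simp add: choose_two)
    then show "int (card (pairs S - {e})) = 2 * int (card S) - 1"
      using spanned_whole[OF g order_refl] S by simp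
    fix X assume X: "X \<subseteq> S" "X \<noteq> {}" "X \<noteq> S"
    have "card X < 5" using psubset_card_mono[OF f, of X] X S by auto
    moreover have "card X \<noteq> 0" using X(2) finite_subset[OF X(1) f] by simp
    moreover have "X \<inter> S = X" using X by auto
    ultimately show "spanned (pairs S - {e}) X \<le> 2 * int (card X) - 2"
      using spanned[of X] choose_2_le[of "card X"] by simp
  qed
qed

lemma two_K4_counts:
  assumes ST: "card S = 4" "card T = 4"
  shows "finite S" "finite T" "graph_on (S \<union> T) (pairs S \<union> pairs T)"
    "spanned (pairs S \<union> pairs T) X = int (card (X \<inter> S) choose 2) + int (card (X \<inter> T) choose 2) - int (card (X \<inter> (S \<inter> T)) choose 2)"
    "X \<subseteq> S \<union> T \<Longrightarrow> card X + card (X \<inter> (S \<inter> T)) = card (X \<inter> S) + card (X \<inter> T)"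
    "card (X \<inter> S) \<le> 4" "card (X \<inter> T) \<le> 4"
    "card (X \<inter> (S \<inter> T)) \<le> card (X \<inter> S)" "card (X \<inter> (S \<inter> T)) \<le> card (X \<inter> T)"
    "X \<subseteq> S \<union> T \<Longrightarrow> X \<noteq> S \<union> T \<Longrightarrow> card (X \<inter> S) \<le> 3 \<or> card (X \<inter> T) \<le> 3"
proof -
  show f: "finite S" "finite T" using ST card.infinite by fastforce+
  show "graph_on (S \<union> T) (pairs S \<union> pairs T)" using f by (auto simp: graph_on_def)
  have fp: "finite (pairs S)" "finite (pairs T)" using graph_on_finite_edges graph_on_pairs f by blast+
  have i: "(pairs T - pairs S) \<union> pairs (S \<inter> T) = pairs T" "(pairs T - pairs S) \<inter> pairs (S \<inter> T) = {}"
    "pairs S \<union> (pairs T - pairs S) = pairs S \<union> pairs T" "pairs S \<inter> (pairs T - pairs S) = {}" by auto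
  have "spanned (pairs S \<union> pairs T) X = spanned (pairs S) X + spanned (pairs T - pairs S) X"
    using spanned_Un[of "pairs S" "pairs T - pairs S" X] fp unfolding i by auto
  moreover have "spanned (pairs T) X = spanned (pairs T - pairs S) X + spanned (pairs (S \<inter> T)) X"
    using spanned_Un[of "pairs T - pairs S" "pairs (S \<inter> T)" X] fp graph_on_finite_edges[OF graph_on_pairs[of "S \<inter> T"]] f
    unfolding i by auto
  ultimately show "spanned (pairs S \<union> pairs T) X = int (card (X \<inter> S) choose 2) + int (card (X \<inter> T) choose 2) - int (card (X \<inter> (S \<inter> T)) choose 2)"
    using spanned_pairs[of S X] spanned_pairs[of T X] spanned_pairs[of "S \<inter> T" X] f by simp
  show "card X + card (X \<inter> (S \<inter> T)) = card (X \<inter> S) + card (X \<inter> T)" if "X \<subseteq> S \<union> T"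
  proof -
    have "(X \<inter> S) \<union> (X \<inter> T) = X" "(X \<inter> S) \<inter> (X \<inter> T) = X \<inter> (S \<inter> T)" using that by auto
    then show ?thesis using card_Un_Int[of "X \<inter> S" "X \<inter> T"] f by simp
  qed
  have m: "card (X \<inter> S) \<le> card S" "card (X \<inter> T) \<le> card T" using f by (auto intro: card_mono)
  then show "card (X \<inter> S) \<le> 4" "card (X \<inter> T) \<le> 4" using ST by auto
  show "card (X \<inter> (S \<inter> T)) \<le> card (X \<inter> S)" "card (X \<inter> (S \<inter> T)) \<le> card (X \<inter> T)"
    using f by (auto intro!: card_mono)
  show "card (X \<inter> S) \<le> 3 \<or> card (X \<inter> T) \<le> 3" if X: "X \<subseteq> S \<union> T" "X \<noteq> S \<union> T"
  proof (rule ccontr)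
    assume "\<not> ?thesis"
    then have "card S \<le> card (X \<inter> S)" "card T \<le> card (X \<inter> T)" using ST by auto
    then have "X \<inter> S = S" "X \<inter> T = T" using f card_seteq[of S "X \<inter> S"] card_seteq[of T "X \<inter> T"] by auto
    then show False using X by blast
  qed
qed

lemma circuit_on_two_K4_edge:
  assumes ST: "card S = 4" "card T = 4" and I: "card (S \<inter> T) = 2"
  shows "circuit_on (S \<union> T) (pairs S \<union> pairs T)"
proof (rule circuit_on_intro)
  note c = two_K4_counts[OF ST]
  show g: "graph_on (S \<union> T) (pairs S \<union> pairs T)" by (rule c(3))
  have i: "(S \<union> T) \<inter> S = S" "(S \<union> T) \<inter> T = T" "(S \<union> T) \<inter> (S \<inter> T) = S \<inter> T" by auto
  have "spanned (pairs S \<union> pairs T) (S \<union> T) = 11" "card (S \<union> T) = 6"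
    using c(4)[of "S \<union> T"] c(5)[of "S \<union> T"] ST I unfolding i by (auto simp: choose_two)
  then show "int (card (pairs S \<union> pairs T)) = 2 * int (card (S \<union> T)) - 1"
    using spanned_whole[OF g order_refl] by simp
  fix X assume X: "X \<subseteq> S \<union> T" "X \<noteq> {}" "X \<noteq> S \<union> T"
  have "card (X \<inter> (S \<inter> T)) \<le> card (S \<inter> T)" using c(1) by (intro card_mono) auto
  then have "card (X \<inter> (S \<inter> T)) \<le> 2" using I by simp
  moreover have "card X \<noteq> 0" using X c(1,2) finite_subset by (metis card_0_eq finite_Un)
  ultimately show "spanned (pairs S \<union> pairs T) X \<le> 2 * int (card X) - 2"
    unfolding c(4) using two_K4_sparse[OF c(5)[OF X(1)] c(6,7,8,9) _ c(10)[OF X(1,3)]] by blast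
qed

lemma circuit_on_two_K4_vertex:
  assumes ST: "card S = 4" "card T = 4" and I: "card (S \<inter> T) = 1"
    and xy: "x \<in> S \<union> T" "y \<in> S \<union> T" "x \<noteq> y" "{x, y} \<notin> pairs S \<union> pairs T"
  shows "circuit_on (S \<union> T) (insert {x, y} (pairs S \<union> pairs T))"
proof (rule circuit_on_intro)
  note c = two_K4_counts[OF ST]
  let ?E = "insert {x, y} (pairs S \<union> pairs T)"
  have "card {x, y} = 2" using xy(3) by simp
  then show g: "graph_on (S \<union> T) ?E" using c(3) xy(1,2) unfolding graph_on_def by blast
  have fp: "finite (pairs S \<union> pairs T)" using graph_on_finite_edges[OF c(3)] .
  have e: "spanned ?E X = spanned (pairs S \<union> pairs T) X + (if {x, y} \<subseteq> X then 1 else 0)" for X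
    by (rule spanned_insert_edge[OF fp xy(4)])
  have i: "(S \<union> T) \<inter> S = S" "(S \<union> T) \<inter> T = T" "(S \<union> T) \<inter> (S \<inter> T) = S \<inter> T" by auto
  have "spanned (pairs S \<union> pairs T) (S \<union> T) = 12" "card (S \<union> T) = 7"
    using c(4)[of "S \<union> T"] c(5)[of "S \<union> T"] ST I unfolding i by (auto simp: choose_two)
  then show "int (card ?E) = 2 * int (card (S \<union> T)) - 1"
    using spanned_whole[OF g order_refl] e[of "S \<union> T"] xy by simp
  fix X assume X: "X \<subseteq> S \<union> T" "X \<noteq> {}" "X \<noteq> S \<union> T"
  have "card (X \<inter> (S \<inter> T)) \<le> card (S \<inter> T)" using c(1) by (intro card_mono) auto
  then have "card (X \<inter> (S \<inter> T)) \<le> 1" using I by simp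
  note k = this
  have ne: "card X \<noteq> 0" using X c(1,2) finite_subset by (metis card_0_eq finite_Un)
  show "spanned ?E X \<le> 2 * int (card X) - 2"
  proof (cases "{x, y} \<subseteq> X")
    case False
    have "card (X \<inter> (S \<inter> T)) \<le> 2" using k by simp
    then have "spanned (pairs S \<union> pairs T) X \<le> 2 * int (card X) - 2"
      unfolding c(4) using two_K4_sparse[OF c(5)[OF X(1)] c(6,7,8,9) _ c(10)[OF X(1,3)] ne] by blast
    then show ?thesis using e[of X] unfolding if_not_P[OF False] by simp
  next
    case True
    have "\<not> {x, y} \<subseteq> S" "\<not> {x, y} \<subseteq> T" using xy(3,4) by auto
    then obtain p q where pq: "p \<in> X" "p \<in> S" "p \<notin> T" "q \<in> X" "q \<in> T" "q \<notin> S"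
      using True xy(1,2) by blast
    have "card (X \<inter> (S \<inter> T)) < card (X \<inter> S)" "card (X \<inter> (S \<inter> T)) < card (X \<inter> T)"
      using pq c(1,2) by (auto intro!: psubset_card_mono)
    then have "spanned (pairs S \<union> pairs T) X + 1 \<le> 2 * int (card X) - 2"
      unfolding c(4) using two_K4_plus_edge_sparse[OF c(5)[OF X(1)] c(6,7) k c(10)[OF X(1,3)]] by blast
    then show ?thesis using e[of X] True by simp
  qed
qed

theorem base_graph_circuit:
  assumes "base_graph G"
  shows "circuit G"
  using assms
proof cases
  case (K5_minus_edge S e)
  then show ?thesis using circuit_on_K5_minus_edge[of S e]
    by (simp add: circuit_iff_circuit_on complete_graph_def delete_edge_def)
next
  case (two_K4_edge S T)
  then show ?thesis using circuit_on_two_K4_edge[of S T]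
    by (simp add: circuit_iff_circuit_on complete_graph_def graph_union_def)
next
  case (two_K4_vertex S T H x y)
  then have "{x, y} \<notin> pairs S \<union> pairs T"
    by (simp add: complete_graph_def graph_union_def adjacent_def)
  then show ?thesis using two_K4_vertex circuit_on_two_K4_vertex[of S T x y]
    by (simp add: circuit_iff_circuit_on complete_graph_def graph_union_def add_edges_def)
qed

section \<open>Components\<close>

lemma simple_graph_iff_graph_on: "simple_graph G \<longleftrightarrow> graph_on (verts G) (edges G)"
  by (simp add: simple_graph_def graph_on_def)

lemma circuit_simple: "circuit G \<Longrightarrow> simple_graph G"
  by (simp add: circuit_def)

lemma neighbours_eq_nbrs: "neighbours G v = nbrs (edges G) v"
  by (simp add: neighbours_def nbrs_def adjacent_def)

lemma degree_eq_card_nbrs: "simple_graph G \<Longrightarrow> degree G v = card (nbrs (edges G) v)"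
  using card_edges_at by (simp add: degree_def simple_graph_iff_graph_on)

lemma reachable_refl: "reachable G u u"
  by (simp add: reachable_def)

lemma reachable_step: "reachable G u v \<Longrightarrow> adjacent G v w \<Longrightarrow> reachable G u w"
  unfolding reachable_def by (rule rtranclp.rtrancl_into_rtrancl)

lemma reachable_closed:
  assumes "reachable G u v" "u \<in> S" "\<And>x y. x \<in> S \<Longrightarrow> adjacent G x y \<Longrightarrow> y \<in> S"
  shows "v \<in> S"
  using assms(1) unfolding reachable_def by (induction rule: rtranclp_induct) (use assms in auto)

lemma K4_end_imp_K4_end_edges:
  assumes G: "circuit G" and K: "K4_end G a b c d"
  shows "K4_end_edges (edges G) a b c d"
proof -
  let ?D = "delete_verts G {a, b}" and ?E = "edges G" and ?Q = "{a, b, c, d}"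
  have g: "graph_on (verts G) ?E" using G by (simp add: circuit_iff_circuit_on circuit_on_def)
  have dist: "a \<noteq> b" "a \<noteq> c" "a \<noteq> d" "b \<noteq> c" "b \<noteq> d" "c \<noteq> d" and c4: "card ?Q = 4"
    using K by (auto simp: K4_end_def card_4_distinct)
  have "{e \<in> ?E. e \<subseteq> ?Q} = pairs ?Q"
    using K by (simp add: K4_end_def induced_def complete_graph_def)
  then have inE: "{x, y} \<in> ?E" if "x \<in> ?Q" "y \<in> ?Q" "x \<noteq> y" for x y
  proof -
    have "{x, y} \<in> pairs ?Q" using that by (simp add: card_2_iff) blast
    then show ?thesis using \<open>{e \<in> ?E. e \<subseteq> ?Q} = pairs ?Q\<close> by blast
  qed
  obtain u where u: "u \<in> verts ?D" and cd: "{c, d} = verts ?D \<inter> {v. reachable ?D u v}"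
    using K by (auto simp: K4_end_def components_def induced_def)
  have nb: "nbrs ?E x = ?Q - {x}" if x: "x \<in> {c, d}" for x
  proof
    show "nbrs ?E x \<subseteq> ?Q - {x}"
    proof
      fix y assume y: "y \<in> nbrs ?E x"
      have yV: "y \<in> verts G" "y \<noteq> x" using y graph_on_nbrs[OF g] by auto
      show "y \<in> ?Q - {x}"
      proof (cases "y \<in> {a, b}")
        case True
        then show ?thesis using yV by auto
      next
        case False
        have "x \<notin> {a, b}" using x dist by auto
        then have "adjacent ?D x y" using y False by (auto simp: adjacent_def delete_verts_def nbrs_def)
        moreover have "reachable ?D u x" using x cd by blast
        ultimately have "reachable ?D u y" by (meson reachable_step)
        moreover have "y \<in> verts ?D" using yV False by (simp add: delete_verts_def)
        ultimately have "y \<in> {c, d}" using cd by blast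
        then show ?thesis using yV by auto
      qed
    qed
    show "?Q - {x} \<subseteq> nbrs ?E x" using inE[of x] x by (auto simp: nbrs_def)
  qed
  have "nbrs ?E c = {a, b, d}" "nbrs ?E d = {a, b, c}" using nb[of c] nb[of d] dist by auto
  then show ?thesis using c4 inE[of a b] dist by (simp add: K4_end_edges_def)
qed

lemma K4_end_edges_imp_K4_end:
  assumes G: "circuit G" and K: "K4_end_edges (edges G) a b c d"
  shows "K4_end G a b c d"
proof -
  interpret circuit_graph "verts G" "edges G" using G by unfold_locales (simp add: circuit_iff_circuit_on)
  let ?D = "delete_verts G {a, b}" and ?E = "edges G" and ?Q = "{a, b, c, d}"
  have dist: "a \<noteq> b" "a \<noteq> c" "a \<noteq> d" "b \<noteq> c" "b \<noteq> d" "c \<noteq> d" and c4: "card ?Q = 4"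
    and ab: "{a, b} \<in> ?E" and n: "nbrs ?E c = {a, b, d}" "nbrs ?E d = {a, b, c}"
    using K by (auto simp: K4_end_edges_def card_4_distinct)
  have QV: "?Q \<subseteq> verts G" using n nbrs_V[of c] nbrs_V[of d] by auto
  have "a \<in> nbrs ?E c" "b \<in> nbrs ?E c" "d \<in> nbrs ?E c" "a \<in> nbrs ?E d" "b \<in> nbrs ?E d" "b \<in> nbrs ?E a"
    using n ab by (auto simp: nbrs_def)
  then have "clique ?E ?Q" unfolding clique_def nbrs_def by (auto simp: insert_commute)
  then have "{e \<in> ?E. e \<subseteq> ?Q} = pairs ?Q" using clique_spanned(2)[of ?Q] by simp
  moreover have "verts G \<inter> ?Q = ?Q" using QV by blast
  ultimately have ind: "induced G ?Q = complete_graph ?Q" by (simp add: induced_def complete_graph_def)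
  have adjD: "adjacent ?D x y \<longleftrightarrow> {x, y} \<in> ?E \<and> x \<notin> {a, b} \<and> y \<notin> {a, b}" for x y
    by (auto simp: adjacent_def delete_verts_def)
  have closed: "v \<in> {c, d}" if "reachable ?D c v" for v
  proof (rule reachable_closed[OF that])
    show "y \<in> {c, d}" if "x \<in> {c, d}" "adjacent ?D x y" for x y
      using that n by (auto simp: adjD nbrs_def)
  qed simp
  have cdE: "{c, d} \<in> ?E" using n by (auto simp: nbrs_def)
  then have "reachable ?D c d" using dist reachable_step[OF reachable_refl] by (metis adjD insertE singletonD)
  then have comp: "verts ?D \<inter> {v. reachable ?D c v} = {c, d}"
    using closed QV dist reachable_refl[of ?D c] by (auto simp: delete_verts_def)
  have cD: "c \<in> verts ?D" using QV dist by (auto simp: delete_verts_def)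
  have "{c, d} \<in> verts ` components ?D"
  proof (rule image_eqI)
    show "induced ?D {v. reachable ?D c v} \<in> components ?D" using cD by (auto simp: components_def)
    show "{c, d} = verts (induced ?D {v. reachable ?D c v})" using comp by (simp add: induced_def)
  qed
  moreover have "vertex_cut G {a, b}"
  proof -
    \<comment> \<open>A circuit has at least five vertices, so some vertex lies beyond the K_4 and
      \<open>{a, b}\<close> really separates.\<close>
    have "\<not> verts G \<subseteq> ?Q"
    proof
      assume "verts G \<subseteq> ?Q"
      then have "card (verts G) \<le> card ?Q" by (intro card_mono) auto
      then show False using c4 card_V_ge by simp
    qed
    then obtain r where r: "r \<in> verts G" "r \<notin> ?Q" by blast
    then have "\<not> reachable ?D c r" using closed[of r] by auto
    moreover have "r \<in> verts G - {a, b}" "c \<in> verts G - {a, b}" using r QV dist by auto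
    moreover have "{a, b} \<subseteq> verts G" using QV by simp
    ultimately show ?thesis unfolding vertex_cut_def by (intro conjI bexI)
  qed
  ultimately show ?thesis using c4 ind unfolding K4_end_def by blast
qed

text \<open>At least three edges leave every proper nonempty vertex set, in particular the set of
  vertices reachable from \<open>u\<close> if it were proper.\<close>

lemma circuit_connected:
  assumes "circuit G"
  shows "connected_graph G"
proof -
  interpret circuit_graph "verts G" "edges G" using assms by unfold_locales (simp add: circuit_iff_circuit_on)
  have "reachable G u v" if u: "u \<in> verts G" and v: "v \<in> verts G" for u v
  proof -
    let ?S = "verts G \<inter> {v. reachable G u v}"
    have "?S = verts G"
    proof (rule ccontr)
      assume ne: "?S \<noteq> verts G"
      have "u \<in> ?S" using u reachable_refl by auto
      then have "3 \<le> card (cross (edges G) ?S (verts G - ?S))" using cut_ge_3(1)[of ?S] ne by blast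
      then have "cross (edges G) ?S (verts G - ?S) \<noteq> {}" by auto
      then obtain x y where "x \<in> ?S" "y \<in> verts G - ?S" "{x, y} \<in> edges G"
        using cross_empty_iff[OF graph_on, of ?S "verts G - ?S"] by blast
      then show False using reachable_step[of G u x y] by (auto simp: adjacent_def)
    qed
    then show ?thesis using v by blast
  qed
  moreover have "verts G \<noteq> {}" using card_V_ge by auto
  ultimately show ?thesis by (simp add: connected_graph_def)
qed

lemma simple_edge_props:
  assumes "simple_graph G" "e \<in> edges G"
  shows "e \<subseteq> verts G" "e \<noteq> {}"
  using assms by (auto simp: simple_graph_def)

lemma simple_adjacent: "simple_graph G \<Longrightarrow> adjacent G u v \<Longrightarrow> u \<in> verts G \<and> v \<in> verts G"
  unfolding adjacent_def using simple_edge_props by blast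

lemma reachable_in_verts: "simple_graph G \<Longrightarrow> reachable G u v \<Longrightarrow> u \<in> verts G \<Longrightarrow> v \<in> verts G"
  using reachable_closed simple_adjacent by metis

lemma reachable_union:
  assumes G: "simple_graph G" and K: "simple_graph K" and dis: "verts G \<inter> verts K = {}" and u: "u \<in> verts G"
  shows "reachable (graph_union G K) u v \<longleftrightarrow> reachable G u v"
proof
  assume "reachable G u v"
  then show "reachable (graph_union G K) u v" unfolding reachable_def
    by (rule rtranclp_mono[THEN predicate2D, rotated]) (auto simp: adjacent_def graph_union_def)
next
  assume r: "reachable (graph_union G K) u v"
  have "v \<in> {v \<in> verts G. reachable G u v}"
  proof (rule reachable_closed[OF r])
    show "u \<in> {v \<in> verts G. reachable G u v}" using u reachable_refl by simp
    fix x y assume x: "x \<in> {v \<in> verts G. reachable G u v}" and a: "adjacent (graph_union G K) x y"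
    have "adjacent G x y \<or> adjacent K x y" using a by (auto simp: adjacent_def graph_union_def)
    then have "adjacent G x y" using simple_adjacent[OF K] x dis by blast
    then show "y \<in> {v \<in> verts G. reachable G u v}"
      using x simple_adjacent[OF G, of x y] reachable_step[of G u x y] by simp
  qed
  then show "reachable G u v" by simp
qed

lemma induced_union:
  assumes K: "simple_graph K" and dis: "verts G \<inter> verts K = {}" and S: "S \<subseteq> verts G"
  shows "induced (graph_union G K) S = induced G S"
proof -
  have "\<not> e \<subseteq> S" if "e \<in> edges K" for e
    using simple_edge_props[OF K that] S dis by blast
  then have "{e \<in> edges G \<union> edges K. e \<subseteq> S} = {e \<in> edges G. e \<subseteq> S}" by blast
  moreover have "(verts G \<union> verts K) \<inter> S = verts G \<inter> S" using S dis by blast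
  ultimately show ?thesis by (simp add: induced_def graph_union_def)
qed

lemma component_union:
  assumes "simple_graph G" "simple_graph K" "verts G \<inter> verts K = {}" "u \<in> verts G"
  shows "induced (graph_union G K) {v. reachable (graph_union G K) u v} = induced G {v. reachable G u v}"
proof -
  have "{v. reachable (graph_union G K) u v} = {v. reachable G u v}"
    using reachable_union[OF assms] by blast
  moreover have "{v. reachable G u v} \<subseteq> verts G" using reachable_in_verts[OF assms(1) _ assms(4)] by blast
  ultimately show ?thesis using induced_union[OF assms(2,3)] by simp
qed

lemma components_union:
  assumes "simple_graph G" "simple_graph K" "verts G \<inter> verts K = {}"
  shows "components G \<subseteq> components (graph_union G K)"
proof
  fix C assume "C \<in> components G"
  then obtain u where u: "u \<in> verts G" "C = induced G {v. reachable G u v}" by (auto simp: components_def)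
  then have "C = induced (graph_union G K) {v. reachable (graph_union G K) u v}"
    using component_union[OF assms u(1)] by simp
  then show "C \<in> components (graph_union G K)" using u by (auto simp: components_def graph_union_def)
qed

lemma induced_whole:
  assumes "simple_graph G" "verts G \<subseteq> S"
  shows "induced G S = G"
proof -
  have "{e \<in> edges G. e \<subseteq> S} = edges G" using assms simple_edge_props by blast
  moreover have "verts G \<inter> S = verts G" using assms by blast
  ultimately show ?thesis by (simp add: induced_def)
qed

lemma connected_component:
  assumes "simple_graph G" "connected_graph G" "u \<in> verts G"
  shows "induced G {v. reachable G u v} = G"
  by (rule induced_whole) (use assms in \<open>auto simp: connected_graph_def\<close>)

lemma connected_components: "simple_graph G \<Longrightarrow> connected_graph G \<Longrightarrow> components G = {G}"
proof -
  assume G: "simple_graph G" "connected_graph G"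
  then obtain u where u: "u \<in> verts G" by (auto simp: connected_graph_def)
  have "components G = (\<lambda>u. induced G {v. reachable G u v}) ` verts G" by (auto simp: components_def)
  also have "\<dots> = (\<lambda>u. G) ` verts G" by (rule image_cong) (simp_all add: connected_component[OF G])
  finally show ?thesis using u by auto
qed

definition family_union :: "'v ugraph set \<Rightarrow> 'v ugraph" where
  "family_union \<C> = Graph (\<Union>C\<in>\<C>. verts C) (\<Union>C\<in>\<C>. edges C)"

text \<open>The invariant of the generation: every graph reached is the union of such a family, and
  the members are its components.\<close>

definition circuit_family :: "'v ugraph set \<Rightarrow> bool" where
  "circuit_family \<C> \<longleftrightarrow> finite \<C> \<and> (\<forall>C\<in>\<C>. circuit C) \<and>
     (\<forall>C\<in>\<C>. \<forall>D\<in>\<C>. C \<noteq> D \<longrightarrow> verts C \<inter> verts D = {})"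

lemma family_union_insert: "family_union (insert C \<C>) = graph_union C (family_union \<C>)"
  by (simp add: family_union_def graph_union_def)

lemma circuit_family_subset: "circuit_family \<C> \<Longrightarrow> \<D> \<subseteq> \<C> \<Longrightarrow> circuit_family \<D>"
  unfolding circuit_family_def using finite_subset by blast

lemma family_union_simple:
  assumes "circuit_family \<C>"
  shows "simple_graph (family_union \<C>)"
proof -
  have "finite (verts C)" "\<forall>e\<in>edges C. e \<subseteq> verts C \<and> card e = 2" if "C \<in> \<C>" for C
    using assms that circuit_simple by (auto simp: circuit_family_def simple_graph_def)
  then show ?thesis using assms unfolding family_union_def simple_graph_def circuit_family_def by fastforce
qed

lemma family_disjoint_rest:
  assumes "circuit_family \<C>" "\<D> \<subseteq> \<C>"
  shows "verts (family_union \<D>) \<inter> verts (family_union (\<C> - \<D>)) = {}"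
  using assms unfolding circuit_family_def family_union_def by (auto 4 4)

lemma circuit_family_components:
  assumes F: "circuit_family \<C>"
  shows "components (family_union \<C>) = \<C>"
proof -
  have comp: "induced (family_union \<C>) {v. reachable (family_union \<C>) u v} = C" if C: "C \<in> \<C>" and u: "u \<in> verts C" for C u
  proof -
    have eq: "family_union \<C> = graph_union C (family_union (\<C> - {C}))"
      using family_union_insert[of C "\<C> - {C}"] C by (simp add: insert_absorb)
    have s: "circuit C" "simple_graph C" using F C circuit_simple by (auto simp: circuit_family_def)
    have s': "simple_graph (family_union (\<C> - {C}))" using family_union_simple[OF circuit_family_subset[OF F]] by blast
    have dis: "verts C \<inter> verts (family_union (\<C> - {C})) = {}"
      using family_disjoint_rest[OF F, of "{C}"] C by (simp add: family_union_def)
    show ?thesis unfolding eq component_union[OF s(2) s' dis u]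
      by (rule connected_component[OF s(2) circuit_connected[OF s(1)] u])
  qed
  show ?thesis
  proof
    show "components (family_union \<C>) \<subseteq> \<C>"
    proof
      fix D assume "D \<in> components (family_union \<C>)"
      then obtain u where u: "u \<in> verts (family_union \<C>)" "D = induced (family_union \<C>) {v. reachable (family_union \<C>) u v}"
        by (auto simp: components_def)
      then obtain C where "C \<in> \<C>" "u \<in> verts C" by (auto simp: family_union_def)
      then show "D \<in> \<C>" using comp u by metis
    qed
    show "\<C> \<subseteq> components (family_union \<C>)"
    proof
      fix C assume C: "C \<in> \<C>"
      then have "connected_graph C" using F circuit_connected by (auto simp: circuit_family_def)
      then obtain u where u: "u \<in> verts C" by (auto simp: connected_graph_def)
      then have "u \<in> verts (family_union \<C>)" using C by (auto simp: family_union_def)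
      then show "C \<in> components (family_union \<C>)" unfolding components_def using comp[OF C u] by blast
    qed
  qed
qed

lemma circuit_family_replace:
  assumes F: "circuit_family \<C>" and D: "\<D> \<subseteq> \<C>" and C: "circuit C"
    and dis: "verts C \<inter> verts (family_union (\<C> - \<D>)) = {}"
  shows "circuit_family (insert C (\<C> - \<D>))"
  using circuit_family_subset[OF F, of "\<C> - \<D>"] C dis
  unfolding circuit_family_def family_union_def by (auto 4 3)

section \<open>Generated graphs are disjoint unions of circuits\<close>

lemma circuit_graph_on: "circuit G \<Longrightarrow> graph_on (verts G) (edges G)"
  by (simp add: circuit_iff_circuit_on circuit_on_def)

lemma edges_avoiding:
  assumes "graph_on V E"
  shows "{e \<in> E. e \<inter> S = {}} = {e \<in> E. e \<subseteq> V - S}"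
  using assms by (auto simp: graph_on_def)

lemma inj_on_glue:
  assumes "a1 \<notin> R" "b1 \<notin> R" "a1 \<noteq> b1"
  shows "inj_on (id(a2 := a1, b2 := b1)) R"
  using assms by (auto simp: inj_on_def)

lemma image_glue:
  assumes "a2 \<in> R" "b2 \<in> R" "a2 \<noteq> b2"
  shows "id(a2 := a1, b2 := b1) ` R = (R - {a2, b2}) \<union> {a1, b1}"
  using assms by (auto simp: image_iff)

text \<open>In the first two joins, renaming \<open>a2, b2\<close> to \<open>a1, b1\<close> makes
  the remaining parts overlap exactly in \<open>{a1, b1}\<close>, as the gluing theorems require.
  The bound on the vertices keeps the join disjoint from all other components.\<close>

lemma is_join_circuit:
  assumes "is_join G1 G2 H"
  shows "circuit H" "verts H \<subseteq> verts G1 \<union> verts G2"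
proof -
  have "circuit H \<and> verts H \<subseteq> verts G1 \<union> verts G2"
    using assms
  proof cases
    case (join1 a1 b1 a2 b2 c2 d2)
    let ?s = "id(a2 := a1, b2 := b1)" and ?R = "verts G2 - {c2, d2}"
    let ?F = "{e \<in> edges G2. e \<subseteq> ?R}"
    have C1: "circuit_on (verts G1) (edges G1)" and C2: "circuit_on (verts G2) (edges G2)"
      using join1 by (auto simp: circuit_iff_circuit_on)
    have S: "tight_side ?R ?F a2 b2" by (rule circuit_on_K4_end_side[OF C2 K4_end_imp_K4_end_edges]) (use join1 in auto)
    note S' = tight_sideD[OF S]
    have ab: "a1 \<noteq> b1" "a1 \<in> verts G1" "b1 \<in> verts G1"
      using circuit_graph_on[OF join1(2)] join1(5) by (auto simp: graph_on_def)
    have nR: "a1 \<notin> ?R" "b1 \<notin> ?R" using ab join1(4) by auto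
    have inj: "inj_on ?s ?R" by (rule inj_on_glue[OF nR ab(1)])
    have s: "?s a2 = a1" "?s b2 = b1" using S'(4) by auto
    have im: "?s ` ?R = (?R - {a2, b2}) \<union> {a1, b1}" by (rule image_glue[OF S'(6,7,4)])
    have T: "tight_side (?s ` ?R) ((`) ?s ` ?F) a1 b1" using tight_side_rename[OF S inj] unfolding s .
    have I: "verts G1 \<inter> ?s ` ?R = {a1, b1}" unfolding im using ab join1(4) by auto
    have "(`) ?s ` (?F - {{a2, b2}}) = (`) ?s ` ?F - {?s ` {a2, b2}}"
    proof -
      have "inj_on ((`) ?s) ?F"
        using inj_on_image_Pow[OF inj] by (rule inj_on_subset) auto
      then show ?thesis using inj_on_image_set_diff[of "(`) ?s" ?F ?F "{{a2, b2}}"] S'(5) by simp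
    qed
    also have "?s ` {a2, b2} = {a1, b1}" by (simp only: image_insert image_empty s)
    finally have eE: "(`) ?s ` (?F - {{a2, b2}}) = (`) ?s ` ?F - {{a1, b1}}" .
    have H: "H = Graph (verts G1 \<union> ?s ` ?R) ((edges G1 - {{a1, b1}}) \<union> ((`) ?s ` ?F - {{a1, b1}}))"
      unfolding join1(1) eE[symmetric]
      by (simp only: graph_union_def delete_edge_def rename_def delete_verts_def ugraph.sel
          edges_avoiding[OF circuit_graph_on[OF join1(3)]])
    have "circuit H" using circuit_on_join1[OF C1 join1(5) T I] by (simp add: H circuit_iff_circuit_on)
    moreover have "verts H \<subseteq> verts G1 \<union> verts G2" unfolding H using ab im by auto
    ultimately show ?thesis ..
  next
    case (join2 a1 b1 c1 d1 a2 b2 c2 d2)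
    let ?s = "id(a2 := a1, b2 := b1)" and ?P = "verts G1 - {c1, d1}" and ?R = "verts G2 - {c2, d2}"
    let ?E = "{e \<in> edges G1. e \<subseteq> ?P}" and ?F = "{e \<in> edges G2. e \<subseteq> ?R}"
    have C1: "circuit_on (verts G1) (edges G1)" and C2: "circuit_on (verts G2) (edges G2)"
      using join2 by (auto simp: circuit_iff_circuit_on)
    have S1: "tight_side ?P ?E a1 b1" by (rule circuit_on_K4_end_side[OF C1 K4_end_imp_K4_end_edges]) (use join2 in auto)
    have S: "tight_side ?R ?F a2 b2" by (rule circuit_on_K4_end_side[OF C2 K4_end_imp_K4_end_edges]) (use join2 in auto)
    note S1' = tight_sideD[OF S1] and S' = tight_sideD[OF S]
    have nR: "a1 \<notin> ?R" "b1 \<notin> ?R" using S1'(6,7) join2(4) by auto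
    have inj: "inj_on ?s ?R" by (rule inj_on_glue[OF nR S1'(4)])
    have s: "?s a2 = a1" "?s b2 = b1" using S'(4) by auto
    have im: "?s ` ?R = (?R - {a2, b2}) \<union> {a1, b1}" by (rule image_glue[OF S'(6,7,4)])
    have T: "tight_side (?s ` ?R) ((`) ?s ` ?F) a1 b1" using tight_side_rename[OF S inj] unfolding s .
    have I: "?P \<inter> ?s ` ?R = {a1, b1}" unfolding im using S1'(6,7) join2(4) by auto
    have H: "H = Graph (?P \<union> ?s ` ?R) (?E \<union> (`) ?s ` ?F)"
      unfolding join2(1)
      by (simp only: graph_union_def rename_def delete_verts_def ugraph.sel
          edges_avoiding[OF circuit_graph_on[OF join2(2)]] edges_avoiding[OF circuit_graph_on[OF join2(3)]])
    have "circuit H" using circuit_on_join2[OF S1 T I] by (simp add: H circuit_iff_circuit_on)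
    moreover have "verts H \<subseteq> verts G1 \<union> verts G2" unfolding H using S1'(6,7) im by auto
    ultimately show ?thesis ..
  next
    case (join3 v1 a1 b1 c1 v2 a2 b2 c2)
    let ?A = "verts G1 - {v1}" and ?B = "verts G2 - {v2}"
    let ?E = "{e \<in> edges G1. v1 \<notin> e}" and ?F = "{e \<in> edges G2. v2 \<notin> e}"
    have C1: "circuit_on (verts G1) (edges G1)" and C2: "circuit_on (verts G2) (edges G2)"
      using join3 by (auto simp: circuit_iff_circuit_on)
    have n1: "nbrs (edges G1) v1 = {a1, b1, c1}" "card {a1, b1, c1} = 3"
      using join3 degree_eq_card_nbrs[OF circuit_simple[OF join3(2)], of v1] by (auto simp: neighbours_eq_nbrs)
    have n2: "nbrs (edges G2) v2 = {a2, b2, c2}" "card {a2, b2, c2} = 3"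
      using join3 degree_eq_card_nbrs[OF circuit_simple[OF join3(3)], of v2] by (auto simp: neighbours_eq_nbrs)
    have d: "a1 \<noteq> b1" "a1 \<noteq> c1" "b1 \<noteq> c1" "a2 \<noteq> b2" "a2 \<noteq> c2" "b2 \<noteq> c2"
      using n1(2) n2(2) by (auto simp: card_insert_if split: if_splits)
    have N1: "node_side ?A ?E a1 b1 c1" by (rule circuit_on_node_side[OF C1 join3(5) n1(1) d(1-3)])
    have N2: "node_side ?B ?F a2 b2 c2" by (rule circuit_on_node_side[OF C2 join3(8) n2(1) d(4-6)])
    have H: "H = Graph (?A \<union> ?B) (?E \<union> ?F \<union> {{a1, a2}, {b1, b2}, {c1, c2}})"
      unfolding join3(1) by (simp add: add_edges_def graph_union_def delete_verts_def)
    have "?A \<inter> ?B = {}" using join3(4) by blast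
    from circuit_on_join3[OF N1 N2 this] have "circuit H" by (simp add: H circuit_iff_circuit_on)
    moreover have "verts H \<subseteq> verts G1 \<union> verts G2" unfolding H by auto
    ultimately show ?thesis ..
  qed
  then show "circuit H" "verts H \<subseteq> verts G1 \<union> verts G2" by auto
qed

lemma delete_verts_family_union:
  assumes F: "circuit_family \<C>" and D: "\<D> \<subseteq> \<C>"
  shows "delete_verts (family_union \<C>) (verts (family_union \<D>)) = family_union (\<C> - \<D>)"
proof -
  have eq: "family_union \<C> = graph_union (family_union \<D>) (family_union (\<C> - \<D>))" using D by (auto simp: family_union_def graph_union_def)
  have s: "simple_graph (family_union \<D>)" "simple_graph (family_union (\<C> - \<D>))"
    using family_union_simple circuit_family_subset[OF F] D by blast+
  note dis = family_disjoint_rest[OF F D]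
  have "verts (family_union \<D>) \<union> verts (family_union (\<C> - \<D>)) - verts (family_union \<D>) = verts (family_union (\<C> - \<D>))" using dis by blast
  moreover have "{e \<in> edges (family_union \<D>) \<union> edges (family_union (\<C> - \<D>)). e \<inter> verts (family_union \<D>) = {}} = edges (family_union (\<C> - \<D>))"
  proof -
    have "e \<inter> verts (family_union \<D>) \<noteq> {}" if "e \<in> edges (family_union \<D>)" for e
      using simple_edge_props[OF s(1) that] by blast
    moreover have "e \<inter> verts (family_union \<D>) = {}" if "e \<in> edges (family_union (\<C> - \<D>))" for e
      using simple_edge_props[OF s(2) that] dis by blast
    ultimately show ?thesis by blast
  qed
  ultimately show ?thesis unfolding eq delete_verts_def graph_union_def ugraph.sel by simp
qed

lemma generation_step_family:
  assumes F: "circuit_family \<C>" and st: "generation_step (family_union \<C>) H"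
  shows "\<exists>\<C>'. circuit_family \<C>' \<and> H = family_union \<C>'"
  using st
proof cases
  case (henneberg2 C u w z v)
  have C: "C \<in> \<C>" using henneberg2(2) circuit_family_components[OF F] by simp
  then have "circuit_on (verts C) (edges C)" using F by (auto simp: circuit_family_def circuit_iff_circuit_on)
  moreover have vC: "v \<notin> verts C" using henneberg2(6) C by (auto simp: family_union_def)
  ultimately have c: "circuit_on (insert v (verts C)) (edges C - {{u, w}} \<union> {{v, u}, {v, w}, {v, z}})"
    using circuit_on_henneberg2 henneberg2(3,4,5) by metis
  let ?C = "Graph (insert v (verts C)) (edges C - {{u, w}} \<union> {{v, u}, {v, w}, {v, z}})"
  have sC: "simple_graph C" using C F circuit_simple by (auto simp: circuit_family_def)
  have dis: "verts C \<inter> verts (family_union (\<C> - {C})) = {}"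
    using family_disjoint_rest[OF F, of "{C}"] C by (simp add: family_union_def)
  have "v \<notin> verts (family_union (\<C> - {C}))" using henneberg2(6) by (auto simp: family_union_def)
  then have "circuit_family (insert ?C (\<C> - {C}))"
    using circuit_family_replace[OF F, of "{C}" ?C] c C dis by (simp add: circuit_iff_circuit_on)
  moreover have "H = family_union (insert ?C (\<C> - {C}))"
  proof -
    have eq: "family_union \<C> = graph_union C (family_union (\<C> - {C}))"
      using family_union_insert[of C "\<C> - {C}"] C by (simp add: insert_absorb)
    have "{u, w} \<notin> edges (family_union (\<C> - {C}))"
      using simple_edge_props[OF sC henneberg2(3)] dis
        simple_edge_props(1)[OF family_union_simple[OF circuit_family_subset[OF F]], of "\<C> - {C}" "{u, w}"] by blast
    then have "edges C \<union> edges (family_union (\<C> - {C})) - {{u, w}} \<union> {{v, u}, {v, w}, {v, z}}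
      = edges C - {{u, w}} \<union> {{v, u}, {v, w}, {v, z}} \<union> edges (family_union (\<C> - {C}))" by blast
    then show ?thesis unfolding henneberg2(1) family_union_insert eq graph_union_def ugraph.sel by simp
  qed
  ultimately show ?thesis by blast
next
  case (join G1 G2 H')
  have C: "{G1, G2} \<subseteq> \<C>" using join(2,3) circuit_family_components[OF F] by simp
  note J = is_join_circuit[OF join(5)]
  have V: "verts G1 \<union> verts G2 = verts (family_union {G1, G2})" by (auto simp: family_union_def)
  have "verts H' \<inter> verts (family_union (\<C> - {G1, G2})) = {}"
    using J(2) family_disjoint_rest[OF F C] unfolding V by blast
  then have "circuit_family (insert H' (\<C> - {G1, G2}))" by (rule circuit_family_replace[OF F C J(1)])
  moreover have "H = family_union (insert H' (\<C> - {G1, G2}))"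
    unfolding join(1) V delete_verts_family_union[OF F C] family_union_insert[of H']
    by (simp add: graph_union_def Un_commute)
  ultimately show ?thesis by blast
qed

lemma generated_family:
  assumes "generation_step\<^sup>*\<^sup>* G0 H" "disjoint_base_graphs G0"
  shows "\<exists>\<C>. circuit_family \<C> \<and> H = family_union \<C>"
  using assms(1)
proof (induction rule: rtranclp_induct)
  case base
  obtain \<B> where B: "finite \<B>" "\<forall>B\<in>\<B>. base_graph B" "\<forall>A\<in>\<B>. \<forall>B\<in>\<B>. A \<noteq> B \<longrightarrow> verts A \<inter> verts B = {}"
    "G0 = family_union \<B>"
    using assms(2) by (auto simp: disjoint_base_graphs_def family_union_def)
  have "\<forall>B\<in>\<B>. circuit B" using B(2) base_graph_circuit by blast
  then have "circuit_family \<B>" using B(1,3) unfolding circuit_family_def by (intro conjI)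
  then show ?case using B(4) by (intro exI conjI)
next
  case (step G H)
  then show ?case using generation_step_family by metis
qed

lemma reachable_rename: "reachable G u v \<Longrightarrow> reachable (rename f G) (f u) (f v)"
proof -
  have adj: "adjacent (rename f G) (f x) (f y)" if "adjacent G x y" for x y
  proof -
    have "f ` {x, y} \<in> (`) f ` edges G" using that unfolding adjacent_def by (rule imageI)
    then show ?thesis by (simp add: adjacent_def rename_def)
  qed
  assume "reachable G u v"
  then show ?thesis unfolding reachable_def
    by (induction rule: rtranclp_induct) (auto intro: rtranclp.rtrancl_into_rtrancl adj)
qed

lemma connected_rename: "connected_graph G \<Longrightarrow> connected_graph (rename f G)"
proof -
  assume G: "connected_graph G"
  have "reachable (rename f G) (f u) (f v)" if "u \<in> verts G" "v \<in> verts G" for u v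
    using G that by (intro reachable_rename) (simp add: connected_graph_def)
  then show ?thesis using G by (simp add: connected_graph_def rename_def)
qed

lemma circuit_rename: "circuit G \<Longrightarrow> inj_on f (verts G) \<Longrightarrow> circuit (rename f G)"
  using circuit_on_rename by (simp add: circuit_iff_circuit_on rename_def)

lemma rename_inverse:
  assumes "simple_graph G" "\<And>x. x \<in> verts G \<Longrightarrow> g (f x) = x"
  shows "rename g (rename f G) = G"
proof -
  have V: "g ` f ` X = X" if "X \<subseteq> verts G" for X
    using assms(2) that by (force simp: image_iff)
  have "(`) g ` (`) f ` edges G = (\<lambda>e. e) ` edges G"
    unfolding image_image by (rule image_cong) (use V[unfolded image_image] simple_edge_props(1)[OF assms(1)] in auto)
  then show ?thesis using V[OF order_refl] by (simp add: rename_def)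
qed

text \<open>Renaming back carries connectedness from \<open>G\<close> to the generated graph
  \<open>H\<close>. The components of \<open>H\<close> are the circuits of its family, so the family
  is just \<open>{H}\<close>.\<close>

theorem connected_generated_circuit:
  assumes G: "connected_graph G" and R: "recursively_generated G"
  shows "circuit G"
proof -
  obtain G0 H :: "nat ugraph" where "disjoint_base_graphs G0" "generation_step\<^sup>*\<^sup>* G0 H" "isomorphic H G"
    using R unfolding recursively_generated_def by blast
  then obtain \<C> f where F: "circuit_family \<C>" and H: "H = family_union \<C>" and f: "inj_on f (verts H)" "G = rename f H"
    using generated_family unfolding isomorphic_def by metis
  have sH: "simple_graph H" using family_union_simple[OF F] H by simp
  have "rename (the_inv_into (verts H) f) G = H"
    unfolding f(2) by (rule rename_inverse[OF sH]) (rule the_inv_into_f_f[OF f(1)])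
  then have "connected_graph H" using connected_rename[OF G] by metis
  then have "components H = {H}" using connected_components sH by blast
  then have "\<C> = {H}" using circuit_family_components[OF F] H by simp
  then have "circuit H" using F by (simp add: circuit_family_def)
  then show ?thesis using circuit_rename f by blast
qed

section \<open>Generating circuits\<close>

text \<open>Confining all vertices to a set \<open>U\<close> lets two generations run side by side, on disjoint sets.\<close>

definition step_within :: "'v set \<Rightarrow> 'v ugraph \<Rightarrow> 'v ugraph \<Rightarrow> bool" where
  "step_within U G H \<longleftrightarrow> generation_step G H \<and> verts H \<subseteq> U"

definition generated_within :: "'v set \<Rightarrow> 'v ugraph \<Rightarrow> bool" where
  "generated_within U G \<longleftrightarrow>
     (\<exists>G0. disjoint_base_graphs G0 \<and> verts G0 \<subseteq> U \<and> (step_within U)\<^sup>*\<^sup>* G0 G)"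

lemma steps_within_steps: "(step_within U)\<^sup>*\<^sup>* G H \<Longrightarrow> generation_step\<^sup>*\<^sup>* G H"
  by (rule rtranclp_mono[THEN predicate2D, rotated]) (auto simp: step_within_def)

lemma steps_within_mono:
  assumes "(step_within U)\<^sup>*\<^sup>* G H" "U \<subseteq> W"
  shows "(step_within W)\<^sup>*\<^sup>* G H"
proof -
  have "step_within U \<le> step_within W"
    using assms(2) by (intro predicate2I) (metis step_within_def order_trans)
  then show ?thesis using rtranclp_mono assms(1) by blast
qed

lemma steps_within_verts: "(step_within U)\<^sup>*\<^sup>* G H \<Longrightarrow> verts G \<subseteq> U \<Longrightarrow> verts H \<subseteq> U"
  by (induction rule: rtranclp_induct) (auto simp: step_within_def)

lemma generated_simple:
  assumes "disjoint_base_graphs G0" "(step_within U)\<^sup>*\<^sup>* G0 G"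
  shows "simple_graph G"
  using generated_family[OF steps_within_steps[OF assms(2)] assms(1)] family_union_simple by blast

lemma component_subgraph: "C \<in> components G \<Longrightarrow> verts C \<subseteq> verts G \<and> edges C \<subseteq> edges G"
  by (auto simp: components_def induced_def)

text \<open>A disjoint bystander \<open>K\<close> leaves the components of \<open>G\<close> as they
  are. It must avoid \<open>H\<close> too, so that a new Henneberg vertex does not fall into
  \<open>K\<close>.\<close>

lemma generation_step_union:
  assumes st: "generation_step G H" and G: "simple_graph G" and K: "simple_graph K"
    and dG: "verts G \<inter> verts K = {}" and dH: "verts H \<inter> verts K = {}"
  shows "generation_step (graph_union G K) (graph_union H K)"
  using st
proof cases
  case (henneberg2 C u w z v)
  have C: "C \<in> components (graph_union G K)" using components_union[OF G K dG] henneberg2(2) by blast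
  have "v \<notin> verts K" using dH henneberg2(1) by auto
  then have v: "v \<notin> verts (graph_union G K)" using henneberg2(6) by (simp add: graph_union_def)
  have "{u, w} \<in> edges G" using component_subgraph[OF henneberg2(2)] henneberg2(3) by blast
  then have "{u, w} \<notin> edges K"
    using simple_edge_props[OF G, of "{u, w}"] simple_edge_props(1)[OF K, of "{u, w}"] dG by blast
  then have "edges G - {{u, w}} \<union> {{v, u}, {v, w}, {v, z}} \<union> edges K
      = edges G \<union> edges K - {{u, w}} \<union> {{v, u}, {v, w}, {v, z}}" by blast
  then have "graph_union H K = Graph (insert v (verts (graph_union G K)))
      (edges (graph_union G K) - {{u, w}} \<union> {{v, u}, {v, w}, {v, z}})"
    unfolding henneberg2(1) graph_union_def ugraph.sel by simp
  then show ?thesis using generation_step.henneberg2[OF C henneberg2(3,4,5) v] by simp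
next
  case (join G1 G2 H')
  have C: "G1 \<in> components (graph_union G K)" "G2 \<in> components (graph_union G K)"
    using components_union[OF G K dG] join(2,3) by blast+
  let ?S = "verts G1 \<union> verts G2"
  have S: "?S \<inter> verts K = {}" using component_subgraph join(2,3) dG by blast
  have "e \<inter> ?S = {}" if "e \<in> edges K" for e
    using simple_edge_props(1)[OF K that] S by blast
  then have "{e \<in> edges G \<union> edges K. e \<inter> ?S = {}} = {e \<in> edges G. e \<inter> ?S = {}} \<union> edges K" by blast
  moreover have "verts G \<union> verts K - ?S = (verts G - ?S) \<union> verts K" using S by blast
  ultimately have "graph_union H K = graph_union (delete_verts (graph_union G K) ?S) H'"
    unfolding join(1) graph_union_def delete_verts_def ugraph.sel by (simp add: Un_ac)
  then show ?thesis using generation_step.join[OF C join(4,5)] by simp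
qed

lemma steps_within_union:
  assumes "(step_within U)\<^sup>*\<^sup>* G0 G" and G0: "disjoint_base_graphs G0" "verts G0 \<subseteq> U"
    and K: "simple_graph K" "verts K \<inter> U = {}"
  shows "(step_within (U \<union> verts K))\<^sup>*\<^sup>* (graph_union G0 K) (graph_union G K)"
  using assms(1)
proof (induction rule: rtranclp_induct)
  case base
  show ?case by simp
next
  case (step G H)
  have "verts G \<subseteq> U" using steps_within_verts[OF step(1) G0(2)] .
  then have "generation_step (graph_union G K) (graph_union H K)"
    using step(2) K generated_simple[OF G0(1) step(1)]
    by (intro generation_step_union) (auto simp: step_within_def)
  then have "step_within (U \<union> verts K) (graph_union G K) (graph_union H K)"
    using step(2) by (auto simp: step_within_def graph_union_def)
  then show ?case using step(3) by (rule rtranclp.rtrancl_into_rtrancl[rotated])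
qed

lemma disjoint_base_graphs_iff:
  "disjoint_base_graphs G \<longleftrightarrow> (\<exists>\<B>. finite \<B> \<and> (\<forall>B\<in>\<B>. base_graph B) \<and>
     (\<forall>A\<in>\<B>. \<forall>B\<in>\<B>. A \<noteq> B \<longrightarrow> verts A \<inter> verts B = {}) \<and> G = family_union \<B>)"
  by (simp add: disjoint_base_graphs_def family_union_def)

lemma disjoint_base_graphs_union:
  assumes "disjoint_base_graphs G" "disjoint_base_graphs H" "verts G \<inter> verts H = {}"
  shows "disjoint_base_graphs (graph_union G H)"
proof -
  from assms(1)[unfolded disjoint_base_graphs_iff]
  obtain \<B> where B: "finite \<B>" "\<forall>B\<in>\<B>. base_graph B"
    "\<forall>A\<in>\<B>. \<forall>B\<in>\<B>. A \<noteq> B \<longrightarrow> verts A \<inter> verts B = {}" "G = family_union \<B>"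
    by (elim exE conjE)
  from assms(2)[unfolded disjoint_base_graphs_iff]
  obtain \<D> where D: "finite \<D>" "\<forall>B\<in>\<D>. base_graph B"
    "\<forall>A\<in>\<D>. \<forall>B\<in>\<D>. A \<noteq> B \<longrightarrow> verts A \<inter> verts B = {}" "H = family_union \<D>"
    by (elim exE conjE)
  have BD: "verts A \<inter> verts B = {}" if "A \<in> \<B>" "B \<in> \<D>" for A B
    using assms(3) that unfolding B(4) D(4) family_union_def by auto
  show ?thesis unfolding disjoint_base_graphs_iff
  proof (intro exI[of _ "\<B> \<union> \<D>"] conjI ballI impI)
    show "finite (\<B> \<union> \<D>)" using B(1) D(1) by simp
    show "base_graph B" if "B \<in> \<B> \<union> \<D>" for B using that B(2) D(2) by blast
    show "verts A \<inter> verts B = {}" if m: "A \<in> \<B> \<union> \<D>" "B \<in> \<B> \<union> \<D>" "A \<noteq> B" for A B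
    proof -
      consider "A \<in> \<B>" "B \<in> \<B>" | "A \<in> \<D>" "B \<in> \<D>" | "A \<in> \<B>" "B \<in> \<D>" | "B \<in> \<B>" "A \<in> \<D>"
        using m(1,2) by blast
      then show ?thesis
      proof cases
        case 1
        then show ?thesis using B(3) m(3) by simp
      next
        case 2
        then show ?thesis using D(3) m(3) by simp
      next
        case 3
        then show ?thesis by (rule BD)
      next
        case 4
        then have "verts B \<inter> verts A = {}" by (rule BD)
        then show ?thesis by (simp add: Int_commute)
      qed
    qed
    show "graph_union G H = family_union (\<B> \<union> \<D>)" unfolding B(4) D(4) by (auto simp: family_union_def graph_union_def)
  qed
qed

lemma graph_union_commute: "graph_union G H = graph_union H G"
  by (simp add: graph_union_def Un_commute)

text \<open>First \<open>G\<close> is generated with the base graphs of \<open>H\<close> standing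
  by, then \<open>H\<close> with the finished \<open>G\<close> standing by; the disjoint vertex sets
  rule out collisions.\<close>

lemma generated_within_union:
  assumes "generated_within U G" "generated_within W H" and dis: "U \<inter> W = {}"
  shows "generated_within (U \<union> W) (graph_union G H)"
proof -
  obtain G0 where G: "disjoint_base_graphs G0" "verts G0 \<subseteq> U" "(step_within U)\<^sup>*\<^sup>* G0 G"
    using assms(1) by (auto simp: generated_within_def)
  obtain H0 where H: "disjoint_base_graphs H0" "verts H0 \<subseteq> W" "(step_within W)\<^sup>*\<^sup>* H0 H"
    using assms(2) by (auto simp: generated_within_def)
  have s: "simple_graph H0" "simple_graph G"
    using generated_simple[OF H(1) rtranclp.rtrancl_refl] generated_simple[OF G(1,3)] by auto
  have v: "verts G \<subseteq> U" using steps_within_verts[OF G(3,2)] .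
  have 1: "(step_within (U \<union> verts H0))\<^sup>*\<^sup>* (graph_union G0 H0) (graph_union G H0)"
    by (rule steps_within_union[OF G(3,1,2) s(1)]) (use H(2) dis in auto)
  have 2: "(step_within (W \<union> verts G))\<^sup>*\<^sup>* (graph_union H0 G) (graph_union H G)"
    by (rule steps_within_union[OF H(3,1,2) s(2)]) (use v dis in auto)
  have "(step_within (U \<union> W))\<^sup>*\<^sup>* (graph_union G0 H0) (graph_union G H)"
    using steps_within_mono[OF 1, of "U \<union> W"] steps_within_mono[OF 2, of "U \<union> W"] H(2) v
    unfolding graph_union_commute[of _ G] by (metis Un_mono Un_commute order_refl rtranclp_trans)
  moreover have "disjoint_base_graphs (graph_union G0 H0)"
    by (rule disjoint_base_graphs_union[OF G(1) H(1)]) (use G(2) H(2) dis in auto)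
  moreover have "verts (graph_union G0 H0) \<subseteq> U \<union> W" using G(2) H(2) by (auto simp: graph_union_def)
  ultimately show ?thesis unfolding generated_within_def by blast
qed

lemma generated_within_step:
  assumes "generated_within U G" "generation_step G H" "verts H \<subseteq> U"
  shows "generated_within U H"
proof -
  obtain G0 where G0: "disjoint_base_graphs G0" "verts G0 \<subseteq> U" "(step_within U)\<^sup>*\<^sup>* G0 G"
    using assms(1) by (auto simp: generated_within_def)
  have "step_within U G H" using assms(2,3) by (simp add: step_within_def)
  with G0(3) have "(step_within U)\<^sup>*\<^sup>* G0 H" by (rule rtranclp.rtrancl_into_rtrancl)
  then show ?thesis using G0(1,2) unfolding generated_within_def by blast
qed

lemma generated_within_mono: "generated_within U G \<Longrightarrow> U \<subseteq> W \<Longrightarrow> generated_within W G"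
  unfolding generated_within_def using steps_within_mono by blast

lemma generated_within_base:
  assumes "base_graph G" "verts G \<subseteq> U"
  shows "generated_within U G"
proof -
  have "disjoint_base_graphs G"
    unfolding disjoint_base_graphs_iff using assms(1) by (intro exI[of _ "{G}"]) (simp add: family_union_def)
  then show ?thesis using assms(2) unfolding generated_within_def by blast
qed

lemma generated_within_join:
  assumes "generated_within U G1" "generated_within W G2" "U \<inter> W = {}"
    and c: "circuit G1" "circuit G2" and j: "is_join G1 G2 H" and d: "verts G1 \<inter> verts G2 = {}"
    and H: "verts H \<subseteq> U \<union> W"
  shows "generated_within (U \<union> W) H"
proof -
  let ?G = "graph_union G1 G2"
  have s: "simple_graph G1" "simple_graph G2" using c circuit_simple by auto
  have comp: "components G1 = {G1}" "components G2 = {G2}"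
    using connected_components circuit_connected circuit_simple c by blast+
  have m: "G1 \<in> components ?G" "G2 \<in> components ?G"
    using components_union[OF s d] components_union[OF s(2,1)] d comp
    unfolding graph_union_commute[of G2] by (auto simp: Int_commute)
  have ne: "G1 \<noteq> G2" using d circuit_connected[OF c(1)] by (auto simp: connected_graph_def)
  have "e \<inter> (verts G1 \<union> verts G2) \<noteq> {}" if "e \<in> edges G1 \<union> edges G2" for e
    using simple_edge_props[OF s(1), of e] simple_edge_props[OF s(2), of e] that by blast
  then have "{e \<in> edges G1 \<union> edges G2. e \<inter> (verts G1 \<union> verts G2) = {}} = {}" by blast
  then have "graph_union (delete_verts ?G (verts G1 \<union> verts G2)) H = H"
    by (simp only: graph_union_def delete_verts_def ugraph.sel) simp
  then have "generation_step ?G H" using generation_step.join[OF m ne j] by simp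
  then show ?thesis using generated_within_step generated_within_union[OF assms(1-3)] H by blast
qed

section \<open>From the reductions of a circuit to its generation\<close>

lemma infinite_split:
  assumes U: "infinite U" and S: "finite S" "finite T" "S \<subseteq> U" "T \<subseteq> U" "S \<inter> T = {}"
  obtains U1 U2 where "infinite U1" "infinite U2" "S \<subseteq> U1" "T \<subseteq> U2" "U1 \<inter> U2 = {}" "U1 \<union> U2 \<subseteq> U"
proof -
  have "infinite (U - S - T)" using U S by simp
  then obtain f :: "nat \<Rightarrow> _" where f: "inj f" "range f \<subseteq> U - S - T"
    using infinite_countable_subset by blast
  \<comment> \<open>Even and odd terms of a sequence in \<open>U\<close> provide a separate infinite
    supply of fresh vertices for each part.\<close>
  let ?e = "range (\<lambda>n. f (2 * n))" and ?o = "range (\<lambda>n. f (2 * n + 1))"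
  have inf: "infinite (range g)" if "inj g" for g :: "nat \<Rightarrow> 'a"
    using that finite_imageD[of g UNIV] by auto
  have "inj (\<lambda>n. f (2 * n))" "inj (\<lambda>n. f (2 * n + 1))"
    by (rule injI, drule injD[OF f(1)], simp)+
  then have i: "infinite ?e" "infinite ?o" using inf by blast+
  have "f (2 * n) \<noteq> f (2 * m + 1)" for n m
  proof
    assume "f (2 * n) = f (2 * m + 1)"
    then have "2 * n = 2 * m + 1" by (rule injD[OF f(1)])
    then show False by presburger
  qed
  then have d: "?e \<inter> ?o = {}" by blast
  have sub: "?e \<subseteq> U - S - T" "?o \<subseteq> U - S - T" using f(2) by blast+
  show thesis
  proof (rule that)
    show "infinite (S \<union> ?e)" "infinite (T \<union> ?o)" using i by simp_all
    show "(S \<union> ?e) \<inter> (T \<union> ?o) = {}" using d sub S(5) by blast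
    show "S \<union> ?e \<union> (T \<union> ?o) \<subseteq> U" using sub S(3,4) by blast
  qed simp_all
qed

lemma circuit_Graph_iff: "circuit (Graph V E) \<longleftrightarrow> circuit_on V E"
  by (simp add: circuit_iff_circuit_on)

lemma fresh_vertex:
  assumes "infinite U" "finite S"
  obtains x where "x \<in> U" "x \<notin> S"
  using assms by (metis Diff_infinite_finite equals0I finite.emptyI DiffD1 DiffD2)

lemma delete_extension:
  assumes "graph_on R F" "c \<notin> R" "d \<notin> R"
  shows "delete_verts (Graph (insert d (insert c R)) (F \<union> K4_star a b c d)) {c, d} = Graph R F"
proof -
  have "e \<inter> {c, d} = {}" if "e \<in> F" for e using assms that by (auto simp: graph_on_def)
  then have "{e \<in> F \<union> K4_star a b c d. e \<inter> {c, d} = {}} = F" by auto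
  moreover have "insert d (insert c R) - {c, d} = R" using assms by auto
  ultimately show ?thesis unfolding delete_verts_def ugraph.sel by simp
qed

text \<open>Joins need disjoint operands, but the two sides of a cut share \<open>a\<close> and
  \<open>b\<close>. So the second side gets fresh names for these two vertices, chosen outside
  \<open>W\<close>, and a fresh K_4 end; all other vertices keep their names, and renaming back
  recovers the side. The two final equations serve the 2-join and the 1-join.\<close>

lemma side_copy:
  assumes S: "tight_side R F a b" and U: "infinite U" and W: "finite W" "R \<subseteq> W"
  obtains a2 b2 c2 d2 G2 where
    "circuit G2" "card (verts G2) = card R + 2" "verts G2 \<subseteq> (R - {a, b}) \<union> (U - W)"
    "K4_end G2 a2 b2 c2 d2"
    "rename (id(a2 := a, b2 := b)) (delete_verts G2 {c2, d2}) = Graph R F"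
    "rename (id(a2 := a, b2 := b)) (delete_edge (delete_verts G2 {c2, d2}) {a2, b2}) = Graph R (F - {{a, b}})"
proof -
  note S' = tight_sideD[OF S]
  obtain a2 where a2: "a2 \<in> U" "a2 \<notin> W" using fresh_vertex[OF U W(1)] .
  obtain b2 where b2: "b2 \<in> U" "b2 \<notin> insert a2 W" using fresh_vertex[OF U] W(1) by (metis finite_insert)
  obtain c2 where c2: "c2 \<in> U" "c2 \<notin> insert b2 (insert a2 W)" using fresh_vertex[OF U] W(1) by (metis finite_insert)
  obtain d2 where d2: "d2 \<in> U" "d2 \<notin> insert c2 (insert b2 (insert a2 W))" using fresh_vertex[OF U] W(1) by (metis finite_insert)
  let ?s = "id(a := a2, b := b2)" and ?t = "id(a2 := a, b2 := b)"
  have nR: "a2 \<notin> R" "b2 \<notin> R" "a2 \<noteq> b2" using a2 b2 W by auto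
  have inj: "inj_on ?s R" by (rule inj_on_glue[OF nR])
  have s: "?s a = a2" "?s b = b2" using S'(4) by auto
  have im: "?s ` R = (R - {a, b}) \<union> {a2, b2}" by (rule image_glue[OF S'(6,7,4)])
  have T: "tight_side (?s ` R) ((`) ?s ` F) a2 b2" using tight_side_rename[OF S inj] unfolding s .
  have cd: "c2 \<notin> ?s ` R" "d2 \<notin> ?s ` R" "c2 \<noteq> d2" unfolding im using c2 d2 W(2) by auto
  let ?G = "Graph (insert d2 (insert c2 (?s ` R))) ((`) ?s ` F \<union> K4_star a2 b2 c2 d2)"
  note E = tight_side_extend[OF T cd]
  have cG: "circuit ?G" using E(1) by (simp add: circuit_Graph_iff)
  have K: "K4_end ?G a2 b2 c2 d2" using K4_end_edges_imp_K4_end[OF cG] E(2) by simp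
  have del: "delete_verts ?G {c2, d2} = rename ?s (Graph R F)"
    using delete_extension[OF tight_sideD(1)[OF T] cd(1,2), of a2 b2] by (simp add: rename_def)
  have ts: "?t (?s x) = x" if "x \<in> R" for x using that nR by auto
  have sR: "simple_graph (Graph R F)" using S'(1) by (simp add: simple_graph_iff_graph_on)
  then have sR': "simple_graph (Graph R (F - {{a, b}}))" by (simp add: simple_graph_def)
  have r1: "rename ?t (delete_verts ?G {c2, d2}) = Graph R F"
    unfolding del by (rule rename_inverse[OF sR]) (use ts in simp)
  have "inj_on ((`) ?s) F"
    using inj_on_image_Pow[OF inj] by (rule inj_on_subset) (use S'(1) in \<open>auto simp: graph_on_def\<close>)
  then have "(`) ?s ` (F - {{a, b}}) = (`) ?s ` F - {?s ` {a, b}}"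
    using inj_on_image_set_diff[of "(`) ?s" F F "{{a, b}}"] S'(5) by simp
  moreover have "?s ` {a, b} = {a2, b2}" by (simp only: image_insert image_empty s)
  ultimately have "delete_edge (delete_verts ?G {c2, d2}) {a2, b2} = rename ?s (Graph R (F - {{a, b}}))"
    unfolding del by (simp only: delete_edge_def rename_def ugraph.sel)
  then have r2: "rename ?t (delete_edge (delete_verts ?G {c2, d2}) {a2, b2}) = Graph R (F - {{a, b}})"
    using rename_inverse[OF sR', of ?t ?s] ts by simp
  have "card (verts ?G) = card R + 2" using cd card_image[OF inj] S'(2) by simp
  moreover have "verts ?G \<subseteq> (R - {a, b}) \<union> (U - W)" unfolding ugraph.sel im using a2 b2 c2 d2 by auto
  ultimately show thesis using that[OF cG _ _ K r1 r2] by blast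
qed

text \<open>The induction hypothesis covers every infinite \<open>W\<close> because the two operands
  of a join are generated in disjoint infinite parts of \<open>U\<close>.\<close>

locale generation_induction = circuit_graph V E for V :: "'v set" and E +
  fixes U :: "'v set"
  assumes IH: "\<And>(G :: 'v ugraph) W. circuit G \<Longrightarrow> card (verts G) < card V \<Longrightarrow> infinite W \<Longrightarrow> verts G \<subseteq> W \<Longrightarrow> generated_within W G"
    and U: "infinite U" "V \<subseteq> U"
begin

lemma join_generated:
  assumes G1: "circuit G1" "card (verts G1) < card V" "verts G1 \<subseteq> U"
    and G2: "circuit G2" "card (verts G2) < card V" "verts G2 \<subseteq> U"
    and d: "verts G1 \<inter> verts G2 = {}" and j: "is_join G1 G2 (Graph V E)"
  shows "generated_within U (Graph V E)"
proof -
  have f: "finite (verts G1)" "finite (verts G2)"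
    using circuit_simple G1(1) G2(1) by (auto simp: simple_graph_def)
  obtain U1 U2 where W: "infinite U1" "infinite U2" "verts G1 \<subseteq> U1" "verts G2 \<subseteq> U2" "U1 \<inter> U2 = {}" "U1 \<union> U2 \<subseteq> U"
    using infinite_split[OF U(1) f G1(3) G2(3) d] .
  have "V \<subseteq> U1 \<union> U2" using is_join_circuit(2)[OF j] W(3,4) by auto
  then have "generated_within (U1 \<union> U2) (Graph V E)"
    using generated_within_join[OF IH[OF G1(1,2) W(1,3)] IH[OF G2(1,2) W(2,4)] W(5) G1(1) G2(1) j d] by simp
  then show ?thesis using generated_within_mono W(6) by blast
qed

lemma henneberg2_generated:
  assumes w: "w \<in> V" "nbrs E w = {x, y, z}" "x \<noteq> y" "x \<noteq> z" "y \<noteq> z" and xy: "{x, y} \<notin> E"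
    and C: "circuit_on (V - {w}) (insert {x, y} {e \<in> E. w \<notin> e})"
  shows "generated_within U (Graph V E)"
proof -
  let ?G = "Graph (V - {w}) (insert {x, y} {e \<in> E. w \<notin> e})"
  have c: "circuit ?G" using C by (simp add: circuit_Graph_iff)
  have "card (V - {w}) < card V" using w(1) finV by (metis card_Diff1_less)
  then have gen: "generated_within U ?G" by (intro IH[OF c _ U(1)]) (use U in auto)
  have comp: "?G \<in> components ?G"
    using connected_components[OF circuit_simple circuit_connected] c by blast
  have zG: "z \<in> verts ?G" using w(2) nbrs_V[of w] nbrs_irrefl[of w] by auto
  have "generation_step ?G (Graph (insert w (verts ?G)) (edges ?G - {{x, y}} \<union> {{w, x}, {w, y}, {w, z}}))"
    by (rule generation_step.henneberg2[OF comp _ zG]) (use w in auto)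
  moreover have "edges ?G - {{x, y}} \<union> {{w, x}, {w, y}, {w, z}} = E"
  proof -
    have "{{w, x}, {w, y}, {w, z}} = {e \<in> E. w \<in> e}"
      using edges_at_eq[OF graph_on, of w] w(2) by simp
    then show ?thesis using xy by auto
  qed
  moreover have "insert w (verts ?G) = V" using w(1) by auto
  ultimately have "generation_step ?G (Graph V E)" by simp
  then show ?thesis using generated_within_step[OF gen] U by simp
qed

lemma three_edge_cut_generated:
  assumes A: "tight A" "tight (V - A)" "2 \<le> card A" "2 \<le> card (V - A)"
    and cr: "cross E A (V - A) = {{a1, a2}, {b1, b2}, {c1, c2}}"
    and m: "{a1, b1, c1} \<subseteq> A" "{a2, b2, c2} \<subseteq> V - A"
    and d: "card {a1, b1, c1} = 3" "card {a2, b2, c2} = 3"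
  shows "generated_within U (Graph V E)"
proof -
  let ?B = "V - A"
  have AV: "A \<subseteq> V" "V - ?B = A" using A(1) by (auto simp: tight_def)
  have fA: "finite A" "finite ?B" using tight_finite A by auto
  have N1: "node_side A {e \<in> E. e \<subseteq> A} a1 b1 c1" by (rule cut_node_side[OF A(1,2) cr m d])
  have cr': "cross E ?B (V - ?B) = {{a2, a1}, {b2, b1}, {c2, c1}}"
    unfolding AV cross_commute[of E ?B] cr by (simp add: insert_commute)
  have N2: "node_side ?B {e \<in> E. e \<subseteq> ?B} a2 b2 c2"
    by (rule cut_node_side[OF A(2) _ cr' m(2) _ d(2,1)]) (use A m AV in auto)
  obtain v1 where v1: "v1 \<in> U" "v1 \<notin> V" using fresh_vertex[OF U(1) finV] .
  obtain v2 where v2: "v2 \<in> U" "v2 \<notin> insert v1 V" using fresh_vertex[OF U(1)] finV by (metis finite_insert)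
  have nv: "v1 \<notin> A" "v2 \<notin> ?B" using v1 v2 AV by auto
  let ?F1 = "{e \<in> E. e \<subseteq> A}" and ?F2 = "{e \<in> E. e \<subseteq> ?B}"
  let ?G1 = "Graph (insert v1 A) (?F1 \<union> {{v1, a1}, {v1, b1}, {v1, c1}})"
  let ?G2 = "Graph (insert v2 ?B) (?F2 \<union> {{v2, a2}, {v2, b2}, {v2, c2}})"
  note C1 = node_side_circuit_on[OF N1 nv(1)] and C2 = node_side_circuit_on[OF N2 nv(2)]
  have c: "circuit ?G1" "circuit ?G2" using C1(1) C2(1) by (simp_all add: circuit_Graph_iff)
  have dis: "verts ?G1 \<inter> verts ?G2 = {}" using v1 v2 AV by auto
  have n1: "neighbours ?G1 v1 = {a1, b1, c1}" "degree ?G1 v1 = 3"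
    using C1(2) d(1) degree_eq_card_nbrs[OF circuit_simple[OF c(1)], of v1] by (simp_all add: neighbours_eq_nbrs)
  have n2: "neighbours ?G2 v2 = {a2, b2, c2}" "degree ?G2 v2 = 3"
    using C2(2) d(2) degree_eq_card_nbrs[OF circuit_simple[OF c(2)], of v2] by (simp_all add: neighbours_eq_nbrs)
  let ?H = "add_edges (graph_union (delete_verts ?G1 {v1}) (delete_verts ?G2 {v2})) {{a1, a2}, {b1, b2}, {c1, c2}}"
  have "is_join ?G1 ?G2 ?H"
    by (rule is_join.join3[OF c dis _ n1(2,1) _ n2(2,1)]) simp_all
  moreover have "?H = Graph V E"
  proof -
    have D1: "delete_verts ?G1 {v1} = Graph A ?F1"
    proof -
      have "{e \<in> ?F1 \<union> {{v1, a1}, {v1, b1}, {v1, c1}}. e \<inter> {v1} = {}} = ?F1" using nv by auto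
      moreover have "insert v1 A - {v1} = A" using nv by simp
      ultimately show ?thesis unfolding delete_verts_def ugraph.sel by simp
    qed
    have D2: "delete_verts ?G2 {v2} = Graph ?B ?F2"
    proof -
      have "{e \<in> ?F2 \<union> {{v2, a2}, {v2, b2}, {v2, c2}}. e \<inter> {v2} = {}} = ?F2" using nv v2 by auto
      moreover have "insert v2 ?B - {v2} = ?B" using nv by (metis Diff_insert_absorb)
      ultimately show ?thesis unfolding delete_verts_def ugraph.sel by simp
    qed
    have "E = ?F1 \<union> ?F2 \<union> cross E A ?B"
    proof -
      have "e \<subseteq> V" if "e \<in> E" for e using graph_on that by (simp add: graph_on_def)
      then show ?thesis unfolding cross_def by blast
    qed
    moreover have "A \<union> ?B = V" using AV by blast
    ultimately show ?thesis unfolding D1 D2 cr[symmetric] add_edges_def graph_union_def ugraph.sel by simp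
  qed
  ultimately have j: "is_join ?G1 ?G2 (Graph V E)" by simp
  have cV: "card V = card A + card ?B" using AV(1) finV
    by (metis card_Diff_subset card_mono finite_subset le_add_diff_inverse)
  show ?thesis
  proof (rule join_generated[OF c(1) _ _ c(2) _ _ dis j])
    \<comment> \<open>Each operand trades a side of at least two vertices for a single new
      vertex.\<close>
    show "card (verts ?G1) < card V" "card (verts ?G2) < card V"
      using cV A(3,4) nv fA by simp_all
    show "verts ?G1 \<subseteq> U" "verts ?G2 \<subseteq> U" using v1 v2 U AV by auto
  qed
qed

lemma two_cut_edges:
  assumes "two_vertex_cut V E A B a b"
  shows "{e \<in> E. e \<subseteq> A \<union> {a, b}} \<union> {e \<in> E. e \<subseteq> B \<union> {a, b}} = E"
proof -
  interpret two_vertex_cut V E A B a b by (rule assms)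
  have "e \<subseteq> P \<or> e \<subseteq> R" if e: "e \<in> E" for e
  proof -
    obtain x y where xy: "e = {x, y}" "x \<in> V" "y \<in> V" using graph_on_edgeE[OF graph_on e] by blast
    have "\<not> (x \<in> A \<and> y \<in> B)" "\<not> (x \<in> B \<and> y \<in> A)"
      using sep[of x y] sep[of y x] e xy(1) by (auto simp: insert_commute)
    then show ?thesis using xy V by blast
  qed
  then show ?thesis by blast
qed

lemma nonadjacent_two_cut_generated:
  assumes cut: "two_vertex_cut V E A B a b" and ab: "{a, b} \<notin> E"
    and t: "spanned E (A \<union> {a, b}) = 2 * int (card (A \<union> {a, b})) - 2"
  shows "generated_within U (Graph V E)"
proof -
  interpret two_vertex_cut V E A B a b by (rule cut)
  interpret sw: two_vertex_cut V E B A a b by (rule swap)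
  let ?E1 = "insert {a, b} {e \<in> E. e \<subseteq> P}" and ?E2 = "insert {a, b} {e \<in> E. e \<subseteq> R}"
  let ?G1 = "Graph P ?E1"
  have c1: "circuit ?G1" using nonadjacent_circuit_side[OF ab t] by (simp add: circuit_Graph_iff)
  have "spanned E R = 2 * int (card R) - 3" using nonedge_sides[OF ab] t by linarith
  then have S: "tight_side R ?E2 a b" by (rule sw.nonadjacent_tight_side[OF ab])
  obtain a2 b2 c2 d2 G2 where G2: "circuit G2" "card (verts G2) = card R + 2" "verts G2 \<subseteq> (R - {a, b}) \<union> (U - V)"
    "K4_end G2 a2 b2 c2 d2"
    "rename (id(a2 := a, b2 := b)) (delete_verts G2 {c2, d2}) = Graph R ?E2"
    "rename (id(a2 := a, b2 := b)) (delete_edge (delete_verts G2 {c2, d2}) {a2, b2}) = Graph R (?E2 - {{a, b}})"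
    using side_copy[OF S U(1) finV PR(6)] .
  have dis: "verts ?G1 \<inter> verts G2 = {}" using G2(3) PR(5) AB nab by auto
  have "is_join ?G1 G2 (graph_union (delete_edge ?G1 {a, b}) (Graph R (?E2 - {{a, b}})))"
    using is_join.join1[OF c1 G2(1) dis _ G2(4), of a b] unfolding G2(6) by simp
  moreover have "?E1 - {{a, b}} \<union> (?E2 - {{a, b}}) = E" using two_cut_edges[OF cut] ab by blast
  then have "graph_union (delete_edge ?G1 {a, b}) (Graph R (?E2 - {{a, b}})) = Graph V E"
    unfolding graph_union_def delete_edge_def ugraph.sel PR(1) by simp
  ultimately have j: "is_join ?G1 G2 (Graph V E)" by simp
  \<comment> \<open>The second operand has |R| + 2 = |V| + 4 - |P| vertices, so it is smaller than
    the circuit only if |P| > 4; this holds because \<open>P\<close> carries a circuit.\<close>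
  have "5 \<le> card P" using circuit_graph.card_V_ge[of P ?E1] nonadjacent_circuit_side[OF ab t] by (simp add: circuit_graph_def)
  then have "card R + 2 < card V" using card_PR by linarith
  moreover have "card P < card V" using PR(5,7) finV by (simp add: psubset_card_mono psubsetI)
  moreover have "verts ?G1 \<subseteq> U" "verts G2 \<subseteq> U" using PR(5,6) U(2) G2(3) by auto
  ultimately show ?thesis using join_generated[OF c1 _ _ G2(1) _ _ dis j] G2(2) by simp
qed

lemma two_cut_generated:
  assumes cut: "two_vertex_cut V E A B a b" and n: "{a, b} \<notin> E \<or> card A \<noteq> 2 \<and> card B \<noteq> 2"
  shows "generated_within U (Graph V E)"
proof -
  interpret two_vertex_cut V E A B a b by (rule cut)
  interpret sw: two_vertex_cut V E B A a b by (rule swap)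
  show ?thesis
  proof (cases "{a, b} \<in> E")
    case False
    then show ?thesis using nonedge_sides[OF False] nonadjacent_two_cut_generated[OF cut False]
        nonadjacent_two_cut_generated[OF swap False] by blast
  next
    case True
    then have n2: "card A \<noteq> 2" "card B \<noteq> 2" using n by auto
    let ?E1 = "{e \<in> E. e \<subseteq> P}" and ?E2 = "{e \<in> E. e \<subseteq> R}"
    note S1 = tight_side_P[OF True] and S2 = sw.tight_side_P[OF True]
    note S1' = tight_sideD[OF S1(1)]
    have cP: "card P = card A + 2" "card R = card B + 2"
      using fin nab by (subst card_Un_disjoint, auto)+
    have "4 \<le> card P" "4 \<le> card R"
      using tight_card_ge_4[OF S1(2)] tight_card_ge_4[OF S2(2)] cP by auto
    \<comment> \<open>Each side is completed by two new vertices, so it becomes smaller than the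
      circuit only if the opposite side has more than two vertices besides \<open>a, b\<close>:
      tightness gives at least two, and two is excluded.\<close>
    then have big: "card P + 2 < card V" "card R + 2 < card V" using cP n2 card_PR by linarith+
    obtain c1 where c1: "c1 \<in> U" "c1 \<notin> V" using fresh_vertex[OF U(1) finV] .
    obtain d1 where d1: "d1 \<in> U" "d1 \<notin> insert c1 V" using fresh_vertex[OF U(1)] finV by (metis finite_insert)
    have nP: "c1 \<notin> P" "d1 \<notin> P" "c1 \<noteq> d1" using c1 d1 PR(5) by auto
    let ?G1 = "Graph (insert d1 (insert c1 P)) (?E1 \<union> K4_star a b c1 d1)"
    note X = tight_side_extend[OF S1(1) nP]
    have cc1: "circuit ?G1" using X(1) by (simp add: circuit_Graph_iff)
    have K1: "K4_end ?G1 a b c1 d1" using K4_end_edges_imp_K4_end[OF cc1] X(2) by simp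
    have del: "delete_verts ?G1 {c1, d1} = Graph P ?E1" by (rule delete_extension[OF S1'(1) nP(1,2)])
    have fW: "finite (V \<union> {c1, d1})" "R \<subseteq> V \<union> {c1, d1}" using finV PR(6) by auto
    obtain a2 b2 c2 d2 G2 where G2: "circuit G2" "card (verts G2) = card R + 2"
      "verts G2 \<subseteq> (R - {a, b}) \<union> (U - (V \<union> {c1, d1}))" "K4_end G2 a2 b2 c2 d2"
      "rename (id(a2 := a, b2 := b)) (delete_verts G2 {c2, d2}) = Graph R ?E2"
      "rename (id(a2 := a, b2 := b)) (delete_edge (delete_verts G2 {c2, d2}) {a2, b2}) = Graph R (?E2 - {{a, b}})"
      using side_copy[OF S2(1) U(1) fW] .
    have dis: "verts ?G1 \<inter> verts G2 = {}"
    proof -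
      have "R - {a, b} = B" using nab by blast
      moreover have "P \<inter> B = {}" "c1 \<notin> B" "d1 \<notin> B" using AB nab c1(2) d1(2) PR(6) by auto
      ultimately show ?thesis using G2(3) PR(5) by auto
    qed
    have "is_join ?G1 G2 (graph_union (Graph P ?E1) (Graph R ?E2))"
      using is_join.join2[OF cc1 G2(1) dis K1 G2(4)] unfolding G2(5) del .
    moreover have "graph_union (Graph P ?E1) (Graph R ?E2) = Graph V E"
      unfolding graph_union_def ugraph.sel PR(1) two_cut_edges[OF cut] ..
    ultimately have j: "is_join ?G1 G2 (Graph V E)" by simp
    have "card (verts ?G1) < card V" using big(1) nP S1'(2) by simp
    moreover have "verts ?G1 \<subseteq> U" "verts G2 \<subseteq> U" using PR(5,6) U(2) c1 d1 G2(3) by auto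
    ultimately show ?thesis using join_generated[OF cc1 _ _ G2(1) _ _ dis j] G2(2) big(2) by simp
  qed
qed

text \<open>Every reduction expresses the circuit through smaller circuits, generated by induction;
  a circuit that is not generated would thus be irreducible.\<close>

theorem generated: "generated_within U (Graph V E)"
proof (rule ccontr)
  assume no: "\<not> generated_within U (Graph V E)"
  have "irreducible_circuit V E"
  proof unfold_locales
    show "\<not> base_graph (Graph V E)" using no generated_within_base[of "Graph V E" U] U(2) by auto
    show "\<not> circuit_on (V - {w}) (insert {x, y} {e \<in> E. w \<notin> e})"
      if "w \<in> V" "nbrs E w = {x, y, z}" "x \<noteq> y" "x \<noteq> z" "y \<noteq> z" "{x, y} \<notin> E" for w x y z
      using henneberg2_generated[OF that] no by blast
    show "{a, b} \<in> E \<and> (card A = 2 \<or> card B = 2)"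
      if "V = A \<union> B \<union> {a, b}" "A \<inter> B = {}" "{a, b} \<inter> (A \<union> B) = {}" "a \<noteq> b" "A \<noteq> {}" "B \<noteq> {}"
        "\<And>x y. x \<in> A \<Longrightarrow> y \<in> B \<Longrightarrow> {x, y} \<notin> E" for A B a b
    proof -
      have "two_vertex_cut V E A B a b" by unfold_locales (rule that; assumption)+
      then show ?thesis using two_cut_generated no by blast
    qed
    show False
      if "tight A" "tight (V - A)" "2 \<le> card A" "2 \<le> card (V - A)"
        "cross E A (V - A) = {{a1, a2}, {b1, b2}, {c1, c2}}" "{a1, b1, c1} \<subseteq> A" "{a2, b2, c2} \<subseteq> V - A"
        "card {a1, b1, c1} = 3" "card {a2, b2, c2} = 3" for A a1 a2 b1 b2 c1 c2
      using three_edge_cut_generated[OF that] no by blast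
  qed
  then show False by (rule irreducible_circuit.no_irreducible_circuit)
qed

end

lemma circuit_generated_within:
  assumes "circuit G" "infinite U" "verts G \<subseteq> U"
  shows "generated_within U G"
  using assms
proof (induction "card (verts G)" arbitrary: G U rule: less_induct)
  case less
  interpret generation_induction "verts G" "edges G" U
    by unfold_locales (use less circuit_iff_circuit_on in auto)
  show ?case using generated by simp
qed

text \<open>The vertex type of \<open>G\<close> may be finite, so the circuit is first copied into
  \<open>nat\<close>, where fresh vertices never run out; the inverse renaming is the required
  isomorphism.\<close>

theorem circuit_recursively_generated:
  assumes "circuit G"
  shows "recursively_generated G"
proof -
  have s: "simple_graph G" using circuit_simple[OF assms] .
  then obtain f :: "'a \<Rightarrow> nat" where f: "inj_on f (verts G)"
    using finite_imp_inj_to_nat_seg unfolding simple_graph_def by metis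
  have "generated_within UNIV (rename f G)"
    using circuit_generated_within[OF circuit_rename[OF assms f]] by simp
  then obtain G0 where G0: "disjoint_base_graphs G0" "(step_within UNIV)\<^sup>*\<^sup>* G0 (rename f G)"
    by (auto simp: generated_within_def)
  let ?g = "the_inv_into (verts G) f"
  have "inj_on ?g (verts (rename f G))" using inj_on_the_inv_into[OF f] by (simp add: rename_def)
  moreover have "G = rename ?g (rename f G)" using rename_inverse[OF s, of ?g f] the_inv_into_f_f[OF f] by simp
  ultimately have "isomorphic (rename f G) G" unfolding isomorphic_def by blast
  then show ?thesis using G0 steps_within_steps unfolding recursively_generated_def by blast
qed

theorem theorem1p2:
  fixes G :: "'v ugraph"
  assumes "simple_graph G"
  shows "circuit G \<longleftrightarrow> connected_graph G \<and> recursively_generated G"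
  using circuit_connected circuit_recursively_generated connected_generated_circuit by blast

end
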